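(* Not all simplicial $3$-spheres are LC (locally constructible); that is, there exists a simplicial $3$-sphere that is not LC.
   Context: All complexes are finite. A simplicial $3$-sphere is a simplicial complex whose underlying space is homeomorphic to the $3$-sphere. LC: A regular CW complex is simplicial if every lower interval $[0,F]$ in its face poset is boolean. A $d$-pseudomanifold is a finite, pure $d$-dimensional, simplicial regular CW complex in which each $(d-1)$-cell belongs to at most two $d$-cells; its boundary is the smallest subcomplex containing all $(d-1)$-cells that lie in exactly one $d$-cell. For $d\ge2$, a local construction for a pure $d$-dimensional simplicial complex $C$ with $N$ facets is a sequence $T_1,\dots,T_N,\dots,T_k$ ($k\ge N$) of $d$-pseudomanifolds such that: (1) $T_1$ is a $d$-simplex; (2) for $i\le N-1$, $T_{i+1}$ is obtained from $T_i$ by gluing a new $d$-simplex to $T_i$ along one of the $(d-1)$-cells of $\partial T_i$; (3) for $i\ge N$, $T_{i+1}$ is obtained from $T_i$ by identifying a pair of $(d-1)$-cells $\sigma,\tau$ in $\partial T_i$ whose intersection contains a $(d-2)$-cell $F$ (the identification being the simplicial one that fixes $F$ pointwise); (4) $T_k=C$. $C$ is LC if a local construction for $C$ exists. *)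

theory Defs
  imports "HOL-Analysis.Analysis" "HOL-Homology.Simplices"
begin

text \<open>
  A complex is a pair of a topology \<open>X\<close> and the set \<open>K\<close> of its nonempty closed cells.
  The type \<open>'a\<close> of points is only a supply of names: the topology \<open>X\<close> is explicit
  and need not be related to any standard topology on \<open>'a\<close>.
\<close>

section \<open>Finite regular CW complexes\<close>

definition ball_topology :: "nat \<Rightarrow> (nat \<Rightarrow> real) topology" where
  "ball_topology n = subtopology (Euclidean_space n) {x. (\<Sum>i<n. (x i)\<^sup>2) \<le> 1}"

definition ball_boundary :: "nat \<Rightarrow> (nat \<Rightarrow> real) set" where
  "ball_boundary n = {x \<in> topspace (ball_topology n). (\<Sum>i<n. (x i)\<^sup>2) = 1}"

definition cell_frontier :: "'a set set \<Rightarrow> 'a set \<Rightarrow> 'a set" where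
  "cell_frontier K c = \<Union>{c' \<in> K. c' \<subset> c}"

text \<open>
  A finite collection of closed balls in a Hausdorff space such that the bounding sphere of each
  ball is a union of members of the collection and the interiors of the balls partition the space.
  (As \<open>K\<close> is finite, the interiors cover the space as soon as the closed cells do.)
  For a 0-cell the bounding sphere is empty.
\<close>
definition regular_CW :: "'a topology \<Rightarrow> 'a set set \<Rightarrow> bool" where
  "regular_CW X K \<longleftrightarrow>
     Hausdorff_space X \<and> finite K \<and> \<Union>K = topspace X \<and>
     (\<forall>c\<in>K. \<exists>n f. homeomorphic_map (ball_topology n) (subtopology X c) f \<and>
                   f ` ball_boundary n = cell_frontier K c) \<and>
     (\<forall>c\<in>K. \<forall>c'\<in>K. c \<noteq> c' \<longrightarrow> disjnt (c - cell_frontier K c) (c' - cell_frontier K c'))"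

definition n_cells :: "nat \<Rightarrow> 'a topology \<Rightarrow> 'a set set \<Rightarrow> 'a set set" where
  "n_cells n X K = {c \<in> K. subtopology X c homeomorphic_space ball_topology n}"

text \<open>
  The face poset is \<open>insert {} K\<close>, ordered by inclusion, with bottom element \<open>{}\<close>.
\<close>
definition lower_interval :: "'a set set \<Rightarrow> 'a set \<Rightarrow> 'a set set" where
  "lower_interval K F = {c \<in> insert {} K. c \<subseteq> F}"

definition boolean_poset :: "'a set set \<Rightarrow> bool" where
  "boolean_poset P \<longleftrightarrow>
     (\<exists>(n::nat) g. bij_betw g (Pow {..<n}) P \<and>
        (\<forall>A \<in> Pow {..<n}. \<forall>B \<in> Pow {..<n}. A \<subseteq> B \<longleftrightarrow> g A \<subseteq> g B))"

definition simplicial_CW :: "'a topology \<Rightarrow> 'a set set \<Rightarrow> bool" where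
  "simplicial_CW X K \<longleftrightarrow>
     regular_CW X K \<and> (\<forall>F \<in> insert {} K. boolean_poset (lower_interval K F))"

definition pure_CW :: "nat \<Rightarrow> 'a topology \<Rightarrow> 'a set set \<Rightarrow> bool" where
  "pure_CW d X K \<longleftrightarrow> K \<noteq> {} \<and> (\<forall>c\<in>K. \<exists>\<Delta> \<in> n_cells d X K. c \<subseteq> \<Delta>)"


section \<open>Pseudomanifolds\<close>

definition pseudomanifold :: "nat \<Rightarrow> 'a topology \<Rightarrow> 'a set set \<Rightarrow> bool" where
  "pseudomanifold d X K \<longleftrightarrow>
     simplicial_CW X K \<and> pure_CW d X K \<and>
     (\<forall>\<sigma> \<in> n_cells (d - 1) X K. card {\<Delta> \<in> n_cells d X K. \<sigma> \<subseteq> \<Delta>} \<le> 2)"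

definition subcomplex :: "'a set set \<Rightarrow> 'a set set \<Rightarrow> bool" where
  "subcomplex L K \<longleftrightarrow> L \<subseteq> K \<and> (\<forall>c\<in>L. \<forall>c'\<in>K. c' \<subseteq> c \<longrightarrow> c' \<in> L)"

definition pm_boundary :: "nat \<Rightarrow> 'a topology \<Rightarrow> 'a set set \<Rightarrow> 'a set set" where
  "pm_boundary d X K =
     \<Inter>{L. subcomplex L K \<and>
          {\<sigma> \<in> n_cells (d - 1) X K. card {\<Delta> \<in> n_cells d X K. \<sigma> \<subseteq> \<Delta>} = 1} \<subseteq> L}"


section \<open>Local constructions\<close>

definition simplex_topology :: "nat \<Rightarrow> (nat \<Rightarrow> real) topology" where
  "simplex_topology d = subtopology (powertop_real UNIV) (standard_simplex d)"

definition simplex_faces :: "nat \<Rightarrow> (nat \<Rightarrow> real) set set" where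
  "simplex_faces d = (\<lambda>A. {x \<in> standard_simplex d. \<forall>i. i \<notin> A \<longrightarrow> x i = 0}) ` (Pow {..d} - {{}})"

definition is_simplex :: "nat \<Rightarrow> 'a topology \<Rightarrow> 'a set set \<Rightarrow> bool" where
  "is_simplex d X K \<longleftrightarrow>
     (\<exists>h. homeomorphic_map (simplex_topology d) X h \<and> K = (`) h ` simplex_faces d)"

text \<open>
  \<open>(X', K')\<close> is the union of a copy \<open>e\<close> of \<open>(X, K)\<close> and a copy \<open>s\<close> of the \<open>d\<close>-simplex, which meet
  exactly in the cell \<open>\<sigma>\<close> of the boundary of the former and the facet opposite to vertex \<open>j\<close> of the
  latter. Between compact Hausdorff spaces this describes the adjunction space.
\<close>
definition glue_step ::
  "nat \<Rightarrow> 'a topology \<Rightarrow> 'a set set \<Rightarrow> 'a topology \<Rightarrow> 'a set set \<Rightarrow> bool" where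
  "glue_step d X K X' K' \<longleftrightarrow>
     (\<exists>\<sigma> j e s.
        \<sigma> \<in> n_cells (d - 1) X K \<inter> pm_boundary d X K \<and> j \<le> d \<and>
        embedding_map X X' e \<and> embedding_map (simplex_topology d) X' s \<and>
        e ` topspace X \<union> s ` standard_simplex d = topspace X' \<and>
        e ` topspace X \<inter> s ` standard_simplex d = e ` \<sigma> \<and>
        e ` \<sigma> = s ` {x \<in> standard_simplex d. x j = 0} \<and>
        K' = (`) e ` K \<union> (`) s ` simplex_faces d)"

text \<open>
  The cells of a complex carry no affine structure, so a simplicial identification is a
  homeomorphism \<open>\<phi>\<close> between the cells that maps faces to faces. If it fixes \<open>F\<close>, it takes the
  vertex of \<open>\<sigma>\<close> opposite to \<open>F\<close> to that of \<open>\<tau>\<close>, hence fixes all vertices in \<open>\<sigma> \<inter> \<tau>\<close>; being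
  simplicial, it is then the identity on all of \<open>\<sigma> \<inter> \<tau>\<close>, and in particular on \<open>F\<close>. Consequently
  the relation on the right-hand side of the condition on \<open>q\<close> is already transitive.
  Up to cellular homeomorphism the quotient does not depend on the choice of \<open>\<phi>\<close>.
\<close>
definition identify_step ::
  "nat \<Rightarrow> 'a topology \<Rightarrow> 'a set set \<Rightarrow> 'a topology \<Rightarrow> 'a set set \<Rightarrow> bool" where
  "identify_step d X K X' K' \<longleftrightarrow>
     (\<exists>\<sigma> \<tau> F \<phi> q.
        \<sigma> \<in> n_cells (d - 1) X K \<inter> pm_boundary d X K \<and>
        \<tau> \<in> n_cells (d - 1) X K \<inter> pm_boundary d X K \<and> \<sigma> \<noteq> \<tau> \<and>
        F \<in> n_cells (d - 2) X K \<and> F \<subseteq> \<sigma> \<inter> \<tau> \<and>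
        homeomorphic_map (subtopology X \<sigma>) (subtopology X \<tau>) \<phi> \<and>
        (\<forall>c\<in>K. c \<subseteq> \<sigma> \<longrightarrow> \<phi> ` c \<in> K) \<and>
        (\<forall>x \<in> \<sigma> \<inter> \<tau>. \<phi> x = x) \<and>
        quotient_map X X' q \<and>
        (\<forall>x \<in> topspace X. \<forall>y \<in> topspace X.
           q x = q y \<longleftrightarrow> x = y \<or> (x \<in> \<sigma> \<and> y = \<phi> x) \<or> (y \<in> \<sigma> \<and> x = \<phi> y)) \<and>
        K' = (`) q ` K)"

text \<open>
  The sequence is \<open>(T 1, L 1), \<dots>, (T k, L k)\<close>. All its members use the point type \<open>'a\<close> of the
  target complex. This is no restriction: \<open>'a\<close> has the cardinality of the continuum, so every
  finite complex has a copy with points in \<open>'a\<close>, and the steps are insensitive to passing to copies.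
\<close>
definition local_construction ::
  "nat \<Rightarrow> 'a::euclidean_space topology \<Rightarrow> 'a set set \<Rightarrow> nat \<Rightarrow>
   (nat \<Rightarrow> 'a topology) \<Rightarrow> (nat \<Rightarrow> 'a set set) \<Rightarrow> bool" where
  "local_construction d X K k T L \<longleftrightarrow>
     (let N = card (n_cells d X K) in
        N \<le> k \<and>
        (\<forall>i\<in>{1..k}. pseudomanifold d (T i) (L i)) \<and>
        is_simplex d (T 1) (L 1) \<and>
        (\<forall>i\<in>{1..<N}. glue_step d (T i) (L i) (T (Suc i)) (L (Suc i))) \<and>
        (\<forall>i\<in>{N..<k}. identify_step d (T i) (L i) (T (Suc i)) (L (Suc i))) \<and>
        T k = X \<and> L k = K)"

text \<open>
  The library's simplicial complexes contain the empty simplex, which is not a cell.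
\<close>
definition LC :: "nat \<Rightarrow> 'a::euclidean_space set set \<Rightarrow> bool" where
  "LC d \<C> \<longleftrightarrow>
     (let X = top_of_set (\<Union>\<C>); K = \<C> - {{}} in
        2 \<le> d \<and> simplicial_complex \<C> \<and> pure_CW d X K \<and>
        (\<exists>k T L. local_construction d X K k T L))"

definition simplicial_3_sphere :: "'a::euclidean_space set set \<Rightarrow> bool" where
  "simplicial_3_sphere \<C> \<longleftrightarrow>
     simplicial_complex \<C> \<and> \<Union>\<C> homeomorphic sphere (0 :: real^4) 1"

end

theory Submission
  imports Defs "HOL-Homology.Invariance_of_Domain"
begin

text \<open>
  A 3-sphere \<open>C\<close> that contains a sufficiently complicated knot \<open>\<kappa>\<close> of three edges is not LC. The knot
  below is a connected sum of three trefoils. Its group has a representation onto the symmetric group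
  on five points that sends meridians to transpositions, i.e. there is a connected five-sheeted cover
  of \<open>C\<close>, simply branched along \<open>\<kappa>\<close>, given by permutations attached to the triangles of \<open>C\<close>.

  Pull the cover back to the complexes \<open>T i\<close> of a local construction. It is trivial over the tree of
  tetrahedra \<open>T N\<close>. When two triangles with a common edge \<open>E\<close> are identified, the star of \<open>E\<close> is
  already connected through triangles containing \<open>E\<close>. So the identification respects the sheets if \<open>E\<close>
  lies over no edge of \<open>\<kappa>\<close>, or if it lies over an edge of \<open>\<kappa>\<close> around which some triangle is still to be
  glued in a later step of this kind. The at most three remaining steps each connect at most one pair of
  sheets. Hence five sheets never become connected, a contradiction.

  That \<open>C\<close> is a sphere is seen from a sequence of bistellar moves that leads to the boundary of a
  4-simplex.
\<close>

section \<open>Local constructions, combinatorially\<close>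

text \<open>The complexes of a local construction are bare topological cell complexes without a map
  to C. Such maps are obtained backwards from the identity of C, by composing with the quotient maps
  and embeddings of the steps. The obstacle is that the composite must be injective on every cell;
  this rests on counting the vertices of cells, because the next complex is again simplicial.
  Afterwards a cell is known through the vertex set of its image, its label, and topology
  disappears. No covering space is built either: a permutation is attached to each pair of adjacent
  facets, and a union of components of the cover is a family of subsets of the fibres that these
  permutations respect. One such family is fixed over \<open>T N\<close> and survives every
  identification. The numbers fit as follows: three pairs cannot connect five sheets, whereas S5 is
  generated by four transpositions. The group of one trefoil maps onto S3 with meridians going to
  transpositions; three such maps, each sharing one transposition with the next, fit together on the
  connected sum.\<close>

definition labelling :: "'v set set \<Rightarrow> 'c set set \<Rightarrow> ('c set \<Rightarrow> 'v set) \<Rightarrow> bool" where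
  "labelling Fs K lab \<longleftrightarrow>
     (\<forall>c\<in>K. lab c \<noteq> {} \<and> (\<exists>D\<in>K. c \<subseteq> D \<and> lab D \<in> Fs)) \<and>
     (\<forall>c\<in>K. \<forall>A. A \<noteq> {} \<longrightarrow> A \<subseteq> lab c \<longrightarrow> (\<exists>c'\<in>K. c' \<subseteq> c \<and> lab c' = A)) \<and>
     (\<forall>D\<in>K. \<forall>c\<in>K. \<forall>c'\<in>K. c \<subseteq> D \<longrightarrow> c' \<subseteq> D \<longrightarrow> (c \<subseteq> c' \<longleftrightarrow> lab c \<subseteq> lab c'))"

definition facets_of :: "'v set set \<Rightarrow> 'c set set \<Rightarrow> ('c set \<Rightarrow> 'v set) \<Rightarrow> 'c set set" where
  "facets_of Fs K lab = {c \<in> K. lab c \<in> Fs}"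

definition shared :: "'v set set \<Rightarrow> 'c set set \<Rightarrow> ('c set \<Rightarrow> 'v set) \<Rightarrow> 'c set \<Rightarrow> 'c set \<Rightarrow> 'c set \<Rightarrow> bool" where
  "shared Fs K lab t D D' \<longleftrightarrow> D \<in> facets_of Fs K lab \<and> D' \<in> facets_of Fs K lab \<and> D \<noteq> D' \<and>
     t \<in> K \<and> card (lab t) = 3 \<and> t \<subseteq> D \<and> t \<subseteq> D'"

text \<open>\<open>e\<close> is the inclusion of the old cells and \<open>S\<close> the new
  tetrahedron. Of \<open>s\<close> being a boundary triangle only the uniqueness of its facet is
  kept, and of the adjunction space only that old cells meet \<open>S\<close> inside
  \<open>e s\<close>.\<close>

definition glued :: "'v set set \<Rightarrow> 'c set set \<Rightarrow> ('c set \<Rightarrow> 'v set) \<Rightarrow> 'c set set \<Rightarrow> ('c set \<Rightarrow> 'v set) \<Rightarrow>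
    ('c set \<Rightarrow> 'c set) \<Rightarrow> 'c set \<Rightarrow> 'c set \<Rightarrow> bool" where
  "glued Fs K lab K' lab' e S s \<longleftrightarrow>
     e ` K \<subseteq> K' \<and> (\<forall>c\<in>K. lab' (e c) = lab c) \<and> (\<forall>c\<in>K. \<forall>c'\<in>K. e c \<subseteq> e c' \<longleftrightarrow> c \<subseteq> c') \<and>
     S \<in> facets_of Fs K' lab' \<and> S \<notin> e ` K \<and> (\<forall>c\<in>K'. c \<in> e ` K \<or> c \<subseteq> S) \<and>
     s \<in> K \<and> card (lab s) = 3 \<and> e s \<subseteq> S \<and> (\<exists>!D. D \<in> facets_of Fs K lab \<and> s \<subseteq> D) \<and>
     (\<forall>c\<in>K. \<forall>x\<in>K'. x \<subseteq> e c \<longrightarrow> x \<subseteq> S \<longrightarrow> x \<subseteq> e s)"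

text \<open>Cells are mapped as wholes by \<open>q\<close>, which need only be monotone: a face
  relation in the quotient may be new. The last clause confines all identifications of distinct
  cells to pairs with one member in \<open>s\<close> and the other in \<open>t\<close>.\<close>

definition identified :: "'v set set \<Rightarrow> 'c set set \<Rightarrow> ('c set \<Rightarrow> 'v set) \<Rightarrow> 'c set set \<Rightarrow> ('c set \<Rightarrow> 'v set) \<Rightarrow>
    ('c set \<Rightarrow> 'c set) \<Rightarrow> 'c set \<Rightarrow> 'c set \<Rightarrow> 'c set \<Rightarrow> bool" where
  "identified Fs K lab K' lab' q s t E \<longleftrightarrow>
     K' = q ` K \<and> (\<forall>c\<in>K. lab' (q c) = lab c) \<and> (\<forall>c\<in>K. \<forall>c'\<in>K. c \<subseteq> c' \<longrightarrow> q c \<subseteq> q c') \<and>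
     s \<in> K \<and> t \<in> K \<and> s \<noteq> t \<and> q s = q t \<and> card (lab s) = 3 \<and>
     (\<exists>!D. D \<in> facets_of Fs K lab \<and> s \<subseteq> D) \<and> (\<exists>!D. D \<in> facets_of Fs K lab \<and> t \<subseteq> D) \<and>
     E \<in> K \<and> card (lab E) = 2 \<and> E \<subseteq> s \<and> E \<subseteq> t \<and>
     (\<forall>c\<in>K. \<forall>c'\<in>K. q c = q c' \<longrightarrow> c = c' \<or> c \<subseteq> s \<and> c' \<subseteq> t \<or> c \<subseteq> t \<and> c' \<subseteq> s)"

lemma labelling_subset_iff:
  assumes "labelling Fs K lab" "D \<in> K" "c \<in> K" "c' \<in> K" "c \<subseteq> D" "c' \<subseteq> D"
  shows "c \<subseteq> c' \<longleftrightarrow> lab c \<subseteq> lab c'"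
proof -
  have "\<forall>D\<in>K. \<forall>c\<in>K. \<forall>c'\<in>K. c \<subseteq> D \<longrightarrow> c' \<subseteq> D \<longrightarrow> (c \<subseteq> c' \<longleftrightarrow> lab c \<subseteq> lab c')"
    using assms(1) unfolding labelling_def by (elim conjE)
  from this[rule_format, OF assms(2-6)] show ?thesis .
qed

lemma labelling_inj:
  assumes "labelling Fs K lab" "D \<in> K" "c \<in> K" "c' \<in> K" "c \<subseteq> D" "c' \<subseteq> D" "lab c = lab c'"
  shows "c = c'"
proof
  show "c \<subseteq> c'" unfolding labelling_subset_iff[OF assms(1-6)] using assms(7) by simp
  show "c' \<subseteq> c" unfolding labelling_subset_iff[OF assms(1,2,4,3,6,5)] using assms(7) by simp
qed

lemma labelling_mono:
  assumes "labelling Fs K lab" "c \<in> K" "c' \<in> K" "c \<subseteq> c'" shows "lab c \<subseteq> lab c'"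
  using labelling_subset_iff[OF assms(1,3,2,3,4) order_refl] assms(4) by simp

lemma labelling_card_eq:
  assumes "labelling Fs K lab" "c \<in> K" "c' \<in> K" "c \<subseteq> c'" "card (lab c) = card (lab c')" "card (lab c') > 0"
  shows "c = c'"
proof -
  have "lab c = lab c'"
    using card_subset_eq[OF card_ge_0_finite[OF assms(6)] labelling_mono[OF assms(1-4)]] assms(5) by simp
  from labelling_inj[OF assms(1,3,2,3,4) order_refl this] show ?thesis .
qed

lemma labelling_face:
  assumes "labelling Fs K lab" "c \<in> K" "A \<noteq> {}" "A \<subseteq> lab c"
  shows "\<exists>c'\<in>K. c' \<subseteq> c \<and> lab c' = A"
proof -
  have "\<forall>c\<in>K. \<forall>A. A \<noteq> {} \<longrightarrow> A \<subseteq> lab c \<longrightarrow> (\<exists>c'\<in>K. c' \<subseteq> c \<and> lab c' = A)"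
    using assms(1) unfolding labelling_def by (elim conjE)
  from this[rule_format, OF assms(2-4)] show ?thesis .
qed

lemma labelling_in_facet:
  assumes "labelling Fs K lab" "c \<in> K" shows "lab c \<noteq> {}" "\<exists>D\<in>facets_of Fs K lab. c \<subseteq> D"
proof -
  have "\<forall>c\<in>K. lab c \<noteq> {} \<and> (\<exists>D\<in>K. c \<subseteq> D \<and> lab D \<in> Fs)"
    using assms(1) unfolding labelling_def by (elim conjE)
  from this[rule_format, OF assms(2)] show "lab c \<noteq> {}" "\<exists>D\<in>facets_of Fs K lab. c \<subseteq> D" 
    by (auto simp: facets_of_def)
qed

lemma facets_ofD: "D \<in> facets_of Fs K lab \<Longrightarrow> D \<in> K" "D \<in> facets_of Fs K lab \<Longrightarrow> lab D \<in> Fs"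
  by (auto simp: facets_of_def)

lemma shared_sym: "shared Fs K lab t D D' \<Longrightarrow> shared Fs K lab t D' D"
  by (auto simp: shared_def)

lemma gluedD:
  assumes "glued Fs K lab K' lab' e S s"
  shows "c \<in> K \<Longrightarrow> e c \<in> K'" "c \<in> K \<Longrightarrow> lab' (e c) = lab c"
    "c \<in> K \<Longrightarrow> c' \<in> K \<Longrightarrow> e c \<subseteq> e c' \<longleftrightarrow> c \<subseteq> c'"
    "S \<in> facets_of Fs K' lab'" "c \<in> K \<Longrightarrow> e c \<noteq> S" "x \<in> K' \<Longrightarrow> x \<in> e ` K \<or> x \<subseteq> S"
    "s \<in> K" "card (lab s) = 3" "e s \<subseteq> S" "\<exists>!D. D \<in> facets_of Fs K lab \<and> s \<subseteq> D"
    "c \<in> K \<Longrightarrow> x \<in> K' \<Longrightarrow> x \<subseteq> e c \<Longrightarrow> x \<subseteq> S \<Longrightarrow> x \<subseteq> e s"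
proof -
  have 1: "e ` K \<subseteq> K'" and 2: "\<forall>c\<in>K. lab' (e c) = lab c" and 3: "\<forall>c\<in>K. \<forall>c'\<in>K. e c \<subseteq> e c' \<longleftrightarrow> c \<subseteq> c'"
    and 4: "S \<in> facets_of Fs K' lab'" and 5: "S \<notin> e ` K" and 6: "\<forall>c\<in>K'. c \<in> e ` K \<or> c \<subseteq> S"
    and 7: "s \<in> K" "card (lab s) = 3" "e s \<subseteq> S" "\<exists>!D. D \<in> facets_of Fs K lab \<and> s \<subseteq> D"
    and 8: "\<forall>c\<in>K. \<forall>x\<in>K'. x \<subseteq> e c \<longrightarrow> x \<subseteq> S \<longrightarrow> x \<subseteq> e s"
    using assms unfolding glued_def by - ((elim conjE)?, assumption)+
  show "c \<in> K \<Longrightarrow> e c \<in> K'" using 1 by blast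
  show "c \<in> K \<Longrightarrow> lab' (e c) = lab c" using 2 by blast
  show "c \<in> K \<Longrightarrow> c' \<in> K \<Longrightarrow> e c \<subseteq> e c' \<longleftrightarrow> c \<subseteq> c'" by (rule 3[rule_format])
  show "c \<in> K \<Longrightarrow> e c \<noteq> S" using 5 by blast
  show "x \<in> K' \<Longrightarrow> x \<in> e ` K \<or> x \<subseteq> S" by (rule 6[rule_format])
  show "c \<in> K \<Longrightarrow> x \<in> K' \<Longrightarrow> x \<subseteq> e c \<Longrightarrow> x \<subseteq> S \<Longrightarrow> x \<subseteq> e s" by (rule 8[rule_format])
  show "S \<in> facets_of Fs K' lab'" "s \<in> K" "card (lab s) = 3" "e s \<subseteq> S" "\<exists>!D. D \<in> facets_of Fs K lab \<and> s \<subseteq> D" by (fact 4 7)+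
qed

lemma identifiedD:
  assumes "identified Fs K lab K' lab' q s t E"
  shows "K' = q ` K" "c \<in> K \<Longrightarrow> lab' (q c) = lab c" "c \<in> K \<Longrightarrow> c' \<in> K \<Longrightarrow> c \<subseteq> c' \<Longrightarrow> q c \<subseteq> q c'"
    "s \<in> K" "t \<in> K" "s \<noteq> t" "q s = q t" "card (lab s) = 3"
    "\<exists>!D. D \<in> facets_of Fs K lab \<and> s \<subseteq> D" "\<exists>!D. D \<in> facets_of Fs K lab \<and> t \<subseteq> D"
    "E \<in> K" "card (lab E) = 2" "E \<subseteq> s" "E \<subseteq> t"
    "c \<in> K \<Longrightarrow> c' \<in> K \<Longrightarrow> q c = q c' \<Longrightarrow> c = c' \<or> c \<subseteq> s \<and> c' \<subseteq> t \<or> c \<subseteq> t \<and> c' \<subseteq> s"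
proof -
  have 1: "K' = q ` K" and 2: "\<forall>c\<in>K. lab' (q c) = lab c" and 3: "\<forall>c\<in>K. \<forall>c'\<in>K. c \<subseteq> c' \<longrightarrow> q c \<subseteq> q c'"
    and 4: "s \<in> K" "t \<in> K" "s \<noteq> t" "q s = q t" "card (lab s) = 3"
      "\<exists>!D. D \<in> facets_of Fs K lab \<and> s \<subseteq> D" "\<exists>!D. D \<in> facets_of Fs K lab \<and> t \<subseteq> D"
      "E \<in> K" "card (lab E) = 2" "E \<subseteq> s" "E \<subseteq> t"
    and 5: "\<forall>c\<in>K. \<forall>c'\<in>K. q c = q c' \<longrightarrow> c = c' \<or> c \<subseteq> s \<and> c' \<subseteq> t \<or> c \<subseteq> t \<and> c' \<subseteq> s"
    using assms unfolding identified_def by - ((elim conjE)?, assumption)+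
  show "c \<in> K \<Longrightarrow> lab' (q c) = lab c" by (rule 2[rule_format])
  show "c \<in> K \<Longrightarrow> c' \<in> K \<Longrightarrow> c \<subseteq> c' \<Longrightarrow> q c \<subseteq> q c'" by (rule 3[rule_format])
  show "c \<in> K \<Longrightarrow> c' \<in> K \<Longrightarrow> q c = q c' \<Longrightarrow> c = c' \<or> c \<subseteq> s \<and> c' \<subseteq> t \<or> c \<subseteq> t \<and> c' \<subseteq> s"
    by (rule 5[rule_format])
  show "K' = q ` K" "s \<in> K" "t \<in> K" "s \<noteq> t" "q s = q t" "card (lab s) = 3"
    "\<exists>!D. D \<in> facets_of Fs K lab \<and> s \<subseteq> D" "\<exists>!D. D \<in> facets_of Fs K lab \<and> t \<subseteq> D"
    "E \<in> K" "card (lab E) = 2" "E \<subseteq> s" "E \<subseteq> t" by (fact 1 4)+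
qed

text \<open>Contracting one edge of the graph \<open>P\<close> loses at most one vertex, so by
  induction too few edges leave a nontrivial union of components. The vertex set \<open>V\<close> is
  a parameter because contraction shrinks it while the type of vertices stays the same.\<close>

lemma non_separating_set:
  fixes P :: "('p \<times> 'p) set"
  assumes "finite P" "finite V" "card P + 2 \<le> card V"
  shows "\<exists>A. (\<forall>(x, y)\<in>P. x \<in> A \<longleftrightarrow> y \<in> A) \<and> (\<exists>u\<in>V. u \<in> A) \<and> (\<exists>u\<in>V. u \<notin> A)"
  using assms
proof (induction "card P" arbitrary: P V rule: less_induct)
  case less
  show ?case
  proof (cases "P = {}")
    case True
    then have "2 \<le> card V" using less.prems by simp
    then obtain u v where "u \<in> V" "v \<in> V" "u \<noteq> v" using card_le_Suc0_iff_eq[OF less.prems(2)] by force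
    then show ?thesis using True by (intro exI[of _ "{u}"]) auto
  next
    case False
    then obtain x y where xy: "(x, y) \<in> P" by auto
    define m where "m z = (if z = y then x else z)" for z
    define P' where "P' = map_prod m m ` (P - {(x, y)})"
    have P': "finite P'" "card P' < card P"
      using less.prems(1) xy card_image_le[of "P - {(x, y)}" "map_prod m m"] card_Diff1_less[of P "(x, y)"]
      by (auto simp: P'_def)
    have V': "finite (m ` V)" "card V \<le> Suc (card (m ` V))"
    proof -
      have "V - {y} \<subseteq> m ` V" by (auto simp: m_def image_iff)
      then have "card (V - {y}) \<le> card (m ` V)" using less.prems by (intro card_mono) auto
      then show "card V \<le> Suc (card (m ` V))" using less.prems by (auto simp: card_Diff_singleton_if split: if_splits)
    qed (use less.prems in auto)
    obtain A where A: "\<forall>(x, y)\<in>P'. x \<in> A \<longleftrightarrow> y \<in> A" "\<exists>u\<in>m ` V. u \<in> A" "\<exists>u\<in>m ` V. u \<notin> A"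
      using less.hyps[OF P'(2,1) V'(1)] P' V' less.prems by auto
    have "\<forall>(a, b)\<in>P. m a \<in> A \<longleftrightarrow> m b \<in> A"
    proof safe
      fix a b assume ab: "(a, b) \<in> P"
      have "m a \<in> A \<longleftrightarrow> m b \<in> A"
      proof (cases "(a, b) = (x, y)")
        case False
        then have "(m a, m b) \<in> P'" using ab by (force simp: P'_def)
        then show ?thesis using A(1) by auto
      qed (auto simp: m_def)
      then show "m a \<in> A \<Longrightarrow> m b \<in> A" "m b \<in> A \<Longrightarrow> m a \<in> A" by auto
    qed
    then show ?thesis using A(2,3) by (intro exI[of _ "m -` A"]) auto
  qed
qed

text \<open>The assumption \<open>cut\<close> says that around an edge of \<open>Br\<close> the cover becomes trivial when the star of
  the edge is cut open along any of its triangles, and that crossing the cut transposes the sheets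
  \<open>x\<close> and \<open>y\<close>.\<close>

locale branched_cover =
  fixes Fs :: "'v set set" and g :: "'v set \<Rightarrow> 'v set \<Rightarrow> 'p::finite \<Rightarrow> 'p" and Br :: "'v set set"
    and adj :: "'v set \<Rightarrow> 'v set \<Rightarrow> bool"
  defines "adj A B \<equiv> A \<in> Fs \<and> B \<in> Fs \<and> card (A \<inter> B) = 3"
  assumes card4: "A \<in> Fs \<Longrightarrow> card A = 4"
    and fin_Br: "finite Br" and card_Br: "card Br + 2 \<le> CARD('p)"
    and g_bij: "adj A B \<Longrightarrow> bij (g A B)"
    and g_inv: "adj A B \<Longrightarrow> g B A (g A B x) = x"
    and flat: "card E = 2 \<Longrightarrow> E \<notin> Br \<Longrightarrow>
      \<exists>h :: 'v set \<Rightarrow> 'p \<Rightarrow> 'p. (\<forall>A. bij (h A)) \<and> (\<forall>A B. adj A B \<longrightarrow> E \<subseteq> A \<inter> B \<longrightarrow> g A B \<circ> h A = h B)"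
    and cut: "E \<in> Br \<Longrightarrow> adj A B \<Longrightarrow> E \<subseteq> A \<inter> B \<Longrightarrow>
      \<exists>(h :: 'v set \<Rightarrow> 'p \<Rightarrow> 'p) x y. (\<forall>C. bij (h C)) \<and>
        (\<forall>C D. adj C D \<longrightarrow> E \<subseteq> C \<inter> D \<longrightarrow> C \<inter> D \<noteq> A \<inter> B \<longrightarrow> g C D \<circ> h C = h D) \<and>
        (\<forall>S. (x \<in> S \<longleftrightarrow> y \<in> S) \<longrightarrow> g A B ` h A ` S = h B ` S)"
    and conn: "\<exists>R. \<forall>f. (\<forall>A B. adj A B \<longrightarrow> f B = g A B ` f A) \<longrightarrow> f R = {} \<or> f R = UNIV"
begin

text \<open>Injectivity of \<open>lab\<close> on facets says that no tetrahedron of C is covered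
  twice. Two facets through a common triangle therefore have different labels, and two different
  4-sets containing the same 3-set meet in it exactly.\<close>

lemma shared_adj:
  assumes "labelling Fs K lab" "inj_on lab (facets_of Fs K lab)" "shared Fs K lab t D D'"
  shows "adj (lab D) (lab D')" "lab D \<inter> lab D' = lab t"
proof -
  have D: "D \<in> facets_of Fs K lab" "D' \<in> facets_of Fs K lab" "D \<noteq> D'" "t \<in> K" "card (lab t) = 3" "t \<subseteq> D" "t \<subseteq> D'"
    using assms(3) by (auto simp: shared_def)
  have c: "card (lab D) = 4" "card (lab D') = 4" using D card4 by (auto simp: facets_of_def)
  then have f: "finite (lab D)" "finite (lab D')" by (auto intro: card_ge_0_finite)
  have ne: "lab D \<noteq> lab D'" using assms(2) D by (auto dest: inj_onD)
  have sub: "lab t \<subseteq> lab D \<inter> lab D'" using labelling_mono[OF assms(1)] D facets_ofD by (metis Int_greatest)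
  have "card (lab D \<inter> lab D') \<noteq> 4" using c f ne
    by (metis Int_lower1 Int_lower2 card_subset_eq)
  moreover have "card (lab D \<inter> lab D') \<le> 4" using c f by (metis Int_lower1 card_mono)
  moreover have "3 \<le> card (lab D \<inter> lab D')" using card_mono[OF _ sub] f D by auto
  ultimately have 3: "card (lab D \<inter> lab D') = 3" by auto
  then show "adj (lab D) (lab D')" using D by (auto simp: adj_def facets_of_def)
  show "lab D \<inter> lab D' = lab t"
    using card_subset_eq[OF _ sub] f D 3 by auto
qed

text \<open>Gluing creates no new face of an old cell: \<open>D\<close> already has a face with the
  label of \<open>x\<close>, and inside one cell the label determines the face.\<close>

lemma glued_face_back:
  assumes lb: "labelling Fs K lab" and lb': "labelling Fs K' lab'" and G: "glued Fs K lab K' lab' e S s"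
    and "D \<in> K" and x: "x \<in> K'" "x \<subseteq> e D"
  shows "\<exists>c\<in>K. x = e c \<and> c \<subseteq> D"
proof -
  note GD = gluedD[OF G]
  have D: "e D \<in> K'" "lab' (e D) = lab D" using GD(1,2) \<open>D \<in> K\<close> by auto
  have "lab' x \<noteq> {}" "lab' x \<subseteq> lab D"
    using labelling_in_facet(1)[OF lb' x(1)] labelling_mono[OF lb' x(1) D(1) x(2)] D by auto
  then obtain c where c: "c \<in> K" "c \<subseteq> D" "lab c = lab' x"
    using labelling_face[OF lb \<open>D \<in> K\<close>] by blast
  have "e c \<in> K'" "e c \<subseteq> e D" "lab' x = lab' (e c)" using GD(1,2) GD(3)[OF c(1) \<open>D \<in> K\<close>] c by auto
  from labelling_inj[OF lb' D(1) x(1) this(1) x(2) this(2,3)] show ?thesis using c by auto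
qed

lemma glued_facets:
  assumes lb': "labelling Fs K' lab'" and G: "glued Fs K lab K' lab' e S s"
  shows "facets_of Fs K' lab' = insert S (e ` facets_of Fs K lab)"
proof -
  note GD = gluedD[OF G]
  have S: "S \<in> K'" "lab' S \<in> Fs" using GD(4) by (auto simp: facets_of_def)
  have "c = S \<or> c \<in> e ` facets_of Fs K lab" if c: "c \<in> K'" "lab' c \<in> Fs" for c
  proof (cases "c \<subseteq> S")
    case True
    then show ?thesis using labelling_card_eq[OF lb' c(1) S(1)] card4 S c by auto
  next
    case False
    then obtain b where b: "b \<in> K" "c = e b" using GD(6) c by auto
    then show ?thesis using c GD(2)[OF b(1)] by (auto simp: facets_of_def)
  qed
  then show ?thesis using GD(1,2,4) by (auto simp: facets_of_def)
qed

lemma glued_shared: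
  assumes lb: "labelling Fs K lab" and lb': "labelling Fs K' lab'" and G: "glued Fs K lab K' lab' e S s"
    and sh: "shared Fs K' lab' t D1 D2"
  obtains (old) u C1 C2 where "t = e u" "D1 = e C1" "D2 = e C2" "shared Fs K lab u C1 C2"
  | (new1) C where "t = e s" "D1 = e C" "D2 = S" "C \<in> facets_of Fs K lab" "s \<subseteq> C"
  | (new2) C where "t = e s" "D1 = S" "D2 = e C" "C \<in> facets_of Fs K lab" "s \<subseteq> C"
proof -
  note GD = gluedD[OF G]
  have D: "D1 \<in> facets_of Fs K' lab'" "D2 \<in> facets_of Fs K' lab'" "D1 \<noteq> D2"
    and t: "t \<in> K'" "card (lab' t) = 3" "t \<subseteq> D1" "t \<subseteq> D2" using sh by (auto simp: shared_def)
  have new: "t = e s \<and> s \<subseteq> C" if "C \<in> facets_of Fs K lab" "t \<subseteq> e C" "t \<subseteq> S" for C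
  proof -
    have C: "C \<in> K" using that by (auto simp: facets_of_def)
    have "t \<subseteq> e s" by (rule GD(11)[OF C t(1) that(2,3)])
    from labelling_card_eq[OF lb' t(1) GD(1)[OF GD(7)] this] have "t = e s"
      using t GD(2)[OF GD(7)] GD(8) by simp
    moreover then have "s \<subseteq> C" using GD(3)[OF GD(7) C] that by simp
    ultimately show ?thesis by simp
  qed
  have fac: "facets_of Fs K' lab' = insert S (e ` facets_of Fs K lab)" by (rule glued_facets[OF lb' G])
  have "D1 = S \<or> (\<exists>C1\<in>facets_of Fs K lab. D1 = e C1)" "D2 = S \<or> (\<exists>C2\<in>facets_of Fs K lab. D2 = e C2)"
    using D(1,2) unfolding fac by blast+
  then consider "D1 = S" | "D2 = S" | C1 C2 where "D1 = e C1" "D2 = e C2" "C1 \<in> facets_of Fs K lab" "C2 \<in> facets_of Fs K lab"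
    by fast
  then show thesis
  proof cases
    case 1
    then obtain C where C: "D2 = e C" "C \<in> facets_of Fs K lab" using D fac by blast
    show thesis by (rule new2[of C]) (use new[OF C(2)] t 1 C in auto)
  next
    case 2
    then obtain C where C: "D1 = e C" "C \<in> facets_of Fs K lab" using D fac by blast
    show thesis by (rule new1[of C]) (use new[OF C(2)] t 2 C in auto)
  next
    case 3
    then have C: "C1 \<in> K" "C2 \<in> K" by (auto simp: facets_of_def)
    obtain u where u: "u \<in> K" "t = e u" "u \<subseteq> C1"
      using glued_face_back[OF lb lb' G C(1) t(1)] t(3) 3(1) by blast
    then have "u \<subseteq> C2" using GD(3)[OF u(1) C(2)] t 3 by simp
    then have "shared Fs K lab u C1 C2" using u 3 D t GD(2)[OF u(1)] by (auto simp: shared_def)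
    then show thesis using old u 3 by blast
  qed
qed

lemma glued_shared_old:
  assumes G: "glued Fs K lab K' lab' e S s" and sh: "shared Fs K lab u C1 C2"
  shows "shared Fs K' lab' (e u) (e C1) (e C2)"
proof -
  note GD = gluedD[OF G]
  have C: "C1 \<in> K" "C2 \<in> K" "u \<in> K" using sh by (auto simp: shared_def facets_of_def)
  have "e C1 \<noteq> e C2" using GD(3)[OF C(1,2)] GD(3)[OF C(2,1)] sh by (auto simp: shared_def)
  then show ?thesis using sh GD(1,2) GD(3)[OF C(3,1)] GD(3)[OF C(3,2)] C by (auto simp: shared_def facets_of_def)
qed

section \<open>Edge stars and trivializations along the gluing steps\<close>

lemma rtrancl_map:
  assumes "(a, b) \<in> R\<^sup>*" "\<And>x y. (x, y) \<in> R \<Longrightarrow> (f x, f y) \<in> R'"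
  shows "(f a, f b) \<in> R'\<^sup>*"
  using assms(1) by (induction) (auto intro: rtrancl_into_rtrancl assms(2))

definition star_rel :: "'c set set \<Rightarrow> ('c set \<Rightarrow> 'v set) \<Rightarrow> 'c set \<Rightarrow> ('c set \<times> 'c set) set" where
  "star_rel K lab E = {(D, D'). \<exists>t. shared Fs K lab t D D' \<and> E \<subseteq> t}"

lemma star_rel_sym: "(D, D') \<in> (star_rel K lab E)\<^sup>* \<Longrightarrow> (D', D) \<in> (star_rel K lab E)\<^sup>*"
  by (rule symD[OF sym_rtrancl]) (auto simp: sym_def star_rel_def dest: shared_sym)

text \<open>Needed at every stage and not only at the end: before \<open>s\<close> and
  \<open>t\<close> are identified, the two facets behind them must already be joined by a chain of
  tetrahedra around their common edge, along which sheets can be compared.\<close>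

definition star_connected :: "'c set set \<Rightarrow> ('c set \<Rightarrow> 'v set) \<Rightarrow> bool" where
  "star_connected K lab \<longleftrightarrow> (\<forall>E\<in>K. card (lab E) = 2 \<longrightarrow>
     (\<forall>D\<in>facets_of Fs K lab. \<forall>D'\<in>facets_of Fs K lab. E \<subseteq> D \<longrightarrow> E \<subseteq> D' \<longrightarrow> (D, D') \<in> (star_rel K lab E)\<^sup>*))"

text \<open>Every edge that the new tetrahedron shares with the old part lies on the glued triangle,
  so its star grows by one tetrahedron attached across that triangle. The other edges of
  \<open>S\<close> have \<open>S\<close> as their whole star.\<close>

lemma star_connected_glued:
  assumes lb: "labelling Fs K lab" and lb': "labelling Fs K' lab'" and G: "glued Fs K lab K' lab' e S s"
    and sc: "star_connected K lab"
  shows "star_connected K' lab'"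
  unfolding star_connected_def
proof (intro ballI impI)
  fix E D D' assume E: "E \<in> K'" "card (lab' E) = 2" and D: "D \<in> facets_of Fs K' lab'" "D' \<in> facets_of Fs K' lab'"
    and ED: "E \<subseteq> D" "E \<subseteq> D'"
  note GD = gluedD[OF G]
  have fac: "facets_of Fs K' lab' = insert S (e ` facets_of Fs K lab)" by (rule glued_facets[OF lb' G])
  have old: "(e C, e C') \<in> (star_rel K' lab' E)\<^sup>*"
    if C: "C \<in> facets_of Fs K lab" "C' \<in> facets_of Fs K lab" "E \<subseteq> e C" "E \<subseteq> e C'" for C C'
  proof -
    have CK: "C \<in> K" "C' \<in> K" using C by (auto simp: facets_of_def)
    obtain E0 where E0: "E0 \<in> K" "E = e E0" "E0 \<subseteq> C" using glued_face_back[OF lb lb' G CK(1) E(1) C(3)] by blast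
    then have "E0 \<subseteq> C'" using GD(3)[OF E0(1) CK(2)] C by simp
    then have "(C, C') \<in> (star_rel K lab E0)\<^sup>*"
      using sc E0 E C GD(2)[OF E0(1)] unfolding star_connected_def by simp
    then show ?thesis
    proof (rule rtrancl_map)
      fix x y assume "(x, y) \<in> star_rel K lab E0"
      then obtain t where t: "shared Fs K lab t x y" "E0 \<subseteq> t" by (auto simp: star_rel_def)
      then have "t \<in> K" by (auto simp: shared_def)
      then have "E \<subseteq> e t" using GD(3)[OF E0(1)] t E0 by simp
      then show "(e x, e y) \<in> star_rel K' lab' E" using glued_shared_old[OF G t(1)] by (auto simp: star_rel_def)
    qed
  qed
  have new: "(e C, S) \<in> (star_rel K' lab' E)\<^sup>*" if C: "C \<in> facets_of Fs K lab" "E \<subseteq> e C" "E \<subseteq> S" for C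
  proof -
    have CK: "C \<in> K" using C by (auto simp: facets_of_def)
    have Es: "E \<subseteq> e s" by (rule GD(11)[OF CK E(1) C(2,3)])
    obtain C0 where C0: "C0 \<in> facets_of Fs K lab" "s \<subseteq> C0" using GD(10) by auto
    then have C0K: "C0 \<in> K" by (auto simp: facets_of_def)
    have le: "e s \<subseteq> e C0" using GD(3)[OF GD(7) C0K] C0 by simp
    have "shared Fs K' lab' (e s) (e C0) S"
      using C0 fac GD(1,2)[OF GD(7)] GD(8,9) GD(5)[OF C0K] le by (simp add: shared_def)
    then have "(e C0, S) \<in> star_rel K' lab' E" using Es by (auto simp: star_rel_def)
    moreover have "(e C, e C0) \<in> (star_rel K' lab' E)\<^sup>*" by (rule old[OF C(1) C0(1) C(2)]) (use Es le in auto)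
    ultimately show ?thesis by (rule rtrancl_into_rtrancl[rotated])
  qed
  have DS: "D = S \<or> (\<exists>C\<in>facets_of Fs K lab. D = e C)" "D' = S \<or> (\<exists>C\<in>facets_of Fs K lab. D' = e C)"
    using D unfolding fac by blast+
  consider "D = S" "D' = S" | C where "D = S" "D' = e C" "C \<in> facets_of Fs K lab"
    | C where "D' = S" "D = e C" "C \<in> facets_of Fs K lab"
    | C C' where "D = e C" "D' = e C'" "C \<in> facets_of Fs K lab" "C' \<in> facets_of Fs K lab"
    using DS by fast
  then show "(D, D') \<in> (star_rel K' lab' E)\<^sup>*"
  proof cases
    case 2 then show ?thesis using star_rel_sym[OF new[of C]] ED by simp
  next
    case 3 then show ?thesis using new[of C] ED by simp
  next
    case 4 then show ?thesis using old[of C C'] ED by simp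
  qed simp
qed

text \<open>A trivialization of the pulled-back cover: \<open>w A\<close> identifies one fixed set
  of sheets with the fibre over the facet labelled \<open>A\<close>, compatibly with the crossing of
  every shared triangle.\<close>

definition transport :: "'c set set \<Rightarrow> ('c set \<Rightarrow> 'v set) \<Rightarrow> ('v set \<Rightarrow> 'p \<Rightarrow> 'p) \<Rightarrow> bool" where
  "transport K lab w \<longleftrightarrow> (\<forall>t D D'. shared Fs K lab t D D' \<longrightarrow> w (lab D') = g (lab D) (lab D') \<circ> w (lab D))"

text \<open>The dual graph grows by a leaf: the new facet has a single neighbour, which dictates the
  value of \<open>w\<close> there, and its label is new by injectivity, so no earlier value is
  overwritten.\<close>

lemma transport_glued:
  assumes lb: "labelling Fs K lab" and lb': "labelling Fs K' lab'" and G: "glued Fs K lab K' lab' e S s"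
    and inj: "inj_on lab' (facets_of Fs K' lab')"
    and w: "transport K lab w" "\<And>A. bij (w A)"
  shows "\<exists>w. transport K' lab' w \<and> (\<forall>A. bij (w A))"
proof -
  note GD = gluedD[OF G]
  have fac: "facets_of Fs K' lab' = insert S (e ` facets_of Fs K lab)" by (rule glued_facets[OF lb' G])
  obtain C0 where C0: "C0 \<in> facets_of Fs K lab" "s \<subseteq> C0" and uniq: "\<And>C. C \<in> facets_of Fs K lab \<Longrightarrow> s \<subseteq> C \<Longrightarrow> C = C0"
    using GD(10) by blast
  have C0K: "C0 \<in> K" by (rule facets_ofD(1)[OF C0(1)])
  have facK: "C \<in> K" "lab' (e C) = lab C" if "C \<in> facets_of Fs K lab" for C
    using facets_ofD(1)[OF that] GD(2)[OF facets_ofD(1)[OF that]] by auto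
  have neS: "lab C \<noteq> lab' S" if C: "C \<in> facets_of Fs K lab" for C
  proof
    assume "lab C = lab' S"
    then have "lab' (e C) = lab' S" unfolding facK(2)[OF C] .
    moreover have "e C \<in> facets_of Fs K' lab'" unfolding fac using C by blast
    ultimately have "e C = S" using inj_onD[OF inj _ _ GD(4)] by blast
    then show False using GD(5)[OF facK(1)[OF C]] by contradiction
  qed
  have le: "e s \<subseteq> e C0" using GD(3)[OF GD(7) C0K] C0 by simp
  have "shared Fs K' lab' (e s) (e C0) S"
    using C0 fac GD(1,2)[OF GD(7)] GD(8,9) GD(5)[OF C0K] le by (simp add: shared_def)
  from shared_adj(1)[OF lb' inj this] have ad: "adj (lab C0) (lab' S)" using facK[OF C0(1)] by simp
  define w' where "w' = w (lab' S := g (lab C0) (lab' S) \<circ> w (lab C0))"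
  have w'S: "w' (lab' S) = g (lab C0) (lab' S) \<circ> w (lab C0)" by (simp add: w'_def)
  have w'e: "w' (lab' (e C)) = w (lab C)" if "C \<in> facets_of Fs K lab" for C
    using neS[OF that] facK[OF that] by (simp add: w'_def)
  have "transport K' lab' w'"
    unfolding transport_def
  proof (intro allI impI)
    fix t D D' assume sh: "shared Fs K' lab' t D D'"
    show "w' (lab' D') = g (lab' D) (lab' D') \<circ> w' (lab' D)"
      using lb lb' G sh
    proof (cases rule: glued_shared)
      case (old u C1 C2)
      then have C: "C1 \<in> facets_of Fs K lab" "C2 \<in> facets_of Fs K lab" by (auto simp: shared_def)
      have "w (lab C2) = g (lab C1) (lab C2) \<circ> w (lab C1)" using w(1) old(4) unfolding transport_def by blast
      then show ?thesis using w'e[OF C(1)] w'e[OF C(2)] facK(2)[OF C(1)] facK(2)[OF C(2)] old(2,3) by simp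
    next
      case (new1 C)
      then have "C = C0" by (intro uniq)
      then show ?thesis using new1 w'e[OF C0(1)] w'S facK[OF C0(1)] by simp
    next
      case (new2 C)
      then have "C = C0" by (intro uniq)
      then show ?thesis using new2 w'e[OF C0(1)] w'S facK[OF C0(1)] g_inv[OF ad] by (simp add: fun_eq_iff)
    qed
  qed
  moreover have "bij (w' A)" for A
    using w(2) bij_comp[OF w(2) g_bij[OF ad]] by (simp add: w'_def)
  ultimately show ?thesis by blast
qed

section \<open>Incidences and stars under the identification of two triangles\<close>

lemma identified_facets:
  assumes G: "identified Fs K lab K' lab' q s t E"
  shows "facets_of Fs K' lab' = q ` facets_of Fs K lab"
  using identifiedD(1,2)[OF G] by (auto simp: facets_of_def)

lemma identified_face_back:
  assumes lb: "labelling Fs K lab" and lb': "labelling Fs K' lab'" and G: "identified Fs K lab K' lab' q s t E"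
    and "D \<in> K" and x: "x \<in> K'" "x \<subseteq> q D"
  shows "\<exists>c\<in>K. x = q c \<and> c \<subseteq> D"
proof -
  note GD = identifiedD[OF G]
  have D: "q D \<in> K'" "lab' (q D) = lab D" using GD(1,2) \<open>D \<in> K\<close> by auto
  have "lab' x \<noteq> {}" "lab' x \<subseteq> lab D"
    using labelling_in_facet(1)[OF lb' x(1)] labelling_mono[OF lb' x(1) D(1) x(2)] D by auto
  then obtain c where c: "c \<in> K" "c \<subseteq> D" "lab c = lab' x"
    using labelling_face[OF lb \<open>D \<in> K\<close>] by blast
  have "q c \<in> K'" "q c \<subseteq> q D" "lab' x = lab' (q c)" using GD(1,2) GD(3)[OF c(1) \<open>D \<in> K\<close>] c by auto
  from labelling_inj[OF lb' D(1) x(1) this(1) x(2) this(2,3)] show ?thesis using c by auto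
qed

lemma identified_shared:
  assumes lb: "labelling Fs K lab" and lb': "labelling Fs K' lab'" and G: "identified Fs K lab K' lab' q s t E"
    and sh: "shared Fs K' lab' r D1 D2"
  obtains (old) u C1 C2 where "r = q u" "D1 = q C1" "D2 = q C2" "shared Fs K lab u C1 C2"
  | (new1) C1 C2 where "r = q s" "D1 = q C1" "D2 = q C2" "C1 \<in> facets_of Fs K lab" "C2 \<in> facets_of Fs K lab" "s \<subseteq> C1" "t \<subseteq> C2"
  | (new2) C1 C2 where "r = q s" "D1 = q C1" "D2 = q C2" "C1 \<in> facets_of Fs K lab" "C2 \<in> facets_of Fs K lab" "t \<subseteq> C1" "s \<subseteq> C2"
proof -
  note GD = identifiedD[OF G]
  have D: "D1 \<in> facets_of Fs K' lab'" "D2 \<in> facets_of Fs K' lab'" "D1 \<noteq> D2"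
    and r: "r \<in> K'" "card (lab' r) = 3" "r \<subseteq> D1" "r \<subseteq> D2" using sh by (auto simp: shared_def)
  obtain C1 C2 where C: "D1 = q C1" "D2 = q C2" "C1 \<in> facets_of Fs K lab" "C2 \<in> facets_of Fs K lab"
    using D(1,2)[unfolded identified_facets[OF G]] by blast
  then have CK: "C1 \<in> K" "C2 \<in> K" by (auto simp: facets_of_def)
  have "r \<subseteq> q C1" "r \<subseteq> q C2" using r(3,4) C(1,2) by simp_all
  then obtain u1 u2 where u1: "u1 \<in> K" "r = q u1" "u1 \<subseteq> C1" and u2: "u2 \<in> K" "r = q u2" "u2 \<subseteq> C2"
    using identified_face_back[OF lb lb' G CK(1) r(1)] identified_face_back[OF lb lb' G CK(2) r(1)] by metis
  have c3: "card (lab u1) = 3" "card (lab u2) = 3"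
    using r(2) GD(2)[OF u1(1)] GD(2)[OF u2(1)] u1(2) u2(2) by simp_all
  have c3': "card (lab t) = 3"
    using GD(2)[OF GD(4)] GD(2)[OF GD(5)] GD(7,8) by simp
  have eq: "a = b" if "a \<in> K" "b \<in> K" "a \<subseteq> b" "card (lab a) = 3" "card (lab b) = 3" for a b
    using labelling_card_eq[OF lb that(1-3)] that by simp
  have "q u1 = q u2" using u1(2) u2(2) by simp
  then consider "u1 = u2" | "u1 \<subseteq> s" "u2 \<subseteq> t" | "u1 \<subseteq> t" "u2 \<subseteq> s"
    using GD(15)[OF u1(1) u2(1)] by argo
  then show thesis
  proof cases
    case 1
    then have "shared Fs K lab u1 C1 C2" using C u1 u2 c3 D by (auto simp: shared_def)
    then show thesis using old C u1 by blast
  next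
    case 2
    then have "u1 = s" "u2 = t" using eq[OF u1(1) GD(4)] eq[OF u2(1) GD(5)] GD(8) c3 c3' by simp_all
    then show thesis using new1[OF _ C] u1 u2 by simp
  next
    case 3
    then have "u1 = t" "u2 = s" using eq[OF u1(1) GD(5)] eq[OF u2(1) GD(4)] GD(8) c3 c3' by simp_all
    then show thesis using new2[OF _ C] u1 u2 by simp
  qed
qed

lemma identified_shared_old:
  assumes G: "identified Fs K lab K' lab' q s t E" and sh: "shared Fs K lab u C1 C2"
    and inj: "inj_on lab (facets_of Fs K lab)"
  shows "shared Fs K' lab' (q u) (q C1) (q C2)"
proof -
  note GD = identifiedD[OF G]
  have C: "C1 \<in> K" "C2 \<in> K" "u \<in> K" using sh by (auto simp: shared_def facets_of_def)
  have "lab C1 \<noteq> lab C2" using inj sh by (auto simp: shared_def dest: inj_onD)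
  then have "q C1 \<noteq> q C2" using GD(2)[OF C(1)] GD(2)[OF C(2)] by auto
  then show ?thesis using sh GD(1,2) GD(3)[OF C(3,1)] GD(3)[OF C(3,2)] C by (auto simp: shared_def facets_of_def)
qed

text \<open>The facets behind \<open>s\<close> and \<open>t\<close> differ because one cell has only
  one face with a given label, while \<open>s\<close> and \<open>t\<close> are distinct with equal
  labels. Injectivity on facets then keeps their images apart.\<close>

lemma identified_shared_new:
  assumes lb: "labelling Fs K lab" and G: "identified Fs K lab K' lab' q s t E"
    and inj: "inj_on lab (facets_of Fs K lab)"
    and C: "C1 \<in> facets_of Fs K lab" "C2 \<in> facets_of Fs K lab" "s \<subseteq> C1" "t \<subseteq> C2"
  shows "shared Fs K' lab' (q s) (q C1) (q C2)"
proof -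
  note GD = identifiedD[OF G]
  have CK: "C1 \<in> K" "C2 \<in> K" using C by (auto simp: facets_of_def)
  have st: "lab s = lab t" using GD(2)[OF GD(4)] GD(2)[OF GD(5)] GD(7) by simp
  have "C1 \<noteq> C2" using labelling_inj[OF lb CK(1) GD(4,5) C(3) _ st] C(4) GD(6) by auto
  then have "lab C1 \<noteq> lab C2" using inj C by (auto dest: inj_onD)
  then have "q C1 \<noteq> q C2" using GD(2)[OF CK(1)] GD(2)[OF CK(2)] by auto
  then show ?thesis using C CK GD(1,2,4,5,7,8) st GD(3)[OF GD(4) CK(1) C(3)] GD(3)[OF GD(5) CK(2) C(4)]
    by (auto simp: shared_def facets_of_def)
qed

text \<open>Two edges with the same image are equal or lie in \<open>s\<close> and \<open>t\<close>
  respectively. In the second case each of their stars contains the facet behind \<open>s\<close> or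
  \<open>t\<close>, and these two facets become neighbours across the new triangle, which joins the
  stars.\<close>

lemma star_connected_identified:
  assumes lb: "labelling Fs K lab" and lb': "labelling Fs K' lab'" and G: "identified Fs K lab K' lab' q s t F"
    and inj: "inj_on lab (facets_of Fs K lab)" and sc: "star_connected K lab"
  shows "star_connected K' lab'"
  unfolding star_connected_def
proof (intro ballI impI)
  fix E D D' assume E: "E \<in> K'" "card (lab' E) = 2" and D: "D \<in> facets_of Fs K' lab'" "D' \<in> facets_of Fs K' lab'"
    and ED: "E \<subseteq> D" "E \<subseteq> D'"
  note GD = identifiedD[OF G]
  have old: "(q C, q C') \<in> (star_rel K' lab' E)\<^sup>*"
    if C: "C \<in> facets_of Fs K lab" "C' \<in> facets_of Fs K lab" and E0: "E0 \<in> K" "E = q E0" "E0 \<subseteq> C" "E0 \<subseteq> C'" for C C' E0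
  proof -
    have "(C, C') \<in> (star_rel K lab E0)\<^sup>*"
      using sc E0 E C GD(2)[OF E0(1)] unfolding star_connected_def by simp
    then show ?thesis
    proof (rule rtrancl_map)
      fix x y assume "(x, y) \<in> star_rel K lab E0"
      then obtain t where t: "shared Fs K lab t x y" "E0 \<subseteq> t" by (auto simp: star_rel_def)
      then have "t \<in> K" by (auto simp: shared_def)
      then have "E \<subseteq> q t" using GD(3)[OF E0(1)] t E0 by simp
      then show "(q x, q y) \<in> star_rel K' lab' E" using identified_shared_old[OF G t(1) inj] by (auto simp: star_rel_def)
    qed
  qed
  have cross: "(q C, q C') \<in> (star_rel K' lab' E)\<^sup>*"
    if C: "C \<in> facets_of Fs K lab" "C' \<in> facets_of Fs K lab"
      and E0: "E0 \<in> K" "E = q E0" "E0 \<subseteq> C" "E0 \<subseteq> s" and E1: "E1 \<in> K" "E = q E1" "E1 \<subseteq> C'" "E1 \<subseteq> t" for C C' E0 E1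
  proof -
    obtain Cs where Cs: "Cs \<in> facets_of Fs K lab" "s \<subseteq> Cs" using GD(9) by (elim ex1E conjE)
    obtain Ct where Ct: "Ct \<in> facets_of Fs K lab" "t \<subseteq> Ct" using GD(10) by (elim ex1E conjE)
    have "E \<subseteq> q s" using GD(3)[OF E0(1) GD(4) E0(4)] E0 by simp
    then have "(q Cs, q Ct) \<in> star_rel K' lab' E"
      using identified_shared_new[OF lb G inj Cs(1) Ct(1) Cs(2) Ct(2)] by (auto simp: star_rel_def)
    moreover have "(q C, q Cs) \<in> (star_rel K' lab' E)\<^sup>*" by (rule old[OF C(1) Cs(1) E0(1-3)]) (use E0 Cs in auto)
    moreover have "(q Ct, q C') \<in> (star_rel K' lab' E)\<^sup>*" by (rule old[OF Ct(1) C(2) E1(1,2) _ E1(3)]) (use E1 Ct in auto)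
    ultimately show ?thesis by (meson rtrancl_into_rtrancl rtrancl_trans)
  qed
  obtain C C' where C: "D = q C" "D' = q C'" "C \<in> facets_of Fs K lab" "C' \<in> facets_of Fs K lab"
    using D(1,2)[unfolded identified_facets[OF G]] by blast
  then have CK: "C \<in> K" "C' \<in> K" by (auto simp: facets_of_def)
  have "E \<subseteq> q C" "E \<subseteq> q C'" using ED C(1,2) by simp_all
  then obtain E0 E1 where E0: "E0 \<in> K" "E = q E0" "E0 \<subseteq> C" and E1: "E1 \<in> K" "E = q E1" "E1 \<subseteq> C'"
    using identified_face_back[OF lb lb' G CK(1) E(1)] identified_face_back[OF lb lb' G CK(2) E(1)] by metis
  have "q E0 = q E1" using E0(2) E1(2) by simp
  then consider "E0 = E1" | "E0 \<subseteq> s" "E1 \<subseteq> t" | "E0 \<subseteq> t" "E1 \<subseteq> s"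
    using GD(15)[OF E0(1) E1(1)] by argo
  then show "(D, D') \<in> (star_rel K' lab' E)\<^sup>*"
  proof cases
    case 1 then show ?thesis using old[OF C(3,4) E0] E1 C by simp
  next
    case 2 then show ?thesis using cross[OF C(3,4) E0 _ E1] C by simp
  next
    case 3 then show ?thesis using star_rel_sym[OF cross[OF C(4,3) E1 _ E0]] C by simp
  qed
qed

text \<open>\<open>f\<close> selects a subset of every fibre; being parallel means that the selected
  sheets form a union of components of the pulled-back cover. Such families stand in for the
  covering space.\<close>

definition parallel :: "'c set set \<Rightarrow> ('c set \<Rightarrow> 'v set) \<Rightarrow> ('v set \<Rightarrow> 'p set) \<Rightarrow> bool" where
  "parallel K lab f \<longleftrightarrow> (\<forall>t D D'. shared Fs K lab t D D' \<longrightarrow> f (lab D') = g (lab D) (lab D') ` f (lab D))"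

text \<open>Only the adjacency of \<open>C1\<close> and \<open>C2\<close> is new, so
  \<open>f12\<close> and the same equation read in the other direction are all that has to be
  added.\<close>

lemma parallel_identified:
  assumes lb: "labelling Fs K lab" and lb': "labelling Fs K' lab'" and G: "identified Fs K lab K' lab' q s t E"
    and inj: "inj_on lab (facets_of Fs K lab)" "inj_on lab' (facets_of Fs K' lab')"
    and f: "parallel K lab f"
    and C: "C1 \<in> facets_of Fs K lab" "C2 \<in> facets_of Fs K lab" "s \<subseteq> C1" "t \<subseteq> C2"
    and f12: "f (lab C2) = g (lab C1) (lab C2) ` f (lab C1)"
  shows "parallel K' lab' f"
  unfolding parallel_def
proof (intro allI impI)
  fix r D D' assume sh: "shared Fs K' lab' r D D'"
  note GD = identifiedD[OF G]
  have facK: "lab' (q C) = lab C" if "C \<in> facets_of Fs K lab" for C by (rule GD(2)[OF facets_ofD(1)[OF that]])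
  have "adj (lab C1) (lab C2)"
    using shared_adj(1)[OF lb' inj(2) identified_shared_new[OF lb G inj(1) C]] facK C by simp
  then have f21: "f (lab C1) = g (lab C2) (lab C1) ` f (lab C2)" unfolding f12 image_image using g_inv by auto
  have u1: "C = C1" if "C \<in> facets_of Fs K lab" "s \<subseteq> C" for C using GD(9) C that by blast
  have u2: "C = C2" if "C \<in> facets_of Fs K lab" "t \<subseteq> C" for C using GD(10) C that by blast
  show "f (lab' D') = g (lab' D) (lab' D') ` f (lab' D)"
    using lb lb' G sh
  proof (cases rule: identified_shared)
    case (old u A B)
    then have "A \<in> facets_of Fs K lab" "B \<in> facets_of Fs K lab" by (auto simp: shared_def)
    then show ?thesis using f old(4) unfolding old(2,3) parallel_def by (simp add: facK)
  next
    case (new1 A B)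
    have "A = C1" "B = C2" using u1[OF new1(4,6)] u2[OF new1(5,7)] .
    then show ?thesis using f12 facK[OF C(1)] facK[OF C(2)] new1(2,3) by simp
  next
    case (new2 A B)
    have "A = C2" "B = C1" using u2[OF new2(4,6)] u1[OF new2(5,7)] .
    then show ?thesis using f21 facK[OF C(1)] facK[OF C(2)] new2(2,3) by simp
  qed
qed

text \<open>\<open>h\<close> trivializes the cover around the edge except across a triangle
  \<open>X\<close>. As long as no shared triangle of \<open>K\<close> lies over \<open>X\<close>, a
  parallel family is constant in the coordinates \<open>h\<close> along the star.\<close>

lemma parallel_star:
  assumes lb: "labelling Fs K lab" and inj: "inj_on lab (facets_of Fs K lab)" and f: "parallel K lab f"
    and h: "\<And>A B. adj A B \<Longrightarrow> lab E \<subseteq> A \<inter> B \<Longrightarrow> A \<inter> B \<noteq> X \<Longrightarrow> g A B \<circ> h A = h B"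
    and X: "\<And>u D D'. shared Fs K lab u D D' \<Longrightarrow> lab u \<noteq> X" and E: "E \<in> K"
    and DD: "(D, D') \<in> (star_rel K lab E)\<^sup>*" and S: "f (lab D) = h (lab D) ` S"
  shows "f (lab D') = h (lab D') ` S"
  using DD
proof induction
  case (step A B)
  then obtain u where u: "shared Fs K lab u A B" "E \<subseteq> u" by (auto simp: star_rel_def)
  then have "u \<in> K" by (auto simp: shared_def)
  then have "lab E \<subseteq> lab u" using labelling_mono[OF lb E] u by auto
  then have "g (lab A) (lab B) \<circ> h (lab A) = h (lab B)"
    using h[OF shared_adj(1)[OF lb inj u(1)]] shared_adj(2)[OF lb inj u(1)] X[OF u(1)] by simp
  moreover have "f (lab B) = g (lab A) (lab B) ` f (lab A)" using f u(1) unfolding parallel_def by blast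
  ultimately show ?case using step.IH by (simp add: image_comp)
qed (rule S)

text \<open>All obstructed steps are known in advance, so the pairs of sheets they would join can be
  read in the trivialization \<open>w\<close> over stage \<open>N\<close>, and one set
  \<open>Q\<close> compatible with all of these pairs is fixed before the first identification. By
  \<open>final\<close> the resulting family is parallel on all of C, where \<open>conn\<close>
  forbids it.\<close>

proposition no_local_construction:
  fixes K :: "nat \<Rightarrow> 'c set set" and lab :: "nat \<Rightarrow> 'c set \<Rightarrow> 'v set"
  assumes Nk: "1 \<le> N" "N \<le> k"
    and lb: "\<And>i. i \<in> {1..k} \<Longrightarrow> labelling Fs (K i) (lab i)"
    and inj: "\<And>i. i \<in> {1..k} \<Longrightarrow> inj_on (lab i) (facets_of Fs (K i) (lab i))"
    and base: "facets_of Fs (K 1) (lab 1) = {D0}"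
    and glue: "\<And>i. i \<in> {1..<N} \<Longrightarrow> \<exists>e S s. glued Fs (K i) (lab i) (K (Suc i)) (lab (Suc i)) e S s"
    and ident: "\<And>i. i \<in> {N..<k} \<Longrightarrow> \<exists>q s t E. identified Fs (K i) (lab i) (K (Suc i)) (lab (Suc i)) q s t E"
    and final: "\<And>A B. adj A B \<Longrightarrow> \<exists>t D D'. shared Fs (K k) (lab k) t D D' \<and> lab k D = A \<and> lab k D' = B"
    and thin: "\<And>A B C. adj A B \<Longrightarrow> C \<in> Fs \<Longrightarrow> A \<inter> B \<subseteq> C \<Longrightarrow> C = A \<or> C = B"
  shows False
proof -
  obtain q s t E where ident: "\<And>i. i \<in> {N..<k} \<Longrightarrow> identified Fs (K i) (lab i) (K (Suc i)) (lab (Suc i)) (q i) (s i) (t i) (E i)"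
    using ident by metis
  have in1k: "i \<in> {1..k}" "Suc i \<in> {1..k}" if "i \<in> {N..<k}" for i using that Nk by auto
  have sc: "star_connected (K i) (lab i)" if "i \<in> {1..k}" for i
  proof -
    have "1 \<le> i" "i \<le> k" using that by auto
    then show ?thesis
    proof (induction i rule: dec_induct)
      case base
      show ?case using \<open>facets_of Fs (K 1) (lab 1) = {D0}\<close> by (auto simp: star_connected_def)
    next
      case (step i)
      have i: "i \<in> {1..k}" "Suc i \<in> {1..k}" and IH: "star_connected (K i) (lab i)" using step by auto
      show ?case
      proof (cases "i < N")
        case True
        then obtain e S s where "glued Fs (K i) (lab i) (K (Suc i)) (lab (Suc i)) e S s" using glue[of i] step by auto
        from star_connected_glued[OF lb[OF i(1)] lb[OF i(2)] this IH] show ?thesis .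
      next
        case False
        then have "i \<in> {N..<k}" using step by auto
        from star_connected_identified[OF lb[OF i(1)] lb[OF i(2)] ident[OF this] inj[OF i(1)] IH] show ?thesis .
      qed
    qed
  qed
  have "\<exists>w. transport (K N) (lab N) w \<and> (\<forall>A. bij (w A))"
    using Nk(1) order_refl[of N]
  proof (induction N rule: dec_induct)
    case base
    have "\<not> shared Fs (K 1) (lab 1) t D D'" for t D D' using \<open>facets_of Fs (K 1) (lab 1) = {D0}\<close> by (auto simp: shared_def)
    then have "transport (K 1) (lab 1) (\<lambda>_. id)" by (auto simp: transport_def)
    then show ?case using bij_id by blast
  next
    case (step i)
    then have i: "i \<in> {1..k}" "Suc i \<in> {1..k}" using Nk by auto
    obtain e S s where "glued Fs (K i) (lab i) (K (Suc i)) (lab (Suc i)) e S s" using glue[of i] step by auto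
    moreover obtain w where "transport (K i) (lab i) w" "\<And>A. bij (w A)" using step by auto
    ultimately show ?case using transport_glued[OF lb[OF i(1)] lb[OF i(2)] _ inj[OF i(2)]] by blast
  qed
  then obtain w where w: "transport (K N) (lab N) w" and bw: "\<And>A. bij (w A)" by auto
  have "\<exists>C1 C2. C1 \<in> facets_of Fs (K i) (lab i) \<and> C2 \<in> facets_of Fs (K i) (lab i) \<and> s i \<subseteq> C1 \<and> t i \<subseteq> C2"
    if "i \<in> {N..<k}" for i
    using ex1_implies_ex[OF identifiedD(9)[OF ident[OF that]]] ex1_implies_ex[OF identifiedD(10)[OF ident[OF that]]]
    by (elim exE conjE) (intro exI conjI)
  then obtain C1 C2 where C: "\<And>i. i \<in> {N..<k} \<Longrightarrow> C1 i \<in> facets_of Fs (K i) (lab i)"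
      "\<And>i. i \<in> {N..<k} \<Longrightarrow> C2 i \<in> facets_of Fs (K i) (lab i)"
      "\<And>i. i \<in> {N..<k} \<Longrightarrow> s i \<subseteq> C1 i" "\<And>i. i \<in> {N..<k} \<Longrightarrow> t i \<subseteq> C2 i" by metis
  define A where "A i = lab i (C1 i)" for i
  define B where "B i = lab i (C2 i)" for i
  define F where "F i = lab i (E i)" for i
  have new: "shared Fs (K (Suc i)) (lab (Suc i)) (q i (s i)) (q i (C1 i)) (q i (C2 i))" if "i \<in> {N..<k}" for i
    using identified_shared_new[OF lb ident inj C(1-4)] that in1k by blast
  have AB: "adj (A i) (B i)" "A i \<inter> B i = lab i (s i)" if i: "i \<in> {N..<k}" for i
  proof -
    note GD = identifiedD(2)[OF ident[OF i]]
    have "lab (Suc i) (q i (C1 i)) = A i" "lab (Suc i) (q i (C2 i)) = B i" "lab (Suc i) (q i (s i)) = lab i (s i)"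
      unfolding A_def B_def by (rule GD, rule facets_ofD(1)[OF C(1)[OF i]] facets_ofD(1)[OF C(2)[OF i]] identifiedD(4)[OF ident[OF i]])+
    then show "adj (A i) (B i)" "A i \<inter> B i = lab i (s i)"
      using shared_adj[OF lb[OF in1k(2)[OF i]] inj[OF in1k(2)[OF i]] new[OF i]] by simp_all
  qed
  have st: "lab i (s i) = lab i (t i)" if i: "i \<in> {N..<k}" for i
    using identifiedD(2)[OF ident[OF i] identifiedD(4)[OF ident[OF i]]]
      identifiedD(2)[OF ident[OF i] identifiedD(5)[OF ident[OF i]]] identifiedD(7)[OF ident[OF i]] by simp
  
  \<comment> \<open>The triangle closed in step \<open>i\<close> is shared by no two facets at any
    stage from \<open>N\<close> to \<open>i\<close>: such a pair would persist up to stage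
    \<open>i\<close>, where \<open>thin\<close> leaves only \<open>C1 i\<close> and
    \<open>C2 i\<close>, and then \<open>s i\<close> and \<open>t i\<close> would be the same
    face.\<close>
  have unshared: "lab m u \<noteq> A i \<inter> B i" if i: "i \<in> {N..<k}" and "N \<le> m" "m \<le> i" and u: "shared Fs (K m) (lab m) u D D'" for i m u D D'
    using that(3,2) u
  proof (induction m arbitrary: u D D' rule: inc_induct)
    case base
    note i1 = in1k(1)[OF i]
    show ?case
    proof
      assume eq: "lab i u = A i \<inter> B i"
      have D: "D \<in> facets_of Fs (K i) (lab i)" "D' \<in> facets_of Fs (K i) (lab i)" "D \<noteq> D'" "u \<subseteq> D" "u \<subseteq> D'" "u \<in> K i"
        using base.prems by (auto simp: shared_def)
      have DAB: "X = C1 i \<or> X = C2 i" if X: "X \<in> facets_of Fs (K i) (lab i)" "u \<subseteq> X" for X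
      proof -
        have "A i \<inter> B i \<subseteq> lab i X" using labelling_mono[OF lb[OF i1] D(6) facets_ofD(1)[OF X(1)] X(2)] eq by simp
        then have "lab i X = A i \<or> lab i X = B i" by (rule thin[OF AB(1)[OF i] facets_ofD(2)[OF X(1)]])
        then show ?thesis unfolding A_def B_def using inj_onD[OF inj[OF i1] _ X(1)] C(1,2)[OF i] by metis
      qed
      then have uC: "u \<subseteq> C1 i" "u \<subseteq> C2 i" using D by metis+
      have "u = s i"
        by (rule labelling_inj[OF lb[OF i1] facets_ofD(1)[OF C(1)[OF i]] D(6) identifiedD(4)[OF ident[OF i]] uC(1) C(3)[OF i]])
          (use eq AB(2)[OF i] in simp)
      moreover have "u = t i"
        by (rule labelling_inj[OF lb[OF i1] facets_ofD(1)[OF C(2)[OF i]] D(6) identifiedD(5)[OF ident[OF i]] uC(2) C(4)[OF i]])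
          (use eq AB(2)[OF i] st[OF i] in simp)
      ultimately show False using identifiedD(6)[OF ident[OF i]] by simp
    qed
  next
    case (step m)
    then have m: "m \<in> {N..<k}" using i by auto
    have "u \<in> K m" using step.prems by (auto simp: shared_def)
    then have "lab (Suc m) (q m u) = lab m u" by (rule identifiedD(2)[OF ident[OF m]])
    then show ?case using step.IH[OF _ identified_shared_old[OF ident[OF m] step.prems(2) inj[OF in1k(1)[OF m]]]] step.prems by simp
  qed
  have F: "card (F i) = 2" "F i \<subseteq> A i \<inter> B i" if i: "i \<in> {N..<k}" for i
  proof -
    note GD = identifiedD[OF ident[OF i]]
    show "card (F i) = 2" unfolding F_def by (rule GD(12))
    show "F i \<subseteq> A i \<inter> B i" unfolding F_def AB(2)[OF i]
      by (rule labelling_mono[OF lb[OF in1k(1)[OF i]] GD(11) GD(4) GD(13)])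
  qed
  \<comment> \<open>This walks around the common edge, still inside stage \<open>i\<close>, from the
    facet behind \<open>s i\<close> to the one behind \<open>t i\<close>.\<close>
  have across: "f (B i) = h (B i) ` S"
    if i: "i \<in> {N..<k}" and par: "parallel (K i) (lab i) f" and S: "f (A i) = h (A i) ` S"
      and h: "\<And>A B. adj A B \<Longrightarrow> F i \<subseteq> A \<inter> B \<Longrightarrow> A \<inter> B \<noteq> X \<Longrightarrow> g A B \<circ> h A = h B"
      and X: "\<And>u D D'. shared Fs (K i) (lab i) u D D' \<Longrightarrow> lab i u \<noteq> X" for i f S X and h :: "'v set \<Rightarrow> 'p \<Rightarrow> 'p"
  proof -
    note GD = identifiedD[OF ident[OF i]] and i1 = in1k(1)[OF i]
    have "(C1 i, C2 i) \<in> (star_rel (K i) (lab i) (E i))\<^sup>*"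
      using sc[OF i1] C(1,2)[OF i] GD(11,12) order_trans[OF GD(13) C(3)[OF i]] order_trans[OF GD(14) C(4)[OF i]]
      unfolding star_connected_def by simp
    from parallel_star[OF lb[OF i1] inj[OF i1] par h[unfolded F_def] X GD(11) this S[unfolded A_def]]
    show ?thesis by (simp add: B_def)
  qed
  text \<open>Earlier steps over the same edge of \<open>Br\<close> avoid the triangle glued in the last one, so that only
    the last step over each edge of \<open>Br\<close> can be obstructed.\<close>
  define bad where "bad = {i \<in> {N..<k}. F i \<in> Br \<and> (\<forall>j\<in>{N..<k}. i < j \<longrightarrow> F j \<noteq> F i)}"
  have bad: "i \<in> {N..<k}" "F i \<in> Br" if "i \<in> bad" for i using that by (auto simp: bad_def)
  have "inj_on F bad"
  proof (rule inj_onI)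
    fix i j assume "i \<in> bad" "j \<in> bad" "F i = F j"
    then show "i = j" unfolding bad_def by (metis (mono_tags, lifting) linorder_neqE_nat mem_Collect_eq)
  qed
  moreover have "F ` bad \<subseteq> Br" using bad by auto
  ultimately have cb: "card bad \<le> card Br" using fin_Br by (metis card_image card_mono)
  have finbad: "finite bad" by (auto simp: bad_def)
  define R where "R i z \<longleftrightarrow> (case z of (h, x, y) \<Rightarrow> (\<forall>C. bij (h C)) \<and>
        (\<forall>C D. adj C D \<longrightarrow> F i \<subseteq> C \<inter> D \<longrightarrow> C \<inter> D \<noteq> A i \<inter> B i \<longrightarrow> g C D \<circ> h C = h D) \<and>
        (\<forall>S. (x \<in> S \<longleftrightarrow> y \<in> S) \<longrightarrow> g (A i) (B i) ` h (A i) ` S = h (B i) ` S))"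
    for i and z :: "('v set \<Rightarrow> 'p \<Rightarrow> 'p) \<times> 'p \<times> 'p"
  have "\<exists>z. R i z" if i: "i \<in> bad" for i
    using cut[OF bad(2)[OF i] AB(1)[OF bad(1)[OF i]] F(2)[OF bad(1)[OF i]]]
    unfolding R_def split_paired_Ex prod.case .
  then obtain Z where Z: "\<And>i. i \<in> bad \<Longrightarrow> R i (Z i)" by metis
  define h x y where "h i = fst (Z i)" and "x i = fst (snd (Z i))" and "y i = snd (snd (Z i))" for i
  have "R i (h i, x i, y i)" if "i \<in> bad" for i using Z[OF that] by (simp add: h_def x_def y_def)
  note R = this[unfolded R_def prod.case]
  have h: "bij (h i C)" "adj C D \<Longrightarrow> F i \<subseteq> C \<inter> D \<Longrightarrow> C \<inter> D \<noteq> A i \<inter> B i \<Longrightarrow> g C D \<circ> h i C = h i D"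
    "(x i \<in> S \<longleftrightarrow> y i \<in> S) \<Longrightarrow> g (A i) (B i) ` h i (A i) ` S = h i (B i) ` S" if "i \<in> bad" for i C D S
    by (rule R[OF that, THEN conjunct1, rule_format],
      rule R[OF that, THEN conjunct2, THEN conjunct1, rule_format], assumption+,
      rule R[OF that, THEN conjunct2, THEN conjunct2, rule_format], assumption)
  \<comment> \<open>Both sheets are given in the coordinates \<open>h i\<close>. They are moved to
    the fibre over \<open>A i\<close> and from there back along \<open>w\<close> to the fixed
    sheets, where all pairs can be compared.\<close>
  define P where "P = (\<lambda>i. (inv_into UNIV (w (A i)) (h i (A i) (x i)), inv_into UNIV (w (A i)) (h i (A i) (y i)))) ` bad"
  have "finite P" "card P \<le> card bad" using finbad by (auto simp: P_def card_image_le)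
  then obtain Q where Q: "\<forall>(x, y)\<in>P. x \<in> Q \<longleftrightarrow> y \<in> Q" "\<exists>u. u \<in> Q" "\<exists>u. u \<notin> Q"
    using non_separating_set[of P "UNIV :: 'p set"] cb card_Br by auto
  define f where "f A = w A ` Q" for A
  have "parallel (K i) (lab i) f" if "N \<le> i" "i \<le> k" for i
    using that
  proof (induction i rule: dec_induct)
    case base
    show ?case using w by (auto simp: parallel_def transport_def f_def image_comp)
  next
    case (step i)
    then have i: "i \<in> {N..<k}" and par: "parallel (K i) (lab i) f" by auto
    note i1 = in1k(1)[OF i] and i2 = in1k(2)[OF i]
    have preimage: "f (A i) = h' (A i) ` inv_into UNIV (h' (A i)) ` f (A i)" if "\<And>A. bij (h' A)" for h' :: "'v set \<Rightarrow> 'p \<Rightarrow> 'p"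
      by (simp add: image_image surj_f_inv_f[OF bij_is_surj[OF that]])
    have "f (B i) = g (A i) (B i) ` f (A i)"
    proof (cases "F i \<in> Br")
      case False
      obtain h' :: "'v set \<Rightarrow> 'p \<Rightarrow> 'p" where h': "\<And>A. bij (h' A)" "\<And>A B. adj A B \<Longrightarrow> F i \<subseteq> A \<inter> B \<Longrightarrow> g A B \<circ> h' A = h' B"
        using flat[OF F(1)[OF i] False] by auto
      \<comment> \<open>The excluded triangle is \<open>{}\<close>, which excludes nothing because
        labels of triangles have three elements: around an edge outside \<open>Br\<close> the
        trivialization is complete.\<close>
      have "f (B i) = h' (B i) ` inv_into UNIV (h' (A i)) ` f (A i)"
        by (rule across[of i f h' _ "{}", OF i par preimage[of h', OF h'(1)]]) (rule h'(2), assumption+, force simp: shared_def)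
      also have "h' (B i) = g (A i) (B i) \<circ> h' (A i)" using h'(2)[OF AB(1)[OF i] F(2)[OF i]] ..
      finally show ?thesis by (simp add: image_image surj_f_inv_f[OF bij_is_surj[OF h'(1)]])
    next
      case True
      define J where "J = {j \<in> {N..<k}. i \<le> j \<and> F j = F i}"
      have "finite J" "J \<noteq> {}" using i by (auto simp: J_def)
      then have "Max J \<in> J" "\<And>j. j \<in> J \<Longrightarrow> j \<le> Max J" by auto
      then obtain j where j: "j \<in> {N..<k}" "i \<le> j" "F j = F i" and mx: "\<And>l. l \<in> J \<Longrightarrow> l \<le> j" by (auto simp: J_def)
      have jb: "j \<in> bad"
      proof -
        have "F l \<noteq> F j" if "l \<in> {N..<k}" "j < l" for l using mx[of l] that j by (auto simp: J_def)
        then show ?thesis using j True by (auto simp: bad_def)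
      qed
      \<comment> \<open>The trivialization belongs to the last step \<open>j\<close> over this edge.
        Its exceptional triangle is not yet shared at stage \<open>i \<le> j\<close>, so it is valid
        on the whole star.\<close>
      have fB: "f (B i) = h j (B i) ` inv_into UNIV (h j (A i)) ` f (A i)"
        by (rule across[of i f "h j" _ "A j \<inter> B j", OF i par preimage[of "h j", OF h(1)[OF jb]]])
          (rule h(2)[OF jb, unfolded j(3)], assumption+, rule unshared[OF j(1) _ j(2)], use i in auto)
      show ?thesis
      proof (cases "j = i")
        case False
        \<comment> \<open>The triangle closed in step \<open>i\<close> is shared at stage
          \<open>Suc i \<le> j\<close>, that of step \<open>j\<close> is not. So the two differ, and
          crossing the former is unobstructed for \<open>h j\<close>.\<close>
        have "lab (Suc i) (q i (s i)) \<noteq> A j \<inter> B j"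
          by (rule unshared[OF j(1) _ _ new[OF i]]) (use i j False in auto)
        then have "A i \<inter> B i \<noteq> A j \<inter> B j"
          using AB(2)[OF i] identifiedD(2)[OF ident[OF i] identifiedD(4)[OF ident[OF i]]] by simp
        then have "h j (B i) = g (A i) (B i) \<circ> h j (A i)" using h(2)[OF jb AB(1)[OF i]] F(2)[OF i] j by simp
        then show ?thesis using fB by (simp add: image_image surj_f_inv_f[OF bij_is_surj[OF h(1)[OF jb]]])
      next
        case True
        have ib: "i \<in> bad" using jb True by simp
        \<comment> \<open>\<open>S\<close> is the family at \<open>A i\<close> in the coordinates
          \<open>h i\<close>. By the choice of \<open>Q\<close> it contains both transposed sheets
          or neither, so the jump across the cut leaves it unchanged.\<close>
        define S where "S = inv_into UNIV (h i (A i)) ` f (A i)"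
        have S: "z \<in> S \<longleftrightarrow> inv_into UNIV (w (A i)) (h i (A i) z) \<in> Q" for z
        proof -
          have "z \<in> S \<longleftrightarrow> h i (A i) z \<in> f (A i)"
            unfolding S_def bij_vimage_eq_inv_image[OF h(1)[OF ib], symmetric] by simp
          also have "\<dots> \<longleftrightarrow> inv_into UNIV (w (A i)) (h i (A i) z) \<in> Q"
            using bij_vimage_eq_inv_image[OF bij_imp_bij_inv[OF bw[of "A i"]], of Q] inv_inv_eq[OF bw[of "A i"]]
            unfolding f_def by auto
          finally show ?thesis .
        qed
        have "x i \<in> S \<longleftrightarrow> y i \<in> S" using Q(1) ib unfolding S P_def by auto
        from h(3)[OF ib this] have "g (A i) (B i) ` f (A i) = h i (B i) ` S"
          using preimage[of "h i", OF h(1)[OF ib]] unfolding S_def by argo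
        then show ?thesis using fB True by (simp add: S_def)
      qed
    qed
    from parallel_identified[OF lb[OF i1] lb[OF i2] ident[OF i] inj[OF i1] inj[OF i2] par C(1-4)[OF i] this[unfolded A_def B_def]]
    show ?case .
  qed
  then have pk: "parallel (K k) (lab k) f" using Nk by simp
  have "f B = g A B ` f A" if AB: "adj A B" for A B
    using pk final[OF AB] unfolding parallel_def by blast
  moreover obtain R where "\<And>f. (\<forall>A B. adj A B \<longrightarrow> f B = g A B ` f A) \<Longrightarrow> f R = {} \<or> f R = UNIV" using conn by auto
  ultimately have "f R = {} \<or> f R = UNIV" by simp
  then show False
    using Q(2,3) inj_image_eq_iff[OF bij_is_inj[OF bw[of R]], of Q UNIV] bij_is_surj[OF bw[of R]]
    unfolding f_def by auto
qed

end

section \<open>Barycentric coordinates and bistellar moves\<close>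

text \<open>Coordinates are indexed by all vertex names, so that realizations before and after a
  move, which may have different vertex sets, lie in one space.\<close>

definition bary :: "'v set \<Rightarrow> ('v \<Rightarrow> real) set" where
  "bary F = {x. (\<forall>i. 0 \<le> x i) \<and> (\<forall>i. i \<notin> F \<longrightarrow> x i = 0) \<and> sum x F = 1}"

definition realization :: "'v set set \<Rightarrow> ('v \<Rightarrow> real) set" where
  "realization Fs = (\<Union>F\<in>Fs. bary F)"

lemma bary_mono:
  assumes "F \<subseteq> G" "finite G" shows "bary F \<subseteq> bary G"
proof
  fix x assume x: "x \<in> bary F"
  then have "sum x F = sum x G" by (intro sum.mono_neutral_left assms) (auto simp: bary_def)
  then show "x \<in> bary G" using x assms by (auto simp: bary_def)
qed

text \<open>The move replaces \<open>A * \<partial>B\<close> by \<open>\<partial>A * B\<close>. Pushing along the line through the barycentres of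
  \<open>A\<close> and \<open>B\<close> until a coordinate in \<open>A\<close> vanishes maps one ball to the other and fixes their common boundary.\<close>

definition flip_map :: "'v set \<Rightarrow> 'v set \<Rightarrow> ('v \<Rightarrow> real) \<Rightarrow> 'v \<Rightarrow> real" where
  "flip_map A B x = (\<lambda>i. x i - Min (x ` A) * (if i \<in> A then 1 else if i \<in> B then - (card A / card B) else 0))"

text \<open>In terms of facets: the star of \<open>A\<close> is \<open>A * \<partial>B\<close>, and
  \<open>B\<close> is not a face. The second condition is what makes the reverse replacement a move
  as well.\<close>

definition bistellar :: "'v set \<Rightarrow> 'v set \<Rightarrow> 'v set set \<Rightarrow> 'v set set \<Rightarrow> bool" where
  "bistellar A B Fs Gs \<longleftrightarrow> finite A \<and> finite B \<and> A \<noteq> {} \<and> B \<noteq> {} \<and> A \<inter> B = {} \<and>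
     {F \<in> Fs. A \<subseteq> F} = (\<lambda>b. A \<union> B - {b}) ` B \<and> (\<forall>F\<in>Fs. \<not> B \<subseteq> F) \<and>
     Gs = {F \<in> Fs. \<not> A \<subseteq> F} \<union> (\<lambda>a. A \<union> B - {a}) ` A"

lemma bistellar_sym:
  assumes "bistellar A B Fs Gs" shows "bistellar B A Gs Fs"
proof -
  have f: "finite A" "finite B" "A \<noteq> {}" "B \<noteq> {}" "A \<inter> B = {}"
    and lk: "{F \<in> Fs. A \<subseteq> F} = (\<lambda>b. A \<union> B - {b}) ` B" and nB: "\<And>F. F \<in> Fs \<Longrightarrow> \<not> B \<subseteq> F"
    and Gs: "Gs = {F \<in> Fs. \<not> A \<subseteq> F} \<union> (\<lambda>a. A \<union> B - {a}) ` A"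
    using assms by (auto simp: bistellar_def)
  have 1: "B \<subseteq> A \<union> B - {a}" "\<not> A \<subseteq> A \<union> B - {a}" if "a \<in> A" for a using that f by auto
  have 2: "{F \<in> Gs. B \<subseteq> F} = (\<lambda>a. B \<union> A - {a}) ` A"
    using nB 1 unfolding Gs by (auto simp: Un_commute)
  have 3: "\<forall>F\<in>Gs. \<not> A \<subseteq> F" using 1 unfolding Gs by auto
  have "{F \<in> Gs. \<not> B \<subseteq> F} = {F \<in> Fs. \<not> A \<subseteq> F}" using nB 1 unfolding Gs by auto
  moreover have "Fs = {F \<in> Fs. \<not> A \<subseteq> F} \<union> {F \<in> Fs. A \<subseteq> F}" by auto
  ultimately have 4: "Fs = {F \<in> Gs. \<not> B \<subseteq> F} \<union> (\<lambda>b. B \<union> A - {b}) ` B" unfolding lk by (simp add: Un_commute)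
  show ?thesis unfolding bistellar_def using f 2 3 4 by (simp add: Int_commute)
qed

text \<open>Before the move some coordinate in \<open>B\<close> vanishes, since \<open>B\<close> is
  not a face. After the push the minimum over \<open>B\<close> is therefore exactly the amount added
  there, and the opposite map takes it away again. Where nothing was pushed, both minima are
  0.\<close>

lemma flip_map_inverse:
  assumes bi: "bistellar A B Fs Gs" and x: "x \<in> realization Fs"
  shows "flip_map A B x \<in> realization Gs" "flip_map B A (flip_map A B x) = x"
proof -
  have f: "finite A" "finite B" "A \<noteq> {}" "B \<noteq> {}" "A \<inter> B = {}"
    and lk: "{F \<in> Fs. A \<subseteq> F} = (\<lambda>b. A \<union> B - {b}) ` B" and nB: "\<And>F. F \<in> Fs \<Longrightarrow> \<not> B \<subseteq> F"
    and Gs: "Gs = {F \<in> Fs. \<not> A \<subseteq> F} \<union> (\<lambda>a. A \<union> B - {a}) ` A"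
    using bi by (auto simp: bistellar_def)
  obtain F where F: "F \<in> Fs" "x \<in> bary F" using x by (auto simp: realization_def)
  have x0: "\<And>i. 0 \<le> x i" and xF: "\<And>i. i \<notin> F \<Longrightarrow> x i = 0" and x1: "sum x F = 1" using F(2) by (auto simp: bary_def)
  have "Min (x ` B) = 0"
  proof (rule Min_eqI)
    obtain b where "b \<in> B" "b \<notin> F" using nB[OF F(1)] by auto
    then show "0 \<in> x ` B" using xF by force
  qed (use f x0 in auto)
  note minB = this
  let ?m = "Min (x ` A)" and ?c = "real (card A) / real (card B)"
  have c: "0 < ?c" "?c * (real (card B) / real (card A)) = 1" using f by (auto simp: card_gt_0_iff)
  have "flip_map A B x \<in> realization Gs \<and> flip_map B A (flip_map A B x) = x"
  proof (cases "A \<subseteq> F")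
    case False
    then obtain a where "a \<in> A" "a \<notin> F" by auto
    then have "0 \<in> x ` A" using xF by force
    then have m0: "?m = 0" using f x0 by (intro Min_eqI) auto
    then have "flip_map A B x = x" by (simp add: flip_map_def)
    moreover have "flip_map B A x = x" using minB by (simp add: flip_map_def)
    moreover have "F \<in> Gs" using F False by (auto simp: Gs)
    ultimately show ?thesis using F by (auto simp: realization_def)
  next
    case True
    then obtain b where b: "b \<in> B" "F = A \<union> B - {b}" using lk F by blast
    let ?y = "flip_map A B x"
    have m: "0 \<le> ?m" "\<And>a. a \<in> A \<Longrightarrow> ?m \<le> x a" using f x0 by auto
    have "?m \<in> x ` A" using f by (intro Min_in) auto
    then obtain a where a: "a \<in> A" "x a = ?m" by force
    have yA: "?y i = x i - ?m" if "i \<in> A" for i using that by (simp add: flip_map_def)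
    have yB: "?y i = x i + ?m * ?c" if "i \<in> B" for i using that f by (auto simp: flip_map_def)
    have yO: "?y i = 0" if "i \<notin> A" "i \<notin> B" for i using that b xF by (auto simp: flip_map_def)
    have xb: "x b = 0" using b xF by auto
    have fin: "finite (A \<union> B)" using f by auto
    have "sum x (A \<union> B) = 1"
      using x1 unfolding b(2) using sum.remove[OF fin, of b x] b xb by auto
    then have sx: "sum x A + sum x B = 1" using f by (simp add: sum.union_disjoint)
    have "sum ?y (A \<union> B) = (\<Sum>i\<in>A. x i - ?m) + (\<Sum>i\<in>B. x i + ?m * ?c)"
      using f yA yB by (simp add: sum.union_disjoint cong: sum.cong)
    also have "\<dots> = 1" using sx f c by (simp add: sum_subtractf sum.distrib card_gt_0_iff)
    finally have "sum ?y (A \<union> B - {a}) = 1" using sum.remove[OF fin, of a ?y] a yA[OF a(1)] by auto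
    moreover have "0 \<le> ?y i" for i
      using yA[of i] yB[of i] yO[of i] m x0[of i] c(1) by (cases "i \<in> A"; cases "i \<in> B") auto
    moreover have "?y i = 0" if "i \<notin> A \<union> B - {a}" for i using that yO[of i] yA[OF a(1)] a by auto
    ultimately have "?y \<in> bary (A \<union> B - {a})" by (auto simp: bary_def)
    then have "?y \<in> realization Gs" using a by (auto simp: realization_def Gs)
    moreover have "flip_map B A ?y = x"
    proof -
      have "Min (?y ` B) = ?m * ?c"
      proof (rule Min_eqI)
        show "?m * ?c \<in> ?y ` B" using yB[OF b(1)] xb b(1) by (simp add: image_iff) metis
      qed (use f yB x0 in auto)
      then have mm: "Min (?y ` B) = ?m * ?c" "Min (?y ` B) * (card B / card A) = ?m"
        using c(2) by (auto simp: mult.assoc)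
      show ?thesis
      proof
        fix i
        consider "i \<in> A" "i \<notin> B" | "i \<in> B" "i \<notin> A" | "i \<notin> A" "i \<notin> B" using f by auto
        then show "flip_map B A ?y i = x i"
        proof cases
          case 1
          then have "flip_map B A ?y i = ?y i + Min (?y ` B) * (card B / card A)"
            unfolding flip_map_def[of B A] by simp
          then show ?thesis using mm yA 1 by simp
        next
          case 2
          then have "flip_map B A ?y i = ?y i - Min (?y ` B)" unfolding flip_map_def[of B A] by simp
          then show ?thesis using mm yB 2 by simp
        next
          case 3
          then show ?thesis using yO b xF unfolding flip_map_def[of B A] by simp
        qed
      qed
    qed
    ultimately show ?thesis by simp
  qed
  then show "flip_map A B x \<in> realization Gs" "flip_map B A (flip_map A B x) = x" by auto
qed

lemma continuous_on_Min:
  fixes f :: "'i \<Rightarrow> 'a::topological_space \<Rightarrow> real"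
  assumes "finite A" "A \<noteq> {}" "\<And>i. i \<in> A \<Longrightarrow> continuous_on S (f i)"
  shows "continuous_on S (\<lambda>x. Min ((\<lambda>i. f i x) ` A))"
  using assms by (induction rule: finite_ne_induct) (auto intro!: continuous_intros)

lemma continuous_on_flip_map:
  assumes "finite A" "A \<noteq> {}" shows "continuous_on S (flip_map A B)"
  unfolding flip_map_def
  by (intro continuous_intros continuous_on_Min assms continuous_on_coordinatewise_then_product
      continuous_on_subset[OF continuous_on_product_coordinates]) auto

lemma bistellar_homeomorphic:
  assumes "bistellar A B Fs Gs" shows "realization Fs homeomorphic realization Gs"
proof -
  note bi = assms and bi' = bistellar_sym[OF assms]
  have f: "finite A" "finite B" "A \<noteq> {}" "B \<noteq> {}" using assms by (auto simp: bistellar_def)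
  have "homeomorphism (realization Fs) (realization Gs) (flip_map A B) (flip_map B A)"
  proof
    show "continuous_on (realization Fs) (flip_map A B)" "continuous_on (realization Gs) (flip_map B A)"
      using f by (auto intro: continuous_on_flip_map)
  qed (use flip_map_inverse[OF bi] flip_map_inverse[OF bi'] in auto)
  then show ?thesis by (auto simp: homeomorphic_def)
qed

lemma compact_bary:
  assumes "finite F" shows "compact (bary (F :: 'v set))"
proof -
  have "compact (Pi\<^sub>E UNIV (\<lambda>i::'v. {0..1::real}))"
    using compactin_PiE[of "\<lambda>i::'v. euclidean" UNIV "\<lambda>i. {0..1::real}"]
    by (simp add: euclidean_product_topology)
  moreover have "closed (bary F)"
  proof -
    have *: "continuous_on UNIV (\<lambda>x :: 'v \<Rightarrow> real. x i)" for i by simp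
    have "bary F = (\<Inter>i. {x. 0 \<le> x i}) \<inter> (\<Inter>i\<in>-F. {x. x i = 0}) \<inter> {x. sum x F = 1}" by (auto simp: bary_def)
    moreover have "closed {x :: 'v \<Rightarrow> real. sum (\<lambda>i. x i) F = 1}" by (intro closed_Collect_eq continuous_intros *)
    moreover have "closed {x :: 'v \<Rightarrow> real. 0 \<le> x i}" "closed {x :: 'v \<Rightarrow> real. x i = 0}" for i
      by (intro closed_Collect_eq closed_Collect_le continuous_intros *)+
    ultimately show ?thesis by (auto intro!: closed_Int closed_INT)
  qed
  moreover have "bary F \<subseteq> Pi\<^sub>E UNIV (\<lambda>i::'v. {0..1::real})"
  proof
    fix x assume x: "x \<in> bary F"
    have "x i \<le> 1" for i
    proof (cases "i \<in> F")
      case True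
      have "x i \<le> sum x F" using x assms True by (intro member_le_sum) (auto simp: bary_def)
      then show ?thesis using x by (auto simp: bary_def)
    qed (use x in \<open>auto simp: bary_def\<close>)
    then show "x \<in> Pi\<^sub>E UNIV (\<lambda>i::'v. {0..1::real})" using x by (auto simp: bary_def)
  qed
  ultimately show ?thesis by (metis compact_Int_closed inf.absorb_iff2)
qed

section \<open>Geometric realization on the moment curve\<close>

definition basis_vec :: "nat \<Rightarrow> real^7" where
  "basis_vec = (SOME b. bij_betw b {..<7} Basis)"

lemma basis_vec: "bij_betw basis_vec {..<7} Basis"
proof -
  have "\<exists>b. bij_betw b {..<7::nat} (Basis :: (real^7) set)"
    using ex_bij_betw_nat_finite[of "Basis :: (real^7) set"] by (simp add: atLeast0LessThan)
  then show ?thesis unfolding basis_vec_def by (rule someI_ex)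
qed

text \<open>The points \<open>(i, i^2, ..., i^7)\<close>. Dimension 7 makes any eight of them
  affinely independent, and eight is the number of vertices of two disjoint tetrahedra, so every
  finite complex of tetrahedra embeds with its vertices on this curve.\<close>

definition moment :: "int \<Rightarrow> real^7" where
  "moment i = (\<Sum>k<7. (of_int i ^ Suc k) *\<^sub>R basis_vec k)"

lemma moment_inner: "k < 7 \<Longrightarrow> moment i \<bullet> basis_vec k = of_int i ^ Suc k"
proof -
  assume k: "k < 7"
  have "basis_vec j \<bullet> basis_vec k = (if j = k then 1 else 0)" if "j < 7" for j
  proof -
    have "basis_vec j \<in> Basis" "basis_vec k \<in> Basis" using bij_betw_apply[OF basis_vec] that k by auto
    moreover have "basis_vec j = basis_vec k \<longleftrightarrow> j = k"
      using inj_on_eq_iff[OF bij_betw_imp_inj_on[OF basis_vec]] that k by auto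
    ultimately show ?thesis by (simp add: inner_Basis)
  qed
  then have "moment i \<bullet> basis_vec k = (\<Sum>j<7. if j = k then of_int i ^ Suc j else 0)"
    unfolding moment_def inner_sum_left by (intro sum.cong) auto
  then show ?thesis using k by simp
qed

text \<open>An affine relation with coefficients \<open>u\<close> annihilates all monomials of
  degree at most 7, hence all polynomials of that degree. The one that vanishes exactly at the other
  points of \<open>S\<close> isolates \<open>u i\<close>.\<close>

lemma moment_independent:
  assumes S: "finite S" "card S \<le> 8" and u: "sum u S = 0" "(\<Sum>i\<in>S. u i *\<^sub>R moment i) = 0" and i: "i \<in> S"
  shows "u i = (0 :: real)"
proof -
  have pow: "(\<Sum>i\<in>S. u i * of_int i ^ k) = 0" if "k \<le> 7" for k
  proof (cases k)
    case (Suc j)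
    have "(\<Sum>i\<in>S. u i *\<^sub>R moment i) \<bullet> basis_vec j = 0" using u by simp
    then show ?thesis using Suc that by (simp add: inner_sum_left moment_inner)
  qed (use u in auto)
  define p :: "real poly" where "p = (\<Prod>j\<in>S - {i}. [:- of_int j, 1:])"
  have "degree p = card (S - {i})" unfolding p_def
    by (subst degree_prod_eq_sum_degree) auto
  then have deg: "degree p \<le> 7" using S i by simp
  have "(\<Sum>j\<in>S. u j * poly p (of_int j)) = (\<Sum>j\<in>S. \<Sum>k\<le>degree p. Polynomial.coeff p k * (u j * of_int j ^ k))"
    by (simp add: poly_altdef sum_distrib_left mult_ac)
  also have "\<dots> = (\<Sum>k\<le>degree p. Polynomial.coeff p k * (\<Sum>j\<in>S. u j * of_int j ^ k))"
    by (subst sum.swap) (simp add: sum_distrib_left)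
  also have "\<dots> = 0" using pow deg by simp
  finally have "(\<Sum>j\<in>S. u j * poly p (of_int j)) = 0" .
  moreover have "poly p (of_int j) = 0" if "j \<in> S - {i}" for j
    using that S by (auto simp: p_def poly_prod prod_zero_iff)
  ultimately have "u i * poly p (of_int i) = 0" using sum.remove[OF S(1) i, of "\<lambda>j. u j * poly p (of_int j)"] by simp
  moreover have "poly p (of_int i) \<noteq> 0" using S by (auto simp: p_def poly_prod)
  ultimately show ?thesis by simp
qed

lemma inj_moment: "inj moment"
proof
  fix i j assume "moment i = moment j"
  then have "moment i \<bullet> basis_vec 0 = moment j \<bullet> basis_vec 0" by (rule arg_cong)
  then have "of_int i ^ Suc 0 = (of_int j ^ Suc 0 :: real)" unfolding moment_inner[of 0, simplified] by simp
  then show "i = j" by simp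
qed

lemma moment_affine_independent:
  assumes "finite S" "card S \<le> 8" shows "\<not> affine_dependent (moment ` S)"
proof
  assume "affine_dependent (moment ` S)"
  then obtain u v where u: "sum u (moment ` S) = 0" "(\<Sum>v\<in>moment ` S. u v *\<^sub>R v) = 0"
    and v: "v \<in> moment ` S" "u v \<noteq> 0"
    using affine_dependent_explicit_finite[of "moment ` S"] assms by auto
  have inj: "inj_on moment S" using inj_moment by (rule inj_on_subset) simp
  obtain i where i: "i \<in> S" "v = moment i" using v by auto
  have "sum (\<lambda>i. u (moment i)) S = 0" "(\<Sum>i\<in>S. u (moment i) *\<^sub>R moment i) = 0"
    using u[unfolded sum.reindex[OF inj] o_def] .
  from moment_independent[OF assms this i(1)] show False using v(2) unfolding i(2) by contradiction
qed

definition simplex_on :: "int set \<Rightarrow> (real^7) set" where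
  "simplex_on A = convex hull (moment ` A)"

lemma simplex_on_Int:
  assumes "finite A" "finite B" "card A \<le> 4" "card B \<le> 4"
  shows "simplex_on A \<inter> simplex_on B = simplex_on (A \<inter> B)"
proof -
  have "card (A \<union> B) \<le> 8" using card_Un_le[of A B] assms by simp
  then have "\<not> affine_dependent (moment ` A \<union> moment ` B)"
    using moment_affine_independent[of "A \<union> B"] assms by (simp add: image_Un)
  from convex_hull_Int[OF this] show ?thesis
    by (simp add: simplex_on_def image_Int[OF inj_moment])
qed

lemma simplex_on_subset_iff:
  assumes "finite A" "finite B" "card A \<le> 4" "card B \<le> 4"
  shows "simplex_on A \<subseteq> simplex_on B \<longleftrightarrow> A \<subseteq> B"
proof
  assume sub: "simplex_on A \<subseteq> simplex_on B"
  show "A \<subseteq> B"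
  proof
    fix a assume a: "a \<in> A"
    have "moment a \<in> simplex_on A" using a by (simp add: simplex_on_def hull_inc)
    then have "simplex_on {a} \<inter> simplex_on B \<noteq> {}" using sub by (auto simp: simplex_on_def)
    then have "simplex_on ({a} \<inter> B) \<noteq> {}" using simplex_on_Int[of "{a}" B] assms by simp
    then show "a \<in> B" by (auto simp: simplex_on_def)
  qed
qed (simp add: simplex_on_def hull_mono image_mono)

definition faces_of :: "'v set set \<Rightarrow> 'v set set" where
  "faces_of Fs = {A. \<exists>F\<in>Fs. A \<subseteq> F}"

lemma simplex_on_face_of:
  assumes "finite A" "card A \<le> 8"
  shows "T face_of simplex_on A \<longleftrightarrow> (\<exists>B\<subseteq>A. T = simplex_on B)"
proof -
  have "T face_of simplex_on A \<longleftrightarrow> (\<exists>c\<subseteq>moment ` A. T = convex hull c)"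
    unfolding simplex_on_def by (rule face_of_convex_hull_affine_independent[OF moment_affine_independent[OF assms]])
  then show ?thesis by (auto simp: simplex_on_def subset_image_iff)
qed

lemma simplicial_complex_simplex_on:
  assumes fin: "finite Fs" and Fs: "\<And>F. F \<in> Fs \<Longrightarrow> finite F \<and> card F \<le> 4"
  shows "simplicial_complex (simplex_on ` faces_of Fs)"
proof -
  have face: "finite A" "card A \<le> 4" if "A \<in> faces_of Fs" for A
    using that Fs by (auto simp: faces_of_def intro: finite_subset order_trans[OF card_mono])
  have "faces_of Fs = (\<Union>F\<in>Fs. Pow F)" by (auto simp: faces_of_def)
  then have "finite (faces_of Fs)" using fin Fs by auto
  moreover have "\<exists>n. n simplex simplex_on A" if "A \<in> faces_of Fs" for A
    using face[OF that] moment_affine_independent[of A]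
    by (auto simp: simplex_def simplex_on_def intro!: exI[of _ "int (card A) - 1"] exI[of _ "moment ` A"] card_image inj_on_subset[OF inj_moment])
  moreover have "T \<in> simplex_on ` faces_of Fs" if "A \<in> faces_of Fs" "T face_of simplex_on A" for A T
    using that face[OF that(1)] simplex_on_face_of[of A T] by (auto simp: faces_of_def)
  moreover have "simplex_on A \<inter> simplex_on B face_of simplex_on A" if "A \<in> faces_of Fs" "B \<in> faces_of Fs" for A B
    using face[OF that(1)] face[OF that(2)] simplex_on_face_of[of A] by (auto simp: simplex_on_Int)
  ultimately show ?thesis by (auto simp: simplicial_complex_def)
qed

definition moment_comb :: "int set \<Rightarrow> (int \<Rightarrow> real) \<Rightarrow> real^7" where
  "moment_comb V x = (\<Sum>i\<in>V. x i *\<^sub>R moment i)"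

lemma moment_comb_bary:
  assumes "finite V" "F \<subseteq> V" shows "moment_comb V ` bary F = simplex_on F"
proof -
  have fF: "finite F" using assms by (rule finite_subset[rotated])
  have inj: "inj_on moment F" using inj_moment by (rule inj_on_subset) simp
  have eq: "moment_comb V x = (\<Sum>i\<in>F. x i *\<^sub>R moment i)" if "x \<in> bary F" for x
    unfolding moment_comb_def using that assms by (intro sum.mono_neutral_right) (auto simp: bary_def)
  show ?thesis
  proof (intro subset_antisym subsetI)
    fix y assume "y \<in> moment_comb V ` bary F"
    then obtain x where x: "x \<in> bary F" "y = (\<Sum>i\<in>F. x i *\<^sub>R moment i)" using eq by auto
    then show "y \<in> simplex_on F" unfolding simplex_on_def x(2)
      by (intro convex_sum fF convex_convex_hull) (auto simp: bary_def hull_inc)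
  next
    fix y assume "y \<in> simplex_on F"
    then obtain u where u: "\<forall>v\<in>moment ` F. 0 \<le> u v" "sum u (moment ` F) = 1" "(\<Sum>v\<in>moment ` F. u v *\<^sub>R v) = y"
      using fF by (auto simp: simplex_on_def convex_hull_finite)
    define x where "x i = (if i \<in> F then u (moment i) else 0)" for i
    have "x \<in> bary F" using u by (auto simp: bary_def x_def sum.reindex[OF inj])
    moreover have "moment_comb V x = y" using eq[OF \<open>x \<in> bary F\<close>] u by (simp add: sum.reindex[OF inj] x_def)
    ultimately show "y \<in> moment_comb V ` bary F" by auto
  qed
qed

text \<open>Two points of the realization lie in simplices with at most eight vertices altogether,
  so affine independence keeps their images apart. Compactness makes the continuous injection a
  homeomorphism.\<close>

lemma realization_homeomorphic:
  assumes fin: "finite Fs" and Fs: "\<And>F. F \<in> Fs \<Longrightarrow> finite F \<and> card F \<le> 4"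
  shows "realization Fs homeomorphic \<Union>(simplex_on ` Fs)"
proof -
  define V where "V = \<Union>Fs"
  have V: "finite V" "\<And>F. F \<in> Fs \<Longrightarrow> F \<subseteq> V" using fin Fs by (auto simp: V_def)
  have "compact (realization Fs)" unfolding realization_def using fin Fs by (intro compact_UN compact_bary) auto
  moreover have "continuous_on (realization Fs) (moment_comb V)"
    unfolding moment_comb_def by (intro continuous_intros continuous_on_subset[OF continuous_on_product_coordinates]) auto
  moreover have "moment_comb V ` realization Fs = \<Union>(simplex_on ` Fs)"
    unfolding realization_def image_UN using moment_comb_bary[OF V] by auto
  moreover have "inj_on (moment_comb V) (realization Fs)"
  proof (rule inj_onI)
    fix x y assume xy: "x \<in> realization Fs" "y \<in> realization Fs" "moment_comb V x = moment_comb V y"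
    then obtain F G where F: "F \<in> Fs" "x \<in> bary F" and G: "G \<in> Fs" "y \<in> bary G" by (auto simp: realization_def)
    have fFG: "finite (F \<union> G)" and FGV: "F \<union> G \<subseteq> V" using F G Fs V by auto
    have c: "card (F \<union> G) \<le> 8" using card_Un_le[of F G] Fs[OF F(1)] Fs[OF G(1)] by simp
    have out: "x i = 0" "y i = 0" if "i \<notin> F \<union> G" for i using that F G by (auto simp: bary_def)
    have "sum x (F \<union> G) = 1" "sum y (F \<union> G) = 1"
      using bary_mono[OF _ fFG, of F] bary_mono[OF _ fFG, of G] F G by (auto simp: bary_def)
    moreover have "(\<Sum>i\<in>F \<union> G. (x i - y i) *\<^sub>R moment i) = moment_comb V (\<lambda>i. x i - y i)"
      unfolding moment_comb_def using V FGV out by (intro sum.mono_neutral_left) auto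
    moreover have "moment_comb V (\<lambda>i. x i - y i) = 0"
      using xy(3) by (simp add: moment_comb_def scaleR_left_diff_distrib sum_subtractf)
    ultimately have eq: "x i - y i = 0" if "i \<in> F \<union> G" for i
      by (intro moment_independent[OF fFG c _ _ that, of "\<lambda>i. x i - y i"]) (simp_all add: sum_subtractf)
    show "x = y"
    proof
      fix i show "x i = y i"
      proof (cases "i \<in> F \<union> G")
        case True show ?thesis using eq[OF True] by simp
      next
        case False show ?thesis using out[OF False] by simp
      qed
    qed
  qed
  ultimately show ?thesis by (rule homeomorphic_compact)
qed

text \<open>The union is the relative frontier of a convex body of dimension four, and all such
  frontiers are homeomorphic.\<close>

lemma simplex_boundary_homeomorphic_sphere:
  assumes V: "finite V" "card V = 5"
  shows "\<Union>(simplex_on ` (\<lambda>a. V - {a}) ` V) homeomorphic sphere (0 :: real^4) 1"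
proof -
  have indep: "\<not> affine_dependent (moment ` V)" using moment_affine_independent V by simp
  have inj: "inj_on moment V" using inj_moment by (rule inj_on_subset) simp
  have "rel_frontier (convex hull (moment ` V)) = \<Union>{convex hull (moment ` V - {x}) |x. x \<in> moment ` V}"
    by (rule rel_frontier_convex_hull_cases[OF indep])
  also have "\<dots> = \<Union>(simplex_on ` (\<lambda>a. V - {a}) ` V)"
    unfolding simplex_on_def by (auto simp: image_set_diff[OF inj_moment] intro!: arg_cong[of _ _ Union])
  finally have "\<Union>(simplex_on ` (\<lambda>a. V - {a}) ` V) = rel_frontier (convex hull (moment ` V))" ..
  moreover have "rel_frontier (convex hull (moment ` V)) homeomorphic rel_frontier (cball (0::real^4) 1)"
  proof (rule homeomorphic_rel_frontiers_convex_bounded_sets)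
    show "bounded (convex hull (moment ` V))" using V by (simp add: finite_imp_bounded bounded_convex_hull)
    show "aff_dim (convex hull (moment ` V)) = aff_dim (cball (0::real^4) 1)"
      using aff_dim_affine_independent[OF indep] V by (simp add: aff_dim_convex_hull card_image[OF inj] aff_dim_cball)
  qed auto
  moreover have "rel_frontier (cball (0::real^4) 1) = sphere 0 1" by (simp add: rel_frontier_cball)
  ultimately show ?thesis by simp
qed

section \<open>Balls\<close>

lemma topspace_ball_topology:
  "topspace (ball_topology n) = {x. (\<forall>i\<ge>n. x i = 0) \<and> (\<Sum>i<n. (x i)\<^sup>2) \<le> 1}"
  by (auto simp: ball_topology_def topspace_Euclidean_space)

lemma ball_boundary_eq: "ball_boundary n = {x. (\<forall>i\<ge>n. x i = 0) \<and> (\<Sum>i<n. (x i)\<^sup>2) = 1}"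
  by (auto simp: ball_boundary_def topspace_ball_topology)

lemma ball_boundary_subset: "ball_boundary n \<subseteq> topspace (ball_topology n)"
  by (auto simp: ball_boundary_def)

lemma zero_in_ball: "(\<lambda>_. 0) \<in> topspace (ball_topology n) - ball_boundary n"
  by (auto simp: topspace_ball_topology ball_boundary_eq)

lemma ball_topology_subtopology:
  "ball_topology n = subtopology (powertop_real UNIV) (topspace (ball_topology n))"
proof -
  have "{x. \<forall>i\<ge>n. x i = 0} \<inter> {x. (\<Sum>i<n. (x i)\<^sup>2) \<le> 1} = topspace (ball_topology n)" by (auto simp: topspace_ball_topology)
  then show ?thesis by (simp add: ball_topology_def Euclidean_space_def subtopology_subtopology)
qed

lemma compact_space_ball: "compact_space (ball_topology n)"
proof -
  let ?P = "Pi\<^sub>E UNIV (\<lambda>_::nat. {-1..1::real})"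
  have cP: "compact ?P"
    using compactin_PiE[of "\<lambda>_::nat. euclidean" UNIV "\<lambda>_. {-1..1::real}"] by (simp add: euclidean_product_topology)
  have "topspace (ball_topology n) = (\<Inter>i\<in>{n..}. {x. x i = 0}) \<inter> {x :: nat \<Rightarrow> real. (\<Sum>i<n. (x i)\<^sup>2) \<le> 1}"
    by (auto simp: topspace_ball_topology)
  moreover have "closed {x :: nat \<Rightarrow> real. x i = 0}" for i
    by (intro closed_Collect_eq continuous_intros) simp_all
  moreover have "closed {x :: nat \<Rightarrow> real. (\<Sum>i<n. (x i)\<^sup>2) \<le> 1}"
    by (intro closed_Collect_le continuous_intros) simp_all
  ultimately have "closed (topspace (ball_topology n))" by (auto intro!: closed_Int closed_INT)
  moreover have "topspace (ball_topology n) \<subseteq> ?P"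
  proof
    fix x assume x: "x \<in> topspace (ball_topology n)"
    have "\<bar>x i\<bar> \<le> 1" for i
    proof (cases "i < n")
      case True
      have "(x i)\<^sup>2 \<le> (\<Sum>i<n. (x i)\<^sup>2)" using True by (intro member_le_sum) auto
      then have "(x i)\<^sup>2 \<le> 1" using x by (simp add: topspace_ball_topology)
      then show ?thesis by (simp add: abs_square_le_1)
    qed (use x in \<open>simp add: topspace_ball_topology\<close>)
    then show "x \<in> ?P" by (auto simp: abs_le_iff)
  qed
  ultimately have "compact (topspace (ball_topology n))" using cP by (metis compact_Int_closed inf.absorb_iff2)
  then have "compactin (powertop_real UNIV) (topspace (ball_topology n))" by (simp add: euclidean_product_topology)
  then show ?thesis by (metis ball_topology_subtopology compact_space_subtopology)
qed

section \<open>Low dimensions recognised from the bounding sphere\<close>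

lemma ball_boundary_0: "ball_boundary 0 = {}"
  by (simp add: ball_boundary_eq)

lemma topspace_ball_0: "topspace (ball_topology 0) = {\<lambda>_. 0}"
  by (auto simp: topspace_ball_topology)

lemma ball_boundary_1: "ball_boundary 1 = {(\<lambda>i. if i = 0 then 1 else 0), (\<lambda>i. if i = 0 then -1 else 0)}"
proof -
  have "x \<in> ball_boundary 1 \<longleftrightarrow> x = (\<lambda>i. if i = 0 then 1 else 0) \<or> x = (\<lambda>i. if i = 0 then -1 else 0)" for x
  proof -
    have "x \<in> ball_boundary 1 \<longleftrightarrow> (\<forall>i\<ge>1. x i = 0) \<and> (x 0 = 1 \<or> x 0 = -1)"
      by (simp add: ball_boundary_eq power2_eq_1_iff)
    also have "\<dots> \<longleftrightarrow> x = (\<lambda>i. if i = 0 then 1 else 0) \<or> x = (\<lambda>i. if i = 0 then -1 else 0)"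
      by (auto simp: fun_eq_iff)
    finally show ?thesis .
  qed
  then show ?thesis by blast
qed

lemma card_ball_boundary_1: "card (ball_boundary 1) = 2"
  unfolding ball_boundary_1 by (auto simp: fun_eq_iff card_insert_if)

definition circle_point :: "real \<Rightarrow> nat \<Rightarrow> real" where
  "circle_point t = (\<lambda>i. if i = 0 then cos t else if i = 1 then sin t else 0)"

text \<open>Dimensions 0 and 1 are recognised by counting boundary points: none, two, and from
  dimension 2 on at least a half circle of them.\<close>

lemma infinite_ball_boundary:
  assumes "2 \<le> n" shows "infinite (ball_boundary n)"
proof -
  have "circle_point t \<in> ball_boundary n" for t
  proof -
    have "(\<Sum>i<n. (circle_point t i)\<^sup>2) = (\<Sum>i\<in>{0,1}. (circle_point t i)\<^sup>2)"
      using assms by (intro sum.mono_neutral_right) (auto simp: circle_point_def)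
    also have "\<dots> = 1" by (simp add: circle_point_def)
    finally show ?thesis using assms by (simp add: ball_boundary_eq circle_point_def)
  qed
  then have "circle_point ` {0..pi} \<subseteq> ball_boundary n" by auto
  moreover have "inj_on circle_point {0..pi}"
  proof (rule inj_onI)
    fix s t assume st: "s \<in> {0..pi}" "t \<in> {0..pi}" "circle_point s = circle_point t"
    have "cos s = cos t" using fun_cong[OF st(3), of 0] by (simp add: circle_point_def)
    then show "s = t" by (rule cos_inj_pi[rotated 4]) (use st(1,2) in simp_all)
  qed
  moreover have "infinite {0..pi}" using pi_gt_zero by (simp add: infinite_Icc)
  ultimately show ?thesis using finite_imageD finite_subset by blast
qed

lemma infinite_ball:
  assumes "1 \<le> n" shows "infinite (topspace (ball_topology n))"
proof -
  let ?f = "\<lambda>t i::nat. if i = 0 then t else (0::real)"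
  have "(\<Sum>i<n. (?f t i)\<^sup>2) = t\<^sup>2" for t
  proof -
    have "(\<Sum>i<n. (?f t i)\<^sup>2) = (\<Sum>i\<in>{0}. (?f t i)\<^sup>2)"
      using assms by (intro sum.mono_neutral_right) auto
    then show ?thesis by simp
  qed
  then have "?f t \<in> topspace (ball_topology n)" if "t \<in> {0..1}" for t
    using that assms by (simp add: topspace_ball_topology power_le_one)
  then have "?f ` {0..1} \<subseteq> topspace (ball_topology n)" by blast
  moreover have "inj_on ?f {0..1}" by (auto simp: inj_on_def fun_eq_iff split: if_splits)
  moreover have "infinite {0..1::real}" by (simp add: infinite_Icc)
  ultimately show ?thesis using finite_imageD finite_subset by blast
qed

text \<open>A copy of the ball as a convex subset of \<open>real^7\<close>, where invariance of
  dimension for convex sets applies.\<close>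

definition flat_ball :: "nat \<Rightarrow> (real^7) set" where
  "flat_ball d = span (basis_vec ` {..<d}) \<inter> cball 0 1"

lemma basis_vec_in: "i < 7 \<Longrightarrow> basis_vec i \<in> Basis"
  using bij_betw_apply[OF basis_vec] by simp

lemma homeomorphic_flat_ball:
  assumes "d \<le> 7" shows "ball_topology d homeomorphic_space top_of_set (flat_ball d)"
proof -
  let ?B = "basis_vec ` {..<d}"
  have B: "?B \<subseteq> Basis" using assms basis_vec_in by auto
  have inj: "inj_on basis_vec {..<d}" using bij_betw_imp_inj_on[OF basis_vec] assms by (auto intro: inj_on_subset)
  have ind: "independent ?B" using independent_Basis B by (rule independent_mono)
  have orth: "pairwise orthogonal ?B" using orthogonal_Basis B by (auto simp: pairwise_def)
  have card: "card ?B = d" using card_image[OF inj] by simp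
  have nrm: "\<And>u. u \<in> ?B \<Longrightarrow> norm u = 1" using B by auto
  obtain f g where fg: "homeomorphic_maps (Euclidean_space d) (top_of_set (span ?B)) f g"
    and n: "\<And>x. x \<in> topspace (Euclidean_space d) \<Longrightarrow> (norm (f x))\<^sup>2 = (\<Sum>i<d. (x i)\<^sup>2)"
    using homeomorphic_maps_Euclidean_space_euclidean_gen[OF ind orth card nrm] by blast
  then have hf: "homeomorphic_map (Euclidean_space d) (top_of_set (span ?B)) f" by (auto simp: homeomorphic_map_maps)
  have "f ` (topspace (Euclidean_space d) \<inter> {x. (\<Sum>i<d. (x i)\<^sup>2) \<le> 1}) = topspace (top_of_set (span ?B)) \<inter> cball 0 1"
  proof -
    have im: "f ` topspace (Euclidean_space d) = span ?B" using homeomorphic_imp_surjective_map[OF hf] by simp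
    have le: "(\<Sum>i<d. (x i)\<^sup>2) \<le> 1 \<longleftrightarrow> f x \<in> cball 0 1" if "x \<in> topspace (Euclidean_space d)" for x
      using n[OF that, symmetric] by (simp add: power_le_one_iff)
    show ?thesis
    proof (intro subset_antisym subsetI)
      fix y assume "y \<in> f ` (topspace (Euclidean_space d) \<inter> {x. (\<Sum>i<d. (x i)\<^sup>2) \<le> 1})"
      then obtain x where x: "x \<in> topspace (Euclidean_space d)" "(\<Sum>i<d. (x i)\<^sup>2) \<le> 1" "y = f x" by blast
      then show "y \<in> topspace (top_of_set (span ?B)) \<inter> cball 0 1" using le[OF x(1)] im by auto
    next
      fix y assume y: "y \<in> topspace (top_of_set (span ?B)) \<inter> cball 0 1"
      then have "y \<in> f ` topspace (Euclidean_space d)" unfolding im by simp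
      then obtain x where x: "x \<in> topspace (Euclidean_space d)" "y = f x" by blast
      then have "(\<Sum>i<d. (x i)\<^sup>2) \<le> 1" using le[OF x(1)] y by blast
      then show "y \<in> f ` (topspace (Euclidean_space d) \<inter> {x. (\<Sum>i<d. (x i)\<^sup>2) \<le> 1})" using x by blast
    qed
  qed
  from homeomorphic_map_subtopologies[OF hf this] show ?thesis
    unfolding ball_topology_def flat_ball_def subtopology_subtopology
    by (rule homeomorphic_map_imp_homeomorphic_space)
qed

lemma flat_ball: "convex (flat_ball d)" "compact (flat_ball d)"
  by (auto simp: flat_ball_def convex_Int subspace_imp_convex closed_subspace compact_Int_closed[OF compact_cball] Int_commute)

lemma aff_dim_flat_ball:
  assumes "d \<le> 7" shows "aff_dim (flat_ball d) = int d"
proof -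
  let ?B = "basis_vec ` {..<d}"
  have B: "?B \<subseteq> Basis" using assms basis_vec_in by auto
  have inj: "inj_on basis_vec {..<d}" using bij_betw_imp_inj_on[OF basis_vec] assms by (auto intro: inj_on_subset)
  have ind: "independent ?B" using independent_Basis B by (rule independent_mono)
  have "0 \<in> span ?B \<inter> interior (cball (0::real^7) 1)" by (simp add: interior_cball span_zero)
  then have "aff_dim (flat_ball d) = aff_dim (span ?B)"
    unfolding flat_ball_def by (intro aff_dim_convex_Int_nonempty_interior subspace_imp_convex) auto
  also have "\<dots> = int (dim (span ?B))" by (rule aff_dim_subspace) simp
  also have "\<dots> = int d" using dim_span_eq_card_independent[OF ind] card_image[OF inj] by simp
  finally show ?thesis .
qed

lemma ball_dim_le:
  assumes "m \<le> 7" "d \<le> 7" and f: "continuous_map (ball_topology m) (ball_topology d) f" "inj_on f (topspace (ball_topology m))"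
  shows "m \<le> d"
proof -
  obtain a a' where a: "homeomorphic_maps (ball_topology m) (top_of_set (flat_ball m)) a a'"
    using homeomorphic_flat_ball[OF assms(1)] by (auto simp: homeomorphic_space_def)
  obtain b b' where b: "homeomorphic_maps (ball_topology d) (top_of_set (flat_ball d)) b b'"
    using homeomorphic_flat_ball[OF assms(2)] by (auto simp: homeomorphic_space_def)
  have ca: "continuous_map (top_of_set (flat_ball m)) (ball_topology m) a'" and ia: "inj_on a' (flat_ball m)"
    using a by (auto simp: homeomorphic_maps_def intro: inj_on_inverseI)
  have cb: "continuous_map (ball_topology d) (top_of_set (flat_ball d)) b" and ib: "inj_on b (topspace (ball_topology d))"
    using b by (auto simp: homeomorphic_maps_def intro: inj_on_inverseI)
  have "continuous_map (top_of_set (flat_ball m)) (top_of_set (flat_ball d)) (b \<circ> (f \<circ> a'))"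
    by (intro continuous_map_compose[OF _ cb] continuous_map_compose[OF ca f(1)])
  then have c: "continuous_on (flat_ball m) (b \<circ> (f \<circ> a'))" "(b \<circ> (f \<circ> a')) ` flat_ball m \<subseteq> flat_ball d"
    by (auto simp: continuous_map_in_subtopology)
  have i: "inj_on (b \<circ> (f \<circ> a')) (flat_ball m)"
  proof (intro comp_inj_on ia)
    have s1: "a' ` flat_ball m \<subseteq> topspace (ball_topology m)" using continuous_map_image_subset_topspace[OF ca] by simp
    have s2: "f ` topspace (ball_topology m) \<subseteq> topspace (ball_topology d)" by (rule continuous_map_image_subset_topspace[OF f(1)])
    show "inj_on f (a' ` flat_ball m)" using f(2) s1 by (rule inj_on_subset)
    show "inj_on b ((f \<circ> a') ` flat_ball m)" using ib by (rule inj_on_subset) (use s1 s2 in auto)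
  qed
  have "aff_dim (flat_ball m) \<le> aff_dim (flat_ball d)"
    by (rule invariance_of_dimension_convex_domain[OF flat_ball(1) c(1) order_trans[OF c(2) hull_subset] i])
  then show ?thesis using aff_dim_flat_ball assms by simp
qed

lemma ball_inclusion:
  assumes "m \<le> n" shows "continuous_map (ball_topology m) (ball_topology n) id"
proof -
  have "topspace (ball_topology m) \<subseteq> topspace (ball_topology n)"
  proof
    fix x assume x: "x \<in> topspace (ball_topology m)"
    have "(\<Sum>i<n. (x i)\<^sup>2) = (\<Sum>i<m. (x i)\<^sup>2)"
      using assms x by (intro sum.mono_neutral_right) (auto simp: topspace_ball_topology)
    then show "x \<in> topspace (ball_topology n)" using x assms by (simp add: topspace_ball_topology)
  qed
  then show ?thesis
    by (subst (1 2) ball_topology_subtopology)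
      (auto simp: continuous_map_in_subtopology intro: continuous_map_from_subtopology)
qed

lemma ball_homeomorphic_imp_eq:
  assumes h: "ball_topology n homeomorphic_space ball_topology d" and d: "d \<le> 6"
  shows "n = d"
proof -
  have le: "n \<le> d" if "ball_topology n homeomorphic_space ball_topology d" "d \<le> 6" for n d
  proof -
    obtain f where f: "homeomorphic_map (ball_topology n) (ball_topology d) f"
      using \<open>ball_topology n homeomorphic_space ball_topology d\<close> homeomorphic_space by blast
    \<comment> \<open>\<open>n\<close> is unbounded, while flat copies have dimension at most 7.
      Truncating at 7 is enough: \<open>d \<le> 6\<close> turns \<open>min n 7 \<le> d\<close> into
      \<open>n \<le> d\<close>.\<close>
    let ?m = "min n 7"
    have inc: "continuous_map (ball_topology ?m) (ball_topology n) id" by (rule ball_inclusion) simp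
    have "continuous_map (ball_topology ?m) (ball_topology d) (f \<circ> id)"
      by (rule continuous_map_compose[OF inc homeomorphic_imp_continuous_map[OF f]])
    moreover have "inj_on (f \<circ> id) (topspace (ball_topology ?m))"
      using homeomorphic_imp_injective_map[OF f] continuous_map_image_subset_topspace[OF inc] by (auto intro: inj_on_subset)
    ultimately have "?m \<le> d" using ball_dim_le[of ?m d "f \<circ> id"] that by simp
    then show "n \<le> d" using that by simp
  qed
  have "n \<le> d" by (rule le[OF h d])
  moreover have "d \<le> n"
    using \<open>n \<le> d\<close> d by (intro le[OF homeomorphic_space_sym[THEN iffD1, OF h]]) simp
  ultimately show ?thesis by simp
qed

lemma simplex_on_homeomorphic_ball:
  assumes "card A = Suc d" "d \<le> 7"
  shows "ball_topology d homeomorphic_space top_of_set (simplex_on A)"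
proof -
  have A: "finite A" "card A \<le> 8" using assms by (auto intro: card_ge_0_finite)
  have inj: "inj_on moment A" using inj_moment by (rule inj_on_subset) simp
  have "aff_dim (simplex_on A) = int d"
    using aff_dim_affine_independent[OF moment_affine_independent[OF A]] assms
    by (simp add: simplex_on_def aff_dim_convex_hull card_image[OF inj])
  moreover have "compact (simplex_on A)" "convex (simplex_on A)"
    using A by (auto simp: simplex_on_def intro: finite_imp_compact compact_convex_hull)
  ultimately have "flat_ball d homeomorphic simplex_on A"
    using flat_ball aff_dim_flat_ball[OF assms(2)] by (simp add: homeomorphic_convex_compact_sets)
  then show ?thesis
    by (intro homeomorphic_space_trans[OF homeomorphic_flat_ball[OF assms(2)]]) simp
qed

section \<open>Regular CW complexes\<close>

lemma regular_CWD:
  assumes "regular_CW X K"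
  shows "Hausdorff_space X" "finite K" "\<Union>K = topspace X"
    "c \<in> K \<Longrightarrow> \<exists>n f. homeomorphic_map (ball_topology n) (subtopology X c) f \<and> f ` ball_boundary n = cell_frontier K c"
    "c \<in> K \<Longrightarrow> c' \<in> K \<Longrightarrow> c \<noteq> c' \<Longrightarrow> disjnt (c - cell_frontier K c) (c' - cell_frontier K c')"
  using assms unfolding regular_CW_def by simp_all

lemma cell_subset: "regular_CW X K \<Longrightarrow> c \<in> K \<Longrightarrow> c \<subseteq> topspace X"
  using regular_CWD(3) by blast

lemma cell_topspace: "regular_CW X K \<Longrightarrow> c \<in> K \<Longrightarrow> topspace (subtopology X c) = c"
  using cell_subset by (auto simp: topspace_subtopology)

lemma cell_ball:
  assumes "regular_CW X K" "c \<in> K"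
  obtains n f where "homeomorphic_map (ball_topology n) (subtopology X c) f" "f ` ball_boundary n = cell_frontier K c"
    "f ` topspace (ball_topology n) = c" "inj_on f (topspace (ball_topology n))"
proof -
  obtain n f where f: "homeomorphic_map (ball_topology n) (subtopology X c) f" "f ` ball_boundary n = cell_frontier K c"
    using regular_CWD(4)[OF assms] by blast
  show thesis
    by (rule that[OF f homeomorphic_imp_surjective_map[OF f(1), unfolded cell_topspace[OF assms]]
          homeomorphic_imp_injective_map[OF f(1)]])
qed

lemma cell_compact: "regular_CW X K \<Longrightarrow> c \<in> K \<Longrightarrow> compact_space (subtopology X c)"
  by (elim cell_ball) (auto dest!: homeomorphic_map_imp_homeomorphic_space homeomorphic_compact_space simp: compact_space_ball)

lemma cell_interior: 
  assumes "regular_CW X K" "c \<in> K" obtains x where "x \<in> c" "x \<notin> cell_frontier K c"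
proof -
  obtain n f where f: "f ` ball_boundary n = cell_frontier K c"
    "f ` topspace (ball_topology n) = c" "inj_on f (topspace (ball_topology n))" by (rule cell_ball[OF assms])
  have z: "(\<lambda>_. 0) \<in> topspace (ball_topology n)" "(\<lambda>_. 0) \<notin> ball_boundary n" using zero_in_ball by auto
  then have "f (\<lambda>_. 0) \<notin> f ` ball_boundary n"
    using inj_on_image_mem_iff[OF f(3) _ ball_boundary_subset] by blast
  then show thesis using that[of "f (\<lambda>_. 0)"] z f by blast
qed

lemma cell_nonempty: "regular_CW X K \<Longrightarrow> c \<in> K \<Longrightarrow> c \<noteq> {}"
  using cell_interior by blast

lemma cell_carrier:
  assumes X: "regular_CW X K" and c: "c \<in> K" "x \<in> c"
  obtains b where "b \<in> K" "b \<subseteq> c" "x \<in> b" "x \<notin> cell_frontier K b"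
proof -
  let ?S = "{b \<in> K. b \<subseteq> c \<and> x \<in> b}"
  have fin: "finite ?S" "?S \<noteq> {}" using regular_CWD(2)[OF X] c by auto
  obtain b where b: "b \<in> ?S" and mn: "\<forall>b'\<in>?S. b' \<subseteq> b \<longrightarrow> b = b'"
    using finite_has_minimal[OF fin] by (elim bexE)
  have "x \<notin> cell_frontier K b"
  proof
    assume "x \<in> cell_frontier K b"
    then obtain b' where b': "b' \<in> K" "b' \<subset> b" "x \<in> b'" by (auto simp: cell_frontier_def)
    then have "b' \<in> ?S" using b by blast
    then show False using bspec[OF mn, of b'] b'(2) by (simp add: psubset_eq)
  qed
  then show thesis using that[of b] b by blast
qed

text \<open>The carrier of \<open>x\<close> inside \<open>d\<close> must be \<open>c\<close>,
  because open cells are disjoint. Below, this is the standard way to place a whole cell by means of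
  one interior point.\<close>

lemma interior_point_subset:
  assumes X: "regular_CW X K" and c: "c \<in> K" "x \<in> c" "x \<notin> cell_frontier K c" and d: "d \<in> K" "x \<in> d"
  shows "c \<subseteq> d"
proof -
  obtain b where b: "b \<in> K" "b \<subseteq> d" "x \<in> b" "x \<notin> cell_frontier K b" by (rule cell_carrier[OF X d])
  have "b = c"
    using regular_CWD(5)[OF X b(1) c(1)] b c by (auto simp: disjnt_iff)
  then show ?thesis using b by simp
qed

text \<open>Without proper faces the bounding sphere is empty, which happens only in dimension
  0.\<close>

lemma minimal_cell_singleton:
  assumes X: "regular_CW X K" and c: "c \<in> K" and mn: "\<And>b. b \<in> K \<Longrightarrow> \<not> b \<subset> c"
  obtains v where "c = {v}"
proof -
  have "cell_frontier K c = {}" using mn by (auto simp: cell_frontier_def)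
  then obtain n f where f: "ball_boundary n = {}" "f ` topspace (ball_topology n) = c"
    using cell_ball[OF X c] by (metis image_is_empty)
  have "n = 0"
  proof (rule ccontr)
    assume "n \<noteq> 0"
    then consider "n = 1" | "2 \<le> n" by linarith
    then show False using f(1) infinite_ball_boundary[of n] card_ball_boundary_1 by cases auto
  qed
  then show thesis using that[of "f (\<lambda>_. 0)"] f(2) topspace_ball_0 by auto
qed

definition vert :: "'a set set \<Rightarrow> 'a set \<Rightarrow> 'a set" where
  "vert K c = {v \<in> c. {v} \<in> K}"

lemma vert_mono: "c \<subseteq> d \<Longrightarrow> vert K c \<subseteq> vert K d"
  by (auto simp: vert_def)

lemma vert_singleton: "{v} \<in> K \<Longrightarrow> vert K {v} = {v}"
  by (auto simp: vert_def)

lemma simplicial_CW_regular: "simplicial_CW X K \<Longrightarrow> regular_CW X K"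
  by (simp add: simplicial_CW_def)

text \<open>The boolean interval comes only as an abstract order isomorphism \<open>g\<close>. Its
  atoms are minimal cells, hence points, and naming these points turns index sets into the actual
  vertex sets of faces.\<close>

lemma simplicial_vertices:
  assumes X: "simplicial_CW X K" and c: "c \<in> K"
  shows finite_vert: "finite (vert K c)"
    and vert_subset_iff: "\<And>a b. a \<in> K \<Longrightarrow> b \<in> K \<Longrightarrow> a \<subseteq> c \<Longrightarrow> b \<subseteq> c \<Longrightarrow> a \<subseteq> b \<longleftrightarrow> vert K a \<subseteq> vert K b"
    and vert_face: "\<And>W. W \<subseteq> vert K c \<Longrightarrow> W \<noteq> {} \<Longrightarrow> \<exists>b\<in>K. b \<subseteq> c \<and> vert K b = W"
    and vert_nonempty: "vert K c \<noteq> {}"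
proof -
  note R = simplicial_CW_regular[OF X]
  have "boolean_poset (lower_interval K c)" using X c by (simp add: simplicial_CW_def)
  then obtain n :: nat and g where g: "bij_betw g (Pow {..<n}) (lower_interval K c)"
    and mono: "\<And>A B. A \<subseteq> {..<n} \<Longrightarrow> B \<subseteq> {..<n} \<Longrightarrow> A \<subseteq> B \<longleftrightarrow> g A \<subseteq> g B"
    unfolding boolean_poset_def by auto
  have gL: "g A \<in> insert {} K" "g A \<subseteq> c" if "A \<subseteq> {..<n}" for A
    using bij_betw_apply[OF g, of A] that by (auto simp: lower_interval_def)
  have Lg: "\<exists>A\<subseteq>{..<n}. b = g A" if "b \<in> insert {} K" "b \<subseteq> c" for b
  proof -
    have "b \<in> g ` Pow {..<n}" using that bij_betw_imp_surj_on[OF g] by (simp add: lower_interval_def)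
    then show ?thesis by auto
  qed
  have injg: "A = B" if "A \<subseteq> {..<n}" "B \<subseteq> {..<n}" "g A = g B" for A B
    using that bij_betw_imp_inj_on[OF g] by (auto dest: inj_onD)
  have g0: "g {} = {}"
  proof -
    obtain A where "A \<subseteq> {..<n}" "{} = g A" using Lg[of "{}"] by auto
    then show ?thesis using mono[of "{}" A] by auto
  qed
  have gK: "g A \<in> K" if "A \<subseteq> {..<n}" "A \<noteq> {}" for A
    using gL[OF that(1)] injg[OF that(1), of "{}"] g0 that(2) by auto
  have ex: "\<exists>v. g {j} = {v}" if j: "j < n" for j
  proof -
    have jn: "{j} \<subseteq> {..<n}" using j by simp
    have nb: "\<not> b \<subset> g {j}" if b: "b \<in> K" for b
    proof
      assume bj: "b \<subset> g {j}"
      then obtain B where B: "B \<subseteq> {..<n}" "b = g B" using Lg[of b] b gL[OF jn] by blast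
      have "B \<subseteq> {j}" using mono[OF B(1) jn] bj B by simp
      moreover have "B \<noteq> {j}" using bj B by auto
      ultimately have "B = {}" by auto
      then show False using B g0 cell_nonempty[OF R b] by simp
    qed
    show ?thesis by (rule minimal_cell_singleton[OF R gK[OF jn insert_not_empty] nb]) (assumption, rule exI)
  qed
  define v where "v j = the_elem (g {j})" for j
  have v: "g {j} = {v j}" if j: "j < n" for j
  proof -
    from ex[OF j] obtain u where "g {j} = {u}" by (elim exE)
    then show ?thesis unfolding v_def by simp
  qed
  have injv: "inj_on v {..<n}"
  proof (rule inj_onI)
    fix i j assume ij: "i \<in> {..<n}" "j \<in> {..<n}" "v i = v j"
    have "g {i} = g {j}" using v[of i] v[of j] ij by simp
    then have "{i} = {j}" by (rule injg[rotated 2]) (use ij in simp_all)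
    then show "i = j" by simp
  qed
  have vg: "vert K (g A) = v ` A" if A: "A \<subseteq> {..<n}" for A
  proof (intro subset_antisym subsetI)
    fix x assume "x \<in> vert K (g A)"
    then have x: "x \<in> g A" "{x} \<in> K" by (auto simp: vert_def)
    then obtain B where B: "B \<subseteq> {..<n}" "{x} = g B" using Lg[of "{x}"] gL[OF A] by auto
    have "B \<subseteq> A" using mono[OF B(1) A] x B(2) by auto
    have "B \<noteq> {}" using B g0 by auto
    then obtain j where j: "j \<in> B" by auto
    then have jn: "j < n" using B by auto
    have "g {j} \<subseteq> g B" using mono[of "{j}" B] j B jn by auto
    then have "x = v j" using v[OF jn] B by auto
    then show "x \<in> v ` A" using j \<open>B \<subseteq> A\<close> by auto
  next
    fix x assume "x \<in> v ` A"
    then obtain j where j: "j \<in> A" "x = v j" by auto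
    then have jn: "j < n" using A by auto
    have "g {j} \<subseteq> g A" using mono[of "{j}" A] j A by auto
    moreover have "g {j} \<in> K" using gK[of "{j}"] jn by simp
    ultimately show "x \<in> vert K (g A)" using v[OF jn] j by (auto simp: vert_def)
  qed
  obtain C where C: "C \<subseteq> {..<n}" "c = g C" using Lg[of c] c by auto
  show "finite (vert K c)" unfolding C(2) vg[OF C(1)] using C finite_subset by blast
  have "C \<noteq> {}" using C g0 cell_nonempty[OF R c] by auto
  then show "vert K c \<noteq> {}" unfolding C(2) vg[OF C(1)] by simp
  show "a \<subseteq> b \<longleftrightarrow> vert K a \<subseteq> vert K b" if ab: "a \<in> K" "b \<in> K" "a \<subseteq> c" "b \<subseteq> c" for a b
  proof -
    obtain A where A: "A \<subseteq> {..<n}" "a = g A" using Lg[of a] ab by auto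
    obtain B where B: "B \<subseteq> {..<n}" "b = g B" using Lg[of b] ab by auto
    show ?thesis
      unfolding A(2) B(2) vg[OF A(1)] vg[OF B(1)] mono[OF A(1) B(1), symmetric]
      using inj_on_image_subset_iff[OF injv A(1) B(1)] by simp
  qed
  show "\<exists>b\<in>K. b \<subseteq> c \<and> vert K b = W" if W: "W \<subseteq> vert K c" "W \<noteq> {}" for W
  proof -
    have "W \<subseteq> v ` C" using W unfolding C(2) vg[OF C(1)] by simp
    then obtain A where A: "A \<subseteq> C" "W = v ` A" by (auto simp: subset_image_iff)
    then have An: "A \<subseteq> {..<n}" "A \<noteq> {}" using C W by auto
    then show ?thesis using gK[OF An] gL(2)[OF An(1)] vg[OF An(1)] A by blast
  qed
qed

lemma vert_inj:
  assumes X: "simplicial_CW X K" "c \<in> K" "a \<in> K" "b \<in> K" "a \<subseteq> c" "b \<subseteq> c" "vert K a = vert K b"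
  shows "a = b"
  using vert_subset_iff[OF assms(1-6)] vert_subset_iff[OF assms(1,2,4,3,6,5)] assms(7) by simp

text \<open>Proper faces of \<open>c\<close> have one vertex each and are therefore points, so the
  bounding sphere consists of two points, which forces dimension 1.\<close>

lemma edge_frontier:
  assumes X: "simplicial_CW X K" and c: "c \<in> K" and V: "vert K c = {v, w}" "v \<noteq> w"
  shows "cell_frontier K c = {v, w}" "subtopology X c homeomorphic_space ball_topology 1"
proof -
  note R = simplicial_CW_regular[OF X]
  have vw: "{v} \<in> K" "{w} \<in> K" "v \<in> c" "w \<in> c" using V by (auto simp: vert_def)
  show fr: "cell_frontier K c = {v, w}"
  proof (intro subset_antisym subsetI)
    fix x assume "x \<in> cell_frontier K c"
    then obtain b where b: "b \<in> K" "b \<subset> c" "x \<in> b" by (auto simp: cell_frontier_def)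
    have "vert K b \<subseteq> {v, w}" "vert K b \<noteq> {v, w}" "vert K b \<noteq> {}"
      using vert_mono[of b c K] vert_inj[OF X c b(1) c] b V vert_nonempty[OF X b(1)] by auto
    then obtain u where u: "vert K b = {u}" "u \<in> {v, w}" by auto
    then have "{u} \<in> K" "u \<in> b" by (auto simp: vert_def)
    then have "b = {u}" using vert_inj[OF X b(1) b(1), of "{u}"] u vert_singleton[of u K] by simp
    then show "x \<in> {v, w}" using b u by auto
  next
    fix x assume "x \<in> {v, w}"
    then have "{x} \<in> K" "{x} \<subset> c" using vw V(2) by auto
    then show "x \<in> cell_frontier K c" by (auto simp: cell_frontier_def)
  qed
  obtain n f where f: "homeomorphic_map (ball_topology n) (subtopology X c) f" "f ` ball_boundary n = cell_frontier K c"
    "inj_on f (topspace (ball_topology n))" by (rule cell_ball[OF R c])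
  have "card (ball_boundary n) = 2"
    using card_image[OF inj_on_subset[OF f(3) ball_boundary_subset]] f(2) fr V(2) by simp
  have "n = 1"
  proof (rule ccontr)
    assume "n \<noteq> 1"
    then consider "n = 0" | "2 \<le> n" by linarith
    then show False using \<open>card (ball_boundary n) = 2\<close> infinite_ball_boundary[of n] ball_boundary_0 by cases auto
  qed
  then show "subtopology X c homeomorphic_space ball_topology 1"
    using homeomorphic_map_imp_homeomorphic_space[OF f(1)] by (subst homeomorphic_space_sym) simp
qed

lemma cell_ball_dim:
  assumes R: "regular_CW X K" "c \<in> K" and h: "subtopology X c homeomorphic_space ball_topology d" "d \<le> 6"
  obtains f where "f ` ball_boundary d = cell_frontier K c" "inj_on f (ball_boundary d)" "f ` topspace (ball_topology d) = c"
    "inj_on f (topspace (ball_topology d))"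
proof -
  obtain n f where f: "homeomorphic_map (ball_topology n) (subtopology X c) f" "f ` ball_boundary n = cell_frontier K c"
    "f ` topspace (ball_topology n) = c" "inj_on f (topspace (ball_topology n))" by (rule cell_ball[OF R])
  have "n = d"
    by (rule ball_homeomorphic_imp_eq[OF homeomorphic_space_trans[OF homeomorphic_map_imp_homeomorphic_space[OF f(1)] h(1)] h(2)])
  then show thesis using that[of f] f inj_on_subset[OF f(4) ball_boundary_subset] by simp
qed

lemma n_cells_unique:
  assumes "c \<in> n_cells d X K" "c \<in> n_cells d' X K" "d \<le> 6" shows "d' = d"
proof -
  have "subtopology X c homeomorphic_space ball_topology d" "subtopology X c homeomorphic_space ball_topology d'"
    using assms by (auto simp: n_cells_def)
  then have "ball_topology d' homeomorphic_space ball_topology d"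
    using homeomorphic_space_trans homeomorphic_space_sym by metis
  then show ?thesis by (rule ball_homeomorphic_imp_eq[OF _ assms(3)])
qed

section \<open>Complexes over a geometric simplicial complex\<close>

locale target_complex =
  fixes Fs :: "int set set"
  assumes card_facet: "F \<in> Fs \<Longrightarrow> card F = 4"
begin

definition simplices :: "int set set" where
  "simplices = {A. A \<noteq> {} \<and> (\<exists>F\<in>Fs. A \<subseteq> F)}"

definition target_space :: "(real^7) topology" where
  "target_space = top_of_set (\<Union>(simplex_on ` Fs))"

text \<open>The intermediate complexes of a local construction map to the final one by resolutions.\<close>

definition resolution :: "'a topology \<Rightarrow> 'a set set \<Rightarrow> ('a \<Rightarrow> real^7) \<Rightarrow> bool" where
  "resolution X K p \<longleftrightarrow> continuous_map X target_space p \<and> (\<forall>c\<in>K. inj_on p c) \<and>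
     (\<forall>c\<in>K. \<exists>A\<in>simplices. p ` c = simplex_on A) \<and>
     (\<forall>c\<in>K. \<forall>A\<in>simplices. simplex_on A \<subseteq> p ` c \<longrightarrow> (\<exists>b\<in>K. b \<subseteq> c \<and> p ` b = simplex_on A))"

text \<open>The vertices can be read off from the image because a moment point lies in a simplex of
  the target only as one of its vertices.\<close>

definition label :: "('a \<Rightarrow> real^7) \<Rightarrow> 'a set \<Rightarrow> int set" where
  "label p c = {i. moment i \<in> p ` c}"

lemma simplicesD:
  assumes "A \<in> simplices" shows "finite A" "card A \<le> 4" "A \<noteq> {}"
proof -
  obtain F where F: "F \<in> Fs" "A \<subseteq> F" using assms by (auto simp: simplices_def)
  then have "finite F" using card_facet[OF F(1)] by (auto intro: card_ge_0_finite)
  then show "finite A" "card A \<le> 4" using F card_mono[of F A] card_facet[OF F(1)] by (auto intro: finite_subset)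
  show "A \<noteq> {}" using assms by (simp add: simplices_def)
qed

lemma simplices_mono:
  assumes "A \<in> simplices" "B \<subseteq> A" "B \<noteq> {}" shows "B \<in> simplices"
proof -
  obtain F where "F \<in> Fs" "A \<subseteq> F" using assms(1) by (auto simp: simplices_def)
  then show ?thesis using assms(2,3) subset_trans[of B A F] by (auto simp: simplices_def)
qed

lemma simplices_card4: "A \<in> simplices \<Longrightarrow> card A = 4 \<Longrightarrow> A \<in> Fs"
proof -
  assume A: "A \<in> simplices" "card A = 4"
  then obtain F where F: "F \<in> Fs" "A \<subseteq> F" by (auto simp: simplices_def)
  then have "A = F" using A card_facet[OF F(1)] by (intro card_subset_eq) (auto intro: card_ge_0_finite)
  then show "A \<in> Fs" using F by simp
qed

lemma facet_simplex: "F \<in> Fs \<Longrightarrow> F \<in> simplices"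
  unfolding simplices_def using card_facet[of F] by (auto intro!: bexI[of _ F])

lemma simplex_subset_iff: "A \<in> simplices \<Longrightarrow> B \<in> simplices \<Longrightarrow> simplex_on A \<subseteq> simplex_on B \<longleftrightarrow> A \<subseteq> B"
  by (intro simplex_on_subset_iff simplicesD)

lemma moment_in_simplex_on: 
  assumes "A \<in> simplices" shows "moment i \<in> simplex_on A \<longleftrightarrow> i \<in> A"
proof -
  have "moment i \<in> simplex_on A \<longleftrightarrow> simplex_on {i} \<subseteq> simplex_on A" by (simp add: simplex_on_def)
  also have "\<dots> \<longleftrightarrow> {i} \<subseteq> A" using simplicesD[OF assms] by (intro simplex_on_subset_iff) auto
  finally show ?thesis by simp
qed

lemma label_eq: "A \<in> simplices \<Longrightarrow> p ` c = simplex_on A \<Longrightarrow> label p c = A"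
  using moment_in_simplex_on by (auto simp: label_def)

lemma resolution_cell:
  assumes "resolution X K p" "c \<in> K"
  shows "inj_on p c" "label p c \<in> simplices" "p ` c = simplex_on (label p c)"
proof -
  have 1: "\<forall>c\<in>K. inj_on p c" and 2: "\<forall>c\<in>K. \<exists>A\<in>simplices. p ` c = simplex_on A"
    using assms(1) unfolding resolution_def by - ((elim conjE)?, assumption)+
  show "inj_on p c" using 1 assms(2) by (rule bspec)
  obtain A where "A \<in> simplices" "p ` c = simplex_on A" using bspec[OF 2 assms(2)] by (elim bexE)
  then show "label p c \<in> simplices" "p ` c = simplex_on (label p c)" using label_eq[of A p c] by simp_all
qed

lemma resolution_face:
  assumes "resolution X K p" "c \<in> K" "A \<noteq> {}" "A \<subseteq> label p c"
  shows "\<exists>b\<in>K. b \<subseteq> c \<and> label p b = A"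
proof -
  have 1: "\<forall>c\<in>K. \<forall>A\<in>simplices. simplex_on A \<subseteq> p ` c \<longrightarrow> (\<exists>b\<in>K. b \<subseteq> c \<and> p ` b = simplex_on A)"
    using assms(1) unfolding resolution_def by (elim conjE)
  have A: "A \<in> simplices" using simplices_mono[OF resolution_cell(2)[OF assms(1,2)] assms(4,3)] .
  have "simplex_on A \<subseteq> p ` c"
    using resolution_cell[OF assms(1,2)] simplex_subset_iff[OF A] assms(4) by simp
  from 1[rule_format, OF assms(2) A this] obtain b where "b \<in> K" "b \<subseteq> c" "p ` b = simplex_on A" by (elim bexE conjE)
  then show ?thesis using label_eq[OF A] by blast
qed

lemma resolution_continuous: "resolution X K p \<Longrightarrow> continuous_map X target_space p"
  by (simp add: resolution_def)

lemma label_subset_iff: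
  assumes "resolution X K p" "D \<in> K" "a \<in> K" "b \<in> K" "a \<subseteq> D" "b \<subseteq> D"
  shows "a \<subseteq> b \<longleftrightarrow> label p a \<subseteq> label p b"
proof -
  have "a \<subseteq> b \<longleftrightarrow> p ` a \<subseteq> p ` b"
    using inj_on_image_subset_iff[OF resolution_cell(1)[OF assms(1,2)] assms(5,6)] by simp
  also have "\<dots> \<longleftrightarrow> label p a \<subseteq> label p b"
    using resolution_cell[OF assms(1,3)] resolution_cell[OF assms(1,4)] simplex_subset_iff by simp
  finally show ?thesis .
qed

lemma simplex_subset_target: "A \<in> simplices \<Longrightarrow> simplex_on A \<subseteq> \<Union>(simplex_on ` Fs)"
proof -
  assume "A \<in> simplices"
  then obtain F where F: "F \<in> Fs" "A \<subseteq> F" by (auto simp: simplices_def)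
  then have "simplex_on A \<subseteq> simplex_on F" unfolding simplex_on_def by (intro hull_mono image_mono)
  then show ?thesis using F by blast
qed

text \<open>On a compact cell the continuous injection \<open>p\<close> is a homeomorphism onto a
  geometric simplex.\<close>

lemma resolution_cell_homeomorphic:
  assumes p: "resolution X K p" and R: "regular_CW X K" and c: "c \<in> K" and d: "card (label p c) = Suc d"
  shows "subtopology X c homeomorphic_space ball_topology d" "d \<le> 3"
proof -
  note A = resolution_cell[OF p c]
  show d3: "d \<le> 3" using simplicesD(2)[OF A(2)] d by simp
  have sub: "subtopology target_space (simplex_on (label p c)) = top_of_set (simplex_on (label p c))"
    unfolding target_space_def subtopology_subtopology using simplex_subset_target[OF A(2)]
    by (simp add: Int_absorb1)
  have "continuous_map (subtopology X c) (top_of_set (simplex_on (label p c))) p"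
    unfolding sub[symmetric] continuous_map_in_subtopology
    using continuous_map_from_subtopology[OF resolution_continuous[OF p]] A cell_topspace[OF R c] by auto
  then have "homeomorphic_map (subtopology X c) (top_of_set (simplex_on (label p c))) p"
    by (rule continuous_imp_homeomorphic_map[OF _ cell_compact[OF R c]])
      (use A cell_topspace[OF R c] in \<open>simp_all add: Hausdorff_space_subtopology\<close>)
  from homeomorphic_map_imp_homeomorphic_space[OF this]
  have "subtopology X c homeomorphic_space top_of_set (simplex_on (label p c))" .
  moreover have "top_of_set (simplex_on (label p c)) homeomorphic_space ball_topology d"
    using d3 by (subst homeomorphic_space_sym) (intro simplex_on_homeomorphic_ball d, simp)
  ultimately show "subtopology X c homeomorphic_space ball_topology d" by (rule homeomorphic_space_trans)
qed

text \<open>Replaces the topological dimension of a cell by the number of its labels, so that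
  \<open>n_cells\<close> becomes a combinatorial notion. The inclusion from left to right uses
  invariance of dimension.\<close>

lemma resolution_n_cells:
  assumes p: "resolution X K p" and R: "regular_CW X K" and d: "d \<le> 6"
  shows "n_cells d X K = {c \<in> K. card (label p c) = Suc d}"
proof (intro subset_antisym subsetI)
  fix c assume c: "c \<in> n_cells d X K"
  then have cK: "c \<in> K" by (simp add: n_cells_def)
  have "card (label p c) \<noteq> 0" using simplicesD[OF resolution_cell(2)[OF p cK]] by simp
  then obtain m where m: "card (label p c) = Suc m" using not0_implies_Suc by blast
  have "c \<in> n_cells m X K" using resolution_cell_homeomorphic(1)[OF p R cK m] cK by (simp add: n_cells_def)
  then have "m = d" using n_cells_unique[OF c] d resolution_cell_homeomorphic(2)[OF p R cK m] by simp
  then show "c \<in> {c \<in> K. card (label p c) = Suc d}" using cK m by simp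
next
  fix c assume "c \<in> {c \<in> K. card (label p c) = Suc d}"
  then show "c \<in> n_cells d X K" using resolution_cell_homeomorphic(1)[OF p R, of c d] by (simp add: n_cells_def)
qed

lemma pseudomanifoldD:
  assumes "pseudomanifold d X K"
  shows "simplicial_CW X K" "regular_CW X K" "c \<in> K \<Longrightarrow> \<exists>D\<in>n_cells d X K. c \<subseteq> D"
  using assms by (auto simp: pseudomanifold_def pure_CW_def simplicial_CW_def)

lemma resolution_labelling:
  assumes p: "resolution X K p" and X: "pseudomanifold 3 X K"
  shows "labelling Fs K (label p)"
  unfolding labelling_def
proof (intro conjI ballI allI impI)
  note R = pseudomanifoldD(2)[OF X]
  fix c assume c: "c \<in> K"
  show "label p c \<noteq> {}" by (rule simplicesD(3)[OF resolution_cell(2)[OF p c]])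
  obtain D where D: "D \<in> n_cells 3 X K" "c \<subseteq> D" using pseudomanifoldD(3)[OF X c] by blast
  then have "D \<in> K" "card (label p D) = 4" using resolution_n_cells[OF p R, of 3] by auto
  then show "\<exists>D\<in>K. c \<subseteq> D \<and> label p D \<in> Fs" using D simplices_card4[OF resolution_cell(2)[OF p]] by blast
next
  fix c A assume "c \<in> K" "A \<noteq> {}" "A \<subseteq> label p c"
  then show "\<exists>c'\<in>K. c' \<subseteq> c \<and> label p c' = A" by (rule resolution_face[OF p])
next
  fix D c c' assume "D \<in> K" "c \<in> K" "c' \<in> K" "c \<subseteq> D" "c' \<subseteq> D"
  then show "c \<subseteq> c' \<longleftrightarrow> label p c \<subseteq> label p c'" by (rule label_subset_iff[OF p])
qed

lemma facets_of_n_cells: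
  assumes p: "resolution X K p" and R: "regular_CW X K"
  shows "facets_of Fs K (label p) = n_cells 3 X K"
proof -
  have "label p c \<in> Fs \<longleftrightarrow> card (label p c) = 4" if "c \<in> K" for c
    using simplices_card4[OF resolution_cell(2)[OF p that]] card_facet by blast
  then show ?thesis using resolution_n_cells[OF p R, of 3] by (auto simp: facets_of_def)
qed

text \<open>The boundary is given as an intersection of subcomplexes. The faces of triangles with
  exactly one facet form one of these, so \<open>s\<close> lies in such a triangle, and having three
  labels itself it equals that triangle.\<close>

lemma boundary_triangle_facet:
  assumes p: "resolution X K p" and X: "pseudomanifold 3 X K"
    and s: "s \<in> n_cells 2 X K \<inter> pm_boundary 3 X K"
  shows "\<exists>!D. D \<in> facets_of Fs K (label p) \<and> s \<subseteq> D"
proof -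
  note R = pseudomanifoldD(2)[OF X]
  let ?B = "{t \<in> n_cells 2 X K. card {D \<in> n_cells 3 X K. t \<subseteq> D} = 1}"
  let ?L = "{c \<in> K. \<exists>t\<in>?B. c \<subseteq> t}"
  have "subcomplex ?L K" by (auto simp: subcomplex_def)
  moreover have "?B \<subseteq> ?L" by (auto simp: n_cells_def)
  ultimately have "pm_boundary 3 X K \<subseteq> ?L" unfolding pm_boundary_def by (intro Inter_lower) simp
  then obtain t where t: "t \<in> ?B" "s \<subseteq> t" using s by blast
  then have st: "s \<in> K" "t \<in> K" "card (label p s) = 3" "card (label p t) = 3"
    using s resolution_n_cells[OF p R, of 2] by auto
  have "s = t" by (rule labelling_card_eq[OF resolution_labelling[OF p X] st(1,2) t(2)]) (use st in simp_all)
  then have "card {D \<in> n_cells 3 X K. s \<subseteq> D} = 1" using t by simp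
  then obtain D where "{D \<in> n_cells 3 X K. s \<subseteq> D} = {D}" by (auto simp: card_1_singleton_iff)
  then have "D' \<in> n_cells 3 X K \<and> s \<subseteq> D' \<longleftrightarrow> D' = D" for D' by auto
  then show ?thesis unfolding facets_of_n_cells[OF p R] by simp
qed

text \<open>This bounds the number of vertices of a cell of the quotient by 4, from which the same
  bound for the cells before an identification is derived later.\<close>

lemma vert_label:
  assumes p: "resolution X K p" and R: "regular_CW X K" and c: "c \<in> K"
  shows "card (vert K c) = card (label p c)"
proof -
  have "p ` vert K c = moment ` label p c"
  proof (intro subset_antisym subsetI)
    fix y assume "y \<in> p ` vert K c"
    then obtain v where v: "v \<in> c" "{v} \<in> K" "y = p v" by (auto simp: vert_def)
    have "simplex_on (label p {v}) = {y}" using resolution_cell(3)[OF p v(2)] v(3) by simp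
    moreover obtain i where i: "i \<in> label p {v}" using simplicesD(3)[OF resolution_cell(2)[OF p v(2)]] by auto
    ultimately have "y = moment i"
      using moment_in_simplex_on[OF resolution_cell(2)[OF p v(2)], of i] by simp
    have "p v \<in> p ` c" using v(1) by (rule imageI)
    then have "i \<in> label p c" unfolding label_def using \<open>y = moment i\<close> v(3) by simp
    then show "y \<in> moment ` label p c" using \<open>y = moment i\<close> by blast
  next
    fix y assume "y \<in> moment ` label p c"
    then obtain i where i: "i \<in> label p c" "y = moment i" by auto
    obtain b where b: "b \<in> K" "b \<subseteq> c" "label p b = {i}" using resolution_face[OF p c, of "{i}"] i by auto
    have "p ` b = {y}" using resolution_cell(3)[OF p b(1)] b(3) i by (simp add: simplex_on_def)
    moreover obtain v where v: "v \<in> b" using cell_nonempty[OF R b(1)] by auto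
    ultimately have "b = {v}" "p v = y" using resolution_cell(1)[OF p b(1)] by (auto dest: inj_onD)
    then show "y \<in> p ` vert K c" using b v by (auto simp: vert_def)
  qed
  moreover have "inj_on p (vert K c)" using resolution_cell(1)[OF p c] by (rule inj_on_subset) (auto simp: vert_def)
  ultimately show ?thesis
    using card_image[of p "vert K c"] card_image[OF inj_on_subset[OF inj_moment], of "label p c"] by simp
qed

end

section \<open>Pulling back along identification steps\<close>

lemma card_le_image_inj: "finite B \<Longrightarrow> inj_on f A \<Longrightarrow> f ` A \<subseteq> B \<Longrightarrow> card A \<le> card B"
  using card_image[of f A] card_mono[of B "f ` A"] by simp

text \<open>The composite \<open>p' \<circ> q\<close> is to be shown a resolution, and what is at
  stake is injectivity of \<open>q\<close> on cells. No resolution of \<open>K\<close> is known yet: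
  \<open>s\<close> and \<open>t\<close> are just cells of dimension 2, and \<open>\<phi>\<close>
  maps cells to cells with no condition on its inverse.\<close>

locale identification = target_complex +
  fixes X :: "'a topology" and K :: "'a set set" and X' :: "'a topology" and K' :: "'a set set"
    and p' :: "'a \<Rightarrow> real^7" and s t F :: "'a set" and \<phi> q :: "'a \<Rightarrow> 'a"
  assumes X: "pseudomanifold 3 X K" and X': "pseudomanifold 3 X' K'" and p': "resolution X' K' p'"
    and s: "s \<in> n_cells 2 X K \<inter> pm_boundary 3 X K" and t: "t \<in> n_cells 2 X K \<inter> pm_boundary 3 X K"
    and st: "s \<noteq> t" and F: "F \<in> n_cells 1 X K" "F \<subseteq> s \<inter> t"
    and \<phi>: "homeomorphic_map (subtopology X s) (subtopology X t) \<phi>"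
    and \<phi>_cell: "\<And>c. c \<in> K \<Longrightarrow> c \<subseteq> s \<Longrightarrow> \<phi> ` c \<in> K" and \<phi>_fix: "\<And>x. x \<in> s \<inter> t \<Longrightarrow> \<phi> x = x"
    and q: "quotient_map X X' q"
    and q_eq: "\<And>x y. x \<in> topspace X \<Longrightarrow> y \<in> topspace X \<Longrightarrow>
       q x = q y \<longleftrightarrow> x = y \<or> (x \<in> s \<and> y = \<phi> x) \<or> (y \<in> s \<and> x = \<phi> y)"
    and K': "K' = (`) q ` K"
begin

lemmas S = pseudomanifoldD(1)[OF X] and S' = pseudomanifoldD(1)[OF X']
lemmas R = pseudomanifoldD(2)[OF X] and R' = pseudomanifoldD(2)[OF X']

lemma cell_st: "s \<in> K" "t \<in> K" using s t by (auto simp: n_cells_def)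

lemma cell_top: "c \<in> K \<Longrightarrow> x \<in> c \<Longrightarrow> x \<in> topspace X"
  using cell_subset[OF R] by blast

lemma qcell: "c \<in> K \<Longrightarrow> q ` c \<in> K'" by (simp add: K')

lemma q_vertex: "{v} \<in> K \<Longrightarrow> {q v} \<in> K'" using qcell[of "{v}"] by simp

lemma \<phi>_image: "\<phi> ` s = t" and \<phi>_inj: "inj_on \<phi> s"
  using homeomorphic_imp_surjective_map[OF \<phi>] homeomorphic_imp_injective_map[OF \<phi>]
  unfolding cell_topspace[OF R cell_st(1)] cell_topspace[OF R cell_st(2)] .

lemma q_\<phi>: assumes "x \<in> s" shows "q (\<phi> x) = q x"
proof -
  have "\<phi> x \<in> t" using \<phi>_image assms by blast
  then show ?thesis
    using q_eq[OF cell_top[OF cell_st(2)] cell_top[OF cell_st(1)], of "\<phi> x" x] assms by simp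
qed

lemma \<phi>_vertex: "{v} \<in> K \<Longrightarrow> v \<in> s \<Longrightarrow> {\<phi> v} \<in> K"
  using \<phi>_cell[of "{v}"] by simp

lemma vert_mapsto: "q ` vert K c \<subseteq> vert K' (q ` c)"
  using q_vertex by (auto simp: vert_def)

text \<open>The second alternative is excluded by \<open>vert_t\<close>, whose proof needs the injectivity of \<open>q\<close> on the
  vertices of a cell first.\<close>

lemma new_vertex:
  assumes c: "c \<in> K" and y: "y \<in> vert K' (q ` c)"
  obtains x where "x \<in> c" "y = q x" "{x} \<in> K \<or> (x \<in> s \<and> {\<phi> x} \<in> K)"
proof -
  have y1: "y \<in> q ` c" "{y} \<in> (`) q ` K" using y unfolding vert_def K' by blast+
  obtain x0 where x0: "x0 \<in> c" "y = q x0" using y1(1) by blast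
  obtain c1 where c1: "c1 \<in> K" "{y} = q ` c1" using y1(2) by blast
  obtain x1 where "x1 \<in> vert K c1" using vert_nonempty[OF S c1(1)] by blast
  then have x1: "x1 \<in> c1" "{x1} \<in> K" by (auto simp: vert_def)
  have "q x1 \<in> {y}" unfolding c1(2) using x1(1) by (rule imageI)
  then have "q x0 = q x1" using x0(2) by simp
  then consider "x0 = x1" | "x0 \<in> s" "x1 = \<phi> x0" | "x1 \<in> s" "x0 = \<phi> x1"
    using q_eq[OF cell_top[OF c x0(1)] cell_top[OF c1(1) x1(1)]] by blast
  then show thesis
  proof cases
    case 1 then show thesis using that[OF x0] x1 by simp
  next
    case 2 then show thesis using that[OF x0] x1 by simp
  next
    case 3 then show thesis using that[OF x0] \<phi>_vertex[OF x1(2)] by simp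
  qed
qed

lemma infinite_edge:
  assumes "subtopology X c homeomorphic_space ball_topology 1" "c \<in> K" shows "infinite c"
proof -
  obtain f where f: "f ` topspace (ball_topology 1) = c" "inj_on f (topspace (ball_topology 1))"
    by (rule cell_ball_dim[OF R assms(2,1)]) simp_all
  show ?thesis using infinite_ball[of 1] finite_imageD[OF _ f(2)] f(1) by auto
qed

text \<open>If two vertices of a cell were identified, the image of the edge between them would be a
  simplicial cell with a single vertex, hence a point. But \<open>q\<close> is finite-to-one and an
  edge is infinite.\<close>

lemma q_inj_vert: assumes c: "c \<in> K" shows "inj_on q (vert K c)"
proof (rule inj_onI, rule ccontr)
  fix v w assume vw: "v \<in> vert K c" "w \<in> vert K c" "q v = q w" "v \<noteq> w"
  then obtain e where e: "e \<in> K" "vert K e = {v, w}" using vert_face[OF S c, of "{v, w}"] by auto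
  have fr: "cell_frontier K e = {v, w}" and hom: "subtopology X e homeomorphic_space ball_topology 1"
    using edge_frontier[OF S e(1) e(2) vw(4)] by simp_all
  have ve: "v \<in> e" "w \<in> e" "{v} \<in> K" "{w} \<in> K" using e(2) by (auto simp: vert_def)
  \<comment> \<open>No inner point \<open>x\<close> of the edge can become a vertex through
    \<open>\<phi>\<close>: then \<open>e\<close> would lie in \<open>s\<close>, and its image under
    \<open>\<phi>\<close> would be an arc with the three frontier points \<open>\<phi> v\<close>,
    \<open>\<phi> w\<close> and \<open>\<phi> x\<close>.\<close>
  have vert_e: "x \<in> {v, w}" if x: "x \<in> e" "{x} \<in> K \<or> (x \<in> s \<and> {\<phi> x} \<in> K)" for x
  proof (rule ccontr)
    assume nx: "x \<notin> {v, w}"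
    then have xs: "x \<in> s" "{\<phi> x} \<in> K" using x e(2) by (auto simp: vert_def)
    have es: "e \<subseteq> s" by (rule interior_point_subset[OF R e(1) x(1) _ cell_st(1) xs(1)]) (use nx fr in simp)
    have \<phi>e: "\<phi> ` e \<in> K" by (rule \<phi>_cell[OF e(1) es])
    have inj: "inj_on \<phi> e" using \<phi>_inj es by (rule inj_on_subset)
    have et: "\<phi> ` e \<subseteq> t" using es \<phi>_image by blast
    have "homeomorphic_map (subtopology (subtopology X s) e) (subtopology (subtopology X t) (\<phi> ` e)) \<phi>"
      by (rule homeomorphic_map_subtopologies[OF \<phi>])
        (use es et cell_topspace[OF R cell_st(1)] cell_topspace[OF R cell_st(2)] in \<open>simp add: Int_absorb1\<close>)
    then have "subtopology X e homeomorphic_space subtopology X (\<phi> ` e)"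
      using es et by (intro homeomorphic_map_imp_homeomorphic_space[of _ _ \<phi>]) (simp add: subtopology_subtopology Int_absorb1)
    then have "subtopology X (\<phi> ` e) homeomorphic_space ball_topology 1"
      using hom homeomorphic_space_sym homeomorphic_space_trans by metis
    then obtain f where f: "f ` ball_boundary 1 = cell_frontier K (\<phi> ` e)"
      using cell_ball_dim[OF R \<phi>e] by (metis one_le_numeral)
    have fin: "finite (ball_boundary 1)" using card_ball_boundary_1 card_ge_0_finite by force
    then have fr\<phi>: "finite (cell_frontier K (\<phi> ` e))" "card (cell_frontier K (\<phi> ` e)) \<le> 2"
      using card_image_le[OF fin, of f] card_ball_boundary_1 unfolding f[symmetric] by auto
    have fr_in: "\<phi> z \<in> cell_frontier K (\<phi> ` e)" if z: "z \<in> e" "{\<phi> z} \<in> K" for z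
    proof -
      have "\<phi> ` e \<noteq> {\<phi> z}"
      proof
        assume eq: "\<phi> ` e = {\<phi> z}"
        have "\<phi> v \<in> {\<phi> z}" "\<phi> w \<in> {\<phi> z}"
          using imageI[OF ve(1), of \<phi>] imageI[OF ve(2), of \<phi>] unfolding eq .
        then have "\<phi> v = \<phi> w" by simp
        then show False using inj_onD[OF inj _ ve(1,2)] vw(4) by simp
      qed
      then have "{\<phi> z} \<subset> \<phi> ` e" using imageI[OF z(1), of \<phi>] by blast
      then show ?thesis using z(2) by (auto simp: cell_frontier_def)
    qed
    have "\<phi> v \<in> cell_frontier K (\<phi> ` e)" "\<phi> w \<in> cell_frontier K (\<phi> ` e)"
      using fr_in[OF ve(1) \<phi>_vertex[OF ve(3)]] fr_in[OF ve(2) \<phi>_vertex[OF ve(4)]] ve(1,2) es by blast+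
    then have "{\<phi> v, \<phi> w, \<phi> x} \<subseteq> cell_frontier K (\<phi> ` e)" using fr_in[OF x(1) xs(2)] by simp
    from order_trans[OF card_mono[OF fr\<phi>(1) this] fr\<phi>(2)] have "card {\<phi> v, \<phi> w, \<phi> x} \<le> 2" .
    moreover have "card {\<phi> v, \<phi> w, \<phi> x} = card {v, w, x}"
      using card_image[OF inj_on_subset[OF inj], of "{v, w, x}"] ve(1,2) x(1) by simp
    moreover have "card {v, w, x} = 3" using nx vw(4) by (auto simp: card_insert_if)
    ultimately show False by simp
  qed
  have "vert K' (q ` e) \<subseteq> {q v}"
  proof
    fix y assume "y \<in> vert K' (q ` e)"
    then obtain x where x: "x \<in> e" "y = q x" "{x} \<in> K \<or> (x \<in> s \<and> {\<phi> x} \<in> K)" by (rule new_vertex[OF e(1)])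
    then show "y \<in> {q v}" using vert_e[OF x(1,3)] vw(3) by auto
  qed
  moreover have "vert K' {q v} = {q v}" by (rule vert_singleton[OF q_vertex[OF ve(3)]])
  ultimately have "q ` e \<subseteq> {q v}"
    using vert_subset_iff[OF S' qcell[OF e(1)] qcell[OF e(1)] q_vertex[OF ve(3)]] ve(1) by simp
  then have "x \<in> {v, \<phi> v} \<union> {x \<in> s. \<phi> x = v}" if "x \<in> e" for x
    using q_eq[OF cell_top[OF e(1) that] cell_top[OF e(1) ve(1)]] that by auto
  then have "e \<subseteq> {v, \<phi> v} \<union> {x \<in> s. \<phi> x = v}" by blast
  moreover have "finite {x \<in> s. \<phi> x = v}"
  proof -
    have "{x \<in> s. \<phi> x = v} = \<phi> -` {v} \<inter> s" by auto
    then show ?thesis using finite_vimage_IntI[OF _ \<phi>_inj, of "{v}"] by simp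
  qed
  ultimately have "finite e" using finite_subset by blast
  then show False using infinite_edge[OF hom e(1)] by simp
qed

lemma card_vert_le4: assumes "c \<in> K" shows "card (vert K c) \<le> 4"
proof -
  have "card (vert K c) \<le> card (vert K' (q ` c))"
    by (rule card_le_image_inj[OF finite_vert[OF S' qcell[OF assms]] q_inj_vert[OF assms] vert_mapsto])
  also have "\<dots> \<le> 4"
    unfolding vert_label[OF p' R' qcell[OF assms]] by (rule simplicesD(2)[OF resolution_cell(2)[OF p' qcell[OF assms]]])
  finally show ?thesis .
qed

text \<open>With at most two vertices, every proper face of \<open>s\<close> would be a vertex and
  the frontier finite, whereas the frontier of a 2-cell is a circle.\<close>

lemma card_vert_s: "3 \<le> card (vert K s)"
proof (rule ccontr)
  assume "\<not> 3 \<le> card (vert K s)"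
  then have le2: "card (vert K s) \<le> 2" by simp
  have fin: "finite (vert K s)" by (rule finite_vert[OF S cell_st(1)])
  have "subtopology X s homeomorphic_space ball_topology 2" using s by (simp add: n_cells_def)
  then obtain f where f: "f ` ball_boundary 2 = cell_frontier K s" "inj_on f (ball_boundary 2)"
    by (rule cell_ball_dim[OF R cell_st(1)]) simp_all
  have "cell_frontier K s \<subseteq> vert K s"
  proof
    fix x assume "x \<in> cell_frontier K s"
    then obtain b where b: "b \<in> K" "b \<subset> s" "x \<in> b" by (auto simp: cell_frontier_def)
    have "vert K b \<subset> vert K s"
      using vert_mono[OF psubset_imp_subset[OF b(2)], of K] vert_inj[OF S cell_st(1) b(1) cell_st(1)] b(2) by auto
    from order_less_le_trans[OF psubset_card_mono[OF fin this] le2] have "card (vert K b) < 2" .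
    moreover have "card (vert K b) \<noteq> 0" using vert_nonempty[OF S b(1)] finite_vert[OF S b(1)] by simp
    ultimately have "card (vert K b) = 1" by linarith
    then obtain u where u: "vert K b = {u}" by (auto simp: card_1_singleton_iff)
    then have "{u} \<in> K" "u \<in> b" by (auto simp: vert_def)
    then have "b = {u}" using vert_inj[OF S b(1) b(1), of "{u}"] u vert_singleton[of u K] by simp
    then show "x \<in> vert K s" using b \<open>{u} \<in> K\<close> by (auto simp: vert_def)
  qed
  then have "finite (f ` ball_boundary 2)" unfolding f(1) using fin by (rule finite_subset)
  then have "finite (ball_boundary 2)" using f(2) by (rule finite_imageD)
  then show False using infinite_ball_boundary[of 2] by simp
qed

text \<open>With four vertices, \<open>t\<close> would have all the vertices of a facet containing
  it and so coincide with that facet, which has dimension 3.\<close>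

lemma card_vert_t: "card (vert K t) \<le> 3"
proof (rule ccontr)
  assume "\<not> card (vert K t) \<le> 3"
  then have 4: "card (vert K t) = 4" using card_vert_le4[OF cell_st(2)] by simp
  obtain D where D: "D \<in> n_cells 3 X K" "t \<subseteq> D" using pseudomanifoldD(3)[OF X cell_st(2)] by blast
  then have DK: "D \<in> K" by (simp add: n_cells_def)
  have "vert K t = vert K D"
    by (rule card_seteq[OF finite_vert[OF S DK] vert_mono[OF D(2)]]) (use 4 card_vert_le4[OF DK] in simp)
  then have "t = D" by (intro vert_inj[OF S DK cell_st(2) DK D(2)]) simp_all
  then have "t \<in> n_cells 2 X K" "t \<in> n_cells 3 X K" using t D by simp_all
  from n_cells_unique[OF this] show False by simp
qed

text \<open>\<open>\<phi>\<close> maps vertices to vertices injectively. That no vertex of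
  \<open>t\<close> is missed follows by counting: at least three in \<open>s\<close>, at most three
  in \<open>t\<close>.\<close>

lemma vert_t: "vert K t = \<phi> ` vert K s"
proof -
  have sub: "\<phi> ` vert K s \<subseteq> vert K t"
    using \<phi>_vertex \<phi>_image by (auto simp: vert_def)
  have "card (\<phi> ` vert K s) = card (vert K s)"
    by (rule card_image[OF inj_on_subset[OF \<phi>_inj]]) (auto simp: vert_def)
  then have "card (vert K t) \<le> card (\<phi> ` vert K s)" using card_vert_s card_vert_t by linarith
  from card_seteq[OF finite_vert[OF S cell_st(2)] sub this] show ?thesis ..
qed

lemma vert_q: assumes c: "c \<in> K" shows "vert K' (q ` c) = q ` vert K c"
proof (intro subset_antisym vert_mapsto subsetI)
  fix y assume "y \<in> vert K' (q ` c)"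
  then obtain x where x: "x \<in> c" "y = q x" "{x} \<in> K \<or> (x \<in> s \<and> {\<phi> x} \<in> K)" by (rule new_vertex[OF c])
  have "{x} \<in> K"
  proof (rule disjE[OF x(3)])
    assume xs: "x \<in> s \<and> {\<phi> x} \<in> K"
    then have "\<phi> x \<in> vert K t" using \<phi>_image by (auto simp: vert_def)
    then obtain v where v: "v \<in> s" "{v} \<in> K" "\<phi> x = \<phi> v" unfolding vert_t by (auto simp: vert_def)
    then have "x = v" using \<phi>_inj xs by (auto dest: inj_onD)
    then show "{x} \<in> K" using v by simp
  qed
  then show "y \<in> q ` vert K c" using x by (auto simp: vert_def)
qed

text \<open>Suppose \<open>x \<in> s\<close> and \<open>\<phi> x\<close> both lie in
  \<open>c\<close>. Comparing the vertices of their carriers after applying \<open>q\<close> puts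
  the carrier of \<open>\<phi> x\<close> inside that of \<open>x\<close>, hence inside
  \<open>s\<close>. So \<open>\<phi> x\<close> lies in \<open>s \<inter> t\<close>, where
  \<open>\<phi>\<close> is the identity, and injectivity of \<open>\<phi>\<close> gives
  \<open>x = \<phi> x\<close>.\<close>

lemma q_inj_cell: assumes c: "c \<in> K" shows "inj_on q c"
proof -
  have *: "x = y" if x: "x \<in> c" "x \<in> s" and y: "y \<in> c" "y = \<phi> x" for x y
  proof -
    obtain c0 where c0: "c0 \<in> K" "c0 \<subseteq> c" "x \<in> c0" "x \<notin> cell_frontier K c0" by (rule cell_carrier[OF R c x(1)])
    have c0s: "c0 \<subseteq> s" by (rule interior_point_subset[OF R c0(1,3,4) cell_st(1) x(2)])
    have c1: "\<phi> ` c0 \<in> K" by (rule \<phi>_cell[OF c0(1) c0s])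
    obtain c2 where c2: "c2 \<in> K" "c2 \<subseteq> c" "y \<in> c2" "y \<notin> cell_frontier K c2" by (rule cell_carrier[OF R c y(1)])
    have "c2 \<subseteq> \<phi> ` c0" by (rule interior_point_subset[OF R c2(1,3,4) c1]) (use y c0 in simp)
    then have "q ` c2 \<subseteq> q ` \<phi> ` c0" by (rule image_mono)
    also have "q ` \<phi> ` c0 = q ` c0" using q_\<phi> c0s by (auto simp: image_image intro!: image_cong)
    finally have "q ` vert K c2 \<subseteq> q ` vert K c0"
      unfolding vert_q[OF c2(1), symmetric] vert_q[OF c0(1), symmetric] by (rule vert_mono)
    then have "vert K c2 \<subseteq> vert K c0"
      using inj_on_image_subset_iff[OF q_inj_vert[OF c] vert_mono[OF c2(2)] vert_mono[OF c0(2)]] by simp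
    then have "c2 \<subseteq> c0" using vert_subset_iff[OF S c c2(1) c0(1) c2(2) c0(2)] by simp
    then have "y \<in> s" using c2 c0s by blast
    moreover have "y \<in> t" using x y \<phi>_image by blast
    ultimately have "\<phi> y = \<phi> x" using \<phi>_fix[of y] y by simp
    then show "x = y" using \<phi>_inj x(2) \<open>y \<in> s\<close> by (auto dest: inj_onD)
  qed
  show ?thesis
  proof (rule inj_onI)
    fix x y assume xy: "x \<in> c" "y \<in> c" "q x = q y"
    then consider "x = y" | "x \<in> s" "y = \<phi> x" | "y \<in> s" "x = \<phi> y"
      using q_eq[OF cell_top[OF c xy(1)] cell_top[OF c xy(2)]] by blast
    then show "x = y"
    proof cases
      case 2 show ?thesis by (rule *[OF xy(1) 2(1) xy(2) 2(2)])
    next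
      case 3 show ?thesis by (rule *[OF xy(2) 3(1) xy(1) 3(2), symmetric])
    qed
  qed
qed

lemma resolution_q: "resolution X K (p' \<circ> q)"
  unfolding resolution_def
proof (intro conjI ballI impI)
  have im: "(p' \<circ> q) ` b = p' ` q ` b" for b by (rule image_comp[symmetric])
  show "continuous_map X target_space (p' \<circ> q)"
    by (rule continuous_map_compose[OF quotient_imp_continuous_map[OF q] resolution_continuous[OF p']])
  fix c assume c: "c \<in> K"
  show "inj_on (p' \<circ> q) c" by (rule comp_inj_on[OF q_inj_cell[OF c] resolution_cell(1)[OF p' qcell[OF c]]])
  show "\<exists>A\<in>simplices. (p' \<circ> q) ` c = simplex_on A"
    unfolding im using resolution_cell(2,3)[OF p' qcell[OF c]] by (rule bexI[rotated])
  fix A assume A: "A \<in> simplices" "simplex_on A \<subseteq> (p' \<circ> q) ` c"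
  then have "A \<subseteq> label p' (q ` c)"
    using simplex_subset_iff[OF A(1) resolution_cell(2)[OF p' qcell[OF c]]] A(2)
    unfolding im resolution_cell(3)[OF p' qcell[OF c], symmetric] by blast
  then obtain b' where b': "b' \<in> K'" "b' \<subseteq> q ` c" "label p' b' = A"
    using resolution_face[OF p' qcell[OF c] simplicesD(3)[OF A(1)]] by blast
  \<comment> \<open>The face of \<open>c\<close> over \<open>b'\<close> is spanned by the vertices
    that \<open>q\<close> sends to vertices of \<open>b'\<close>.\<close>
  let ?W = "{v \<in> vert K c. q v \<in> vert K' b'}"
  have qW: "q ` ?W = vert K' b'" using vert_mono[OF b'(2), of K'] unfolding vert_q[OF c] by blast
  then have "?W \<noteq> {}" using vert_nonempty[OF S' b'(1)] by blast
  then obtain b where b: "b \<in> K" "b \<subseteq> c" "vert K b = ?W" using vert_face[OF S c, of ?W] by auto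
  have "q ` b = b'"
    by (rule vert_inj[OF S' qcell[OF c] qcell[OF b(1)] b'(1) image_mono[OF b(2)] b'(2)]) (simp only: vert_q[OF b(1)] b(3) qW)
  then have "(p' \<circ> q) ` b = simplex_on A"
    unfolding im using resolution_cell(3)[OF p' b'(1)] b'(3) by simp
  then show "\<exists>b\<in>K. b \<subseteq> c \<and> (p' \<circ> q) ` b = simplex_on A" using b by blast
qed

lemma label_q: "label (p' \<circ> q) c = label p' (q ` c)"
  by (simp add: label_def image_comp)

lemma identified_q: "identified Fs K (label (p' \<circ> q)) K' (label p') ((`) q) s t F"
  unfolding identified_def
proof (intro conjI ballI impI)
  note p = resolution_q
  show "K' = (`) q ` K" by (rule K')
  show "label p' (q ` c) = label (p' \<circ> q) c" for c by (simp add: label_q)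
  show "q ` c \<subseteq> q ` c'" if "c \<subseteq> c'" for c c' using that by (rule image_mono)
  show "s \<in> K" "t \<in> K" by (fact cell_st)+
  show "s \<noteq> t" by (fact st)
  show "q ` s = q ` t" using q_\<phi> \<phi>_image by (auto simp: image_iff)
  show "card (label (p' \<circ> q) s) = 3" using s resolution_n_cells[OF p R, of 2] by simp
  show "\<exists>!D. D \<in> facets_of Fs K (label (p' \<circ> q)) \<and> s \<subseteq> D" by (rule boundary_triangle_facet[OF p X s])
  show "\<exists>!D. D \<in> facets_of Fs K (label (p' \<circ> q)) \<and> t \<subseteq> D" by (rule boundary_triangle_facet[OF p X t])
  show "F \<in> K" "card (label (p' \<circ> q) F) = 2" using F resolution_n_cells[OF p R, of 1] by simp_all
  show "F \<subseteq> s" "F \<subseteq> t" using F by simp_all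
  fix c c' assume c: "c \<in> K" and c': "c' \<in> K" and eq: "q ` c = q ` c'"
  \<comment> \<open>An interior point of \<open>a\<close> is identified with some point of
    \<open>b\<close>; wherever this places it, it takes all of \<open>a\<close> along.\<close>
  have half: "a \<subseteq> b \<or> a \<subseteq> s \<or> a \<subseteq> t" if a: "a \<in> K" and b: "b \<in> K" and ab: "q ` a = q ` b" for a b
  proof -
    obtain x where x: "x \<in> a" "x \<notin> cell_frontier K a" by (rule cell_interior[OF R a])
    have "q x \<in> q ` b" using x ab by blast
    then obtain y where y: "y \<in> b" "q x = q y" by blast
    then consider "x = y" | "x \<in> s" | "y \<in> s" "x = \<phi> y"
      using q_eq[OF cell_top[OF a x(1)] cell_top[OF b y(1)]] by blast
    then show ?thesis
    proof cases
      case 1 then show ?thesis using interior_point_subset[OF R a x b] y by blast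
    next
      case 2 then show ?thesis using interior_point_subset[OF R a x cell_st(1)] by blast
    next
      case 3
      then have "x \<in> t" using \<phi>_image by blast
      then show ?thesis using interior_point_subset[OF R a x cell_st(2)] by blast
    qed
  qed
  have inside: "a = b" if "a \<subseteq> d" "b \<subseteq> d" "d \<in> K" "q ` a = q ` b" for a b d
    using inj_on_image_eq_iff[OF q_inj_cell[OF that(3)] that(1,2)] that(4) by simp
  have "c \<subseteq> c' \<or> c \<subseteq> s \<or> c \<subseteq> t" "c' \<subseteq> c \<or> c' \<subseteq> s \<or> c' \<subseteq> t"
    using half[OF c c' eq] half[OF c' c eq[symmetric]] by simp_all
  moreover have "c \<subseteq> c' \<Longrightarrow> c = c'" by (rule inside[OF _ subset_refl c' eq])
  moreover have "c' \<subseteq> c \<Longrightarrow> c = c'" by (rule inside[OF subset_refl _ c eq])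
  moreover have "c \<subseteq> s \<Longrightarrow> c' \<subseteq> s \<Longrightarrow> c = c'" by (rule inside[OF _ _ cell_st(1) eq])
  moreover have "c \<subseteq> t \<Longrightarrow> c' \<subseteq> t \<Longrightarrow> c = c'" by (rule inside[OF _ _ cell_st(2) eq])
  ultimately show "c = c' \<or> c \<subseteq> s \<and> c' \<subseteq> t \<or> c \<subseteq> t \<and> c' \<subseteq> s" by argo
qed

end

lemma (in target_complex) identify_step_resolution:
  assumes step: "identify_step 3 X K X' K'" and X: "pseudomanifold 3 X K" and X': "pseudomanifold 3 X' K'"
    and p': "resolution X' K' p'"
  shows "\<exists>p q s t F. resolution X K p \<and> identified Fs K (label p) K' (label p') q s t F"
proof -
  from step obtain s t F \<phi> q where
    h: "s \<in> n_cells (3 - 1) X K \<inter> pm_boundary 3 X K" "t \<in> n_cells (3 - 1) X K \<inter> pm_boundary 3 X K" "s \<noteq> t"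
      "F \<in> n_cells (3 - 2) X K" "F \<subseteq> s \<inter> t" "homeomorphic_map (subtopology X s) (subtopology X t) \<phi>"
      "\<forall>c\<in>K. c \<subseteq> s \<longrightarrow> \<phi> ` c \<in> K" "\<forall>x \<in> s \<inter> t. \<phi> x = x" "quotient_map X X' q"
      "\<forall>x \<in> topspace X. \<forall>y \<in> topspace X. q x = q y \<longleftrightarrow> x = y \<or> (x \<in> s \<and> y = \<phi> x) \<or> (y \<in> s \<and> x = \<phi> y)"
      "K' = (`) q ` K"
    unfolding identify_step_def by (elim exE conjE)
  have n: "(3::nat) - 1 = 2" "(3::nat) - 2 = 1" by simp_all
  interpret identification Fs X K X' K' p' s t F \<phi> q
    by (intro identification.intro identification_axioms.intro target_complex_axioms X X' p' h(1)[unfolded n]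
        h(2)[unfolded n] h(3) h(4)[unfolded n] h(5,6) h(7)[rule_format] h(8)[rule_format] h(9) h(10)[rule_format] h(11))
  show ?thesis using resolution_q identified_q by blast
qed

section \<open>Pulling back along gluing steps\<close>

definition chart :: "'a topology \<Rightarrow> 'a set set \<Rightarrow> ((nat \<Rightarrow> real) \<Rightarrow> 'a) \<Rightarrow> bool" where
  "chart X K r \<longleftrightarrow> continuous_map (simplex_topology 3) X r \<and> inj_on r (standard_simplex 3) \<and>
     (`) r ` simplex_faces 3 \<subseteq> K"

text \<open>During the gluing steps every cell is a face of a standard tetrahedron embedded in the
  complex. This finds faces with prescribed labels in \<open>K\<close> itself: a face of an old cell
  provided by \<open>K'\<close> might a priori come only from the new simplex.\<close>

definition charted :: "'a topology \<Rightarrow> 'a set set \<Rightarrow> bool" where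
  "charted X K \<longleftrightarrow> (\<forall>c\<in>K. \<exists>r. chart X K r \<and> c \<in> (`) r ` simplex_faces 3)"

definition face :: "nat set \<Rightarrow> (nat \<Rightarrow> real) set" where
  "face A = {x \<in> standard_simplex 3. \<forall>i. i \<notin> A \<longrightarrow> x i = 0}"

lemma simplex_faces_3: "simplex_faces 3 = face ` (Pow {..3} - {{}})"
  by (simp add: simplex_faces_def face_def)

lemma face_full: "face {..3} = standard_simplex 3"
  by (auto simp: face_def standard_simplex_def)

lemma standard_simplex_face: "standard_simplex 3 \<in> simplex_faces 3"
  unfolding simplex_faces_3 face_full[symmetric] by (rule imageI) auto

lemma topspace_simplex_topology: "topspace (simplex_topology 3) = standard_simplex 3"
  by (simp add: simplex_topology_def)

lemma face_mono_iff: assumes "A \<subseteq> {..3}" shows "face A \<subseteq> face B \<longleftrightarrow> A \<subseteq> B"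
proof
  assume sub: "face A \<subseteq> face B"
  show "A \<subseteq> B"
  proof
    fix j assume j: "j \<in> A"
    let ?e = "\<lambda>i. if i = j then 1 else (0::real)"
    have "?e \<in> standard_simplex 3" using j assms by (auto simp: standard_simplex_def)
    then have "?e \<in> face A" using j by (auto simp: face_def)
    then have "?e \<in> face B" using sub by blast
    then show "j \<in> B" by (auto simp: face_def split: if_splits)
  qed
qed (auto simp: face_def)

lemma card_simplex_faces: "card (simplex_faces 3) = 15" and finite_simplex_faces: "finite (simplex_faces 3)"
proof -
  have "inj_on face (Pow {..3} - {{}})"
  proof (rule inj_onI)
    fix A B assume AB: "A \<in> Pow {..3::nat} - {{}}" "B \<in> Pow {..3} - {{}}" "face A = face B"
    show "A = B" using face_mono_iff[of A B] face_mono_iff[of B A] AB by blast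
  qed
  then have "card (simplex_faces 3) = card (Pow {..3::nat} - {{}})" unfolding simplex_faces_3 by (rule card_image)
  also have "\<dots> = 15" by (simp add: card_Pow card_Diff_singleton)
  finally show "card (simplex_faces 3) = 15" .
qed (simp add: simplex_faces_def)

lemma embedding_mapD:
  assumes "embedding_map X X' e" shows "continuous_map X X' e" "inj_on e (topspace X)"
proof -
  have h: "homeomorphic_map X (subtopology X' (e ` topspace X)) e" using assms by (simp add: embedding_map_def)
  show "continuous_map X X' e"
    using homeomorphic_imp_continuous_map[OF h] by (simp add: continuous_map_in_subtopology)
  show "inj_on e (topspace X)" by (rule homeomorphic_imp_injective_map[OF h])
qed

lemma chart_compose:
  assumes r: "chart X K r" and e: "embedding_map X X' e" "(`) e ` K \<subseteq> K'"
  shows "chart X' K' (e \<circ> r)"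
proof -
  have ec: "continuous_map X X' e" and ei: "inj_on e (topspace X)"
    by (fact embedding_mapD[OF e(1)])+
  have rc: "continuous_map (simplex_topology 3) X r" and ri: "inj_on r (standard_simplex 3)"
    and rK: "(`) r ` simplex_faces 3 \<subseteq> K" using r by (auto simp: chart_def)
  have "r ` standard_simplex 3 \<subseteq> topspace X"
    using continuous_map_image_subset_topspace[OF rc] by (simp add: topspace_simplex_topology)
  then have "inj_on (e \<circ> r) (standard_simplex 3)" by (intro comp_inj_on ri inj_on_subset[OF ei])
  moreover have "(`) (e \<circ> r) ` simplex_faces 3 \<subseteq> K'"
  proof
    fix x assume "x \<in> (`) (e \<circ> r) ` simplex_faces 3"
    then obtain f where "f \<in> simplex_faces 3" "x = e ` r ` f" by (auto simp: image_comp)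
    then show "x \<in> K'" using rK e(2) by blast
  qed
  ultimately show ?thesis using continuous_map_compose[OF rc ec] by (simp add: chart_def)
qed

context target_complex
begin

text \<open>The 15 nonempty faces of a tetrahedron get distinct nonempty labels inside one label set
  of at most four elements. As 15 is \<open>2^4 - 1\<close>, that set has four elements and each of
  its nonempty subsets occurs.\<close>

lemma chart_faces:
  assumes p: "resolution X K p" and r: "chart X K r"
  shows "card (label p (r ` standard_simplex 3)) = 4"
    and "A \<noteq> {} \<Longrightarrow> A \<subseteq> label p (r ` standard_simplex 3) \<Longrightarrow> \<exists>f\<in>simplex_faces 3. label p (r ` f) = A"
proof -
  let ?D = "r ` standard_simplex 3" and ?L = "label p (r ` standard_simplex 3)"
  let ?l = "\<lambda>f. label p (r ` f)"
  have rK: "r ` f \<in> K" if "f \<in> simplex_faces 3" for f using r that by (auto simp: chart_def)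
  have ri: "inj_on r (standard_simplex 3)" using r by (simp add: chart_def)
  note DK = rK[OF standard_simplex_face]
  have fs: "f \<subseteq> standard_simplex 3" if "f \<in> simplex_faces 3" for f using that by (auto simp: simplex_faces_def)
  have L: "finite ?L" "card ?L \<le> 4" using simplicesD[OF resolution_cell(2)[OF p DK]] by simp_all
  have inj: "inj_on ?l (simplex_faces 3)"
  proof (rule inj_onI)
    fix f f' assume f: "f \<in> simplex_faces 3" "f' \<in> simplex_faces 3" "?l f = ?l f'"
    have "r ` f \<subseteq> r ` f'" "r ` f' \<subseteq> r ` f"
      using label_subset_iff[OF p DK rK[OF f(1)] rK[OF f(2)] image_mono[OF fs[OF f(1)]] image_mono[OF fs[OF f(2)]]]
        label_subset_iff[OF p DK rK[OF f(2)] rK[OF f(1)] image_mono[OF fs[OF f(2)]] image_mono[OF fs[OF f(1)]]] f(3)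
      by simp_all
    then have "r ` f = r ` f'" by blast
    then show "f = f'" using inj_on_image_eq_iff[OF ri fs[OF f(1)] fs[OF f(2)]] by simp
  qed
  have sub: "?l ` simplex_faces 3 \<subseteq> Pow ?L - {{}}"
  proof
    fix A assume "A \<in> ?l ` simplex_faces 3"
    then obtain f where f: "f \<in> simplex_faces 3" "A = ?l f" by blast
    have "?l f \<subseteq> ?L"
      using label_subset_iff[OF p DK rK[OF f(1)] DK image_mono[OF fs[OF f(1)]] subset_refl] image_mono[OF fs[OF f(1)], of r] by simp
    then show "A \<in> Pow ?L - {{}}" using simplicesD(3)[OF resolution_cell(2)[OF p rK[OF f(1)]]] f(2) by simp
  qed
  have fin: "finite (Pow ?L - {{}})" using L by simp
  have card: "card (?l ` simplex_faces 3) = 15" using card_image[OF inj] card_simplex_faces by simp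
  have cP: "card (Pow ?L - {{}}) = 2 ^ card ?L - 1" using L by (simp add: card_Pow card_Diff_singleton)
  have "15 \<le> 2 ^ card ?L - (1::nat)" using card_mono[OF fin sub] card cP by simp
  then have "(2::nat) ^ 3 < 2 ^ card ?L" by simp
  then have "3 < card ?L" by (rule power_less_imp_less_exp[rotated]) simp
  then show 4: "card ?L = 4" using L by simp
  have "card (Pow ?L - {{}}) = card (?l ` simplex_faces 3)" unfolding cP card 4 by simp
  then have "?l ` simplex_faces 3 = Pow ?L - {{}}" using card_subset_eq[OF fin sub] by simp
  then show "A \<noteq> {} \<Longrightarrow> A \<subseteq> ?L \<Longrightarrow> \<exists>f\<in>simplex_faces 3. ?l f = A" by (metis (no_types, lifting) DiffI PowI imageE singletonD)
qed

text \<open>Since \<open>e\<close> is an embedding, injectivity on cells is inherited from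
  \<open>p'\<close>. The work lies in lifting faces, which is done in a charted tetrahedron around
  the given cell.\<close>

lemma glue_step_resolution:
  assumes step: "glue_step 3 X K X' K'" and X: "pseudomanifold 3 X K" and X': "pseudomanifold 3 X' K'"
    and ch: "charted X K" and p': "resolution X' K' p'"
  shows "\<exists>p e S s. resolution X K p \<and> glued Fs K (label p) K' (label p') e S s"
proof -
  from step obtain t j e s where
    h: "t \<in> n_cells (3 - 1) X K \<inter> pm_boundary 3 X K" "embedding_map X X' e" "embedding_map (simplex_topology 3) X' s"
      "e ` topspace X \<inter> s ` standard_simplex 3 = e ` t"
      "e ` t = s ` {x \<in> standard_simplex 3. x j = 0}" "K' = (`) e ` K \<union> (`) s ` simplex_faces 3"
    unfolding glue_step_def by (elim exE conjE)
  note R = pseudomanifoldD(2)[OF X] and R' = pseudomanifoldD(2)[OF X']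
  have emb: "continuous_map X X' e" "inj_on e (topspace X)"
    by (fact embedding_mapD[OF h(2)])+
  have sc: "chart X' K' s"
    using embedding_mapD[OF h(3)] h(6) by (simp add: chart_def topspace_simplex_topology)
  have eK: "(`) e ` K \<subseteq> K'" "\<And>c. c \<in> K \<Longrightarrow> e ` c \<in> K'" using h(6) by auto
  have top: "c \<subseteq> topspace X" if "c \<in> K" for c using cell_subset[OF R that] .
  have im: "(p' \<circ> e) ` b = p' ` e ` b" for b by (rule image_comp[symmetric])
  have lab: "label (p' \<circ> e) c = label p' (e ` c)" for c by (simp add: label_def image_comp)
  have esub: "e ` a \<subseteq> e ` b \<longleftrightarrow> a \<subseteq> b" if "a \<in> K" "b \<in> K" for a b
    using inj_on_image_subset_iff[OF emb(2) top[OF that(1)] top[OF that(2)]] .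
  have p: "resolution X K (p' \<circ> e)"
    unfolding resolution_def
  proof (intro conjI ballI impI)
    show "continuous_map X target_space (p' \<circ> e)"
      by (rule continuous_map_compose[OF emb(1) resolution_continuous[OF p']])
    fix c assume c: "c \<in> K"
    show "inj_on (p' \<circ> e) c"
      by (rule comp_inj_on[OF inj_on_subset[OF emb(2) top[OF c]] resolution_cell(1)[OF p' eK(2)[OF c]]])
    show "\<exists>A\<in>simplices. (p' \<circ> e) ` c = simplex_on A"
      unfolding im using resolution_cell(2,3)[OF p' eK(2)[OF c]] by (rule bexI[rotated])
    fix A assume A: "A \<in> simplices" "simplex_on A \<subseteq> (p' \<circ> e) ` c"
    then have Ac: "A \<subseteq> label p' (e ` c)"
      using simplex_subset_iff[OF A(1) resolution_cell(2)[OF p' eK(2)[OF c]]] A(2)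
      unfolding im resolution_cell(3)[OF p' eK(2)[OF c], symmetric] by blast
    obtain r f where r: "chart X K r" and f: "f \<in> simplex_faces 3" "c = r ` f"
      using ch c unfolding charted_def by blast
    let ?D = "r ` standard_simplex 3"
    have rK: "r ` f \<in> K" if "f \<in> simplex_faces 3" for f using r that by (auto simp: chart_def)
    have fs: "r ` f \<subseteq> ?D" if "f \<in> simplex_faces 3" for f using that by (auto simp: simplex_faces_def)
    note DK = rK[OF standard_simplex_face]
    have er: "chart X' K' (e \<circ> r)" by (rule chart_compose[OF r h(2) eK(1)])
    have ime: "(e \<circ> r) ` b = e ` r ` b" for b by (rule image_comp[symmetric])
    have cD: "e ` c \<subseteq> e ` ?D" using fs[OF f(1)] f(2) by (simp add: image_mono)
    have "A \<subseteq> label p' (e ` ?D)"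
      using label_subset_iff[OF p' eK(2)[OF DK] eK(2)[OF c] eK(2)[OF DK] cD subset_refl] cD Ac by simp
    then obtain f' where f': "f' \<in> simplex_faces 3" "label p' (e ` r ` f') = A"
      using chart_faces(2)[OF p' er simplicesD(3)[OF A(1)], unfolded ime] by blast
    have "e ` r ` f' \<subseteq> e ` c"
      using label_subset_iff[OF p' eK(2)[OF DK] eK(2)[OF rK[OF f'(1)]] eK(2)[OF c] image_mono[OF fs[OF f'(1)]] cD] f'(2) Ac by simp
    then have "r ` f' \<subseteq> c" using esub[OF rK[OF f'(1)] c] by simp
    moreover have "(p' \<circ> e) ` r ` f' = simplex_on A"
      unfolding im using resolution_cell(3)[OF p' eK(2)[OF rK[OF f'(1)]]] f'(2) by simp
    ultimately show "\<exists>b\<in>K. b \<subseteq> c \<and> (p' \<circ> e) ` b = simplex_on A" using rK[OF f'(1)] by blast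
  qed
  let ?S = "s ` standard_simplex 3"
  have SK: "?S \<in> K'" using h(6) standard_simplex_face by blast
  have cS: "card (label p' ?S) = 4" by (rule chart_faces(1)[OF p' sc])
  have t2: "t \<in> n_cells 2 X K" using h(1) by simp
  then have tK: "t \<in> K" by (simp add: n_cells_def)
  have t3: "card (label (p' \<circ> e) t) = 3" using t2 resolution_n_cells[OF p R, of 2] by simp
  have tS: "e ` t \<subseteq> ?S" using h(5) by blast
  have "glued Fs K (label (p' \<circ> e)) K' (label p') ((`) e) ?S t"
    unfolding glued_def
  proof (intro conjI ballI impI)
    show "(`) e ` K \<subseteq> K'" by (rule eK(1))
    show "label p' (e ` c) = label (p' \<circ> e) c" for c by (rule lab[symmetric])
    show "e ` c \<subseteq> e ` c' \<longleftrightarrow> c \<subseteq> c'" if "c \<in> K" "c' \<in> K" for c c' by (rule esub[OF that])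
    show "?S \<in> facets_of Fs K' (label p')"
      using SK simplices_card4[OF resolution_cell(2)[OF p' SK] cS] by (simp add: facets_of_def)
    show "?S \<notin> (`) e ` K"
    proof
      assume "?S \<in> (`) e ` K"
      then obtain c where c: "c \<in> K" "?S = e ` c" by blast
      then have "?S \<subseteq> e ` topspace X" using top[OF c(1)] by blast
      then have "?S \<subseteq> e ` t" using h(4) by blast
      then have "?S = e ` t" using tS by blast
      then show False using cS t3 unfolding lab by simp
    qed
    show "c \<in> (`) e ` K \<or> c \<subseteq> ?S" if "c \<in> K'" for c
      using that unfolding h(6) by (auto simp: simplex_faces_def)
    show "t \<in> K" "card (label (p' \<circ> e) t) = 3" "e ` t \<subseteq> ?S" by (fact tK t3 tS)+
    show "\<exists>!D. D \<in> facets_of Fs K (label (p' \<circ> e)) \<and> t \<subseteq> D"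
      by (rule boundary_triangle_facet[OF p X]) (use h(1) in simp)
    show "x \<subseteq> e ` t" if c: "c \<in> K" and x: "x \<subseteq> e ` c" "x \<subseteq> ?S" for c x
      using order_trans[OF x(1) image_mono[OF top[OF c]]] x(2) h(4) by blast
  qed
  then show ?thesis using p by blast
qed

end

lemma charted_simplex: "is_simplex 3 X K \<Longrightarrow> charted X K"
proof -
  assume "is_simplex 3 X K"
  then obtain h where h: "homeomorphic_map (simplex_topology 3) X h" "K = (`) h ` simplex_faces 3"
    by (auto simp: is_simplex_def)
  have "chart X K h"
    using homeomorphic_imp_continuous_map[OF h(1)] homeomorphic_imp_injective_map[OF h(1)] h(2)
    by (simp add: chart_def topspace_simplex_topology)
  then show ?thesis unfolding charted_def using h(2) by blast
qed

lemma charted_glue: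
  assumes ch: "charted X K" and step: "glue_step 3 X K X' K'" shows "charted X' K'"
proof -
  from step obtain t j e s where
    h: "embedding_map X X' e" "embedding_map (simplex_topology 3) X' s"
      "K' = (`) e ` K \<union> (`) s ` simplex_faces 3"
    unfolding glue_step_def by (elim exE conjE)
  have sc: "chart X' K' s"
    using embedding_mapD[OF h(2)] h(3) by (simp add: chart_def topspace_simplex_topology)
  show ?thesis
    unfolding charted_def
  proof
    fix c assume "c \<in> K'"
    then consider b where "b \<in> K" "c = e ` b" | "c \<in> (`) s ` simplex_faces 3" unfolding h(3) by (elim UnE imageE) auto
    then show "\<exists>r. chart X' K' r \<and> c \<in> (`) r ` simplex_faces 3"
    proof cases
      case 1
      then obtain r f where r: "chart X K r" "f \<in> simplex_faces 3" "b = r ` f" using ch unfolding charted_def by blast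
      have "chart X' K' (e \<circ> r)" by (rule chart_compose[OF r(1) h(1)]) (use h(3) in blast)
      moreover have "c = (e \<circ> r) ` f" using 1 r by (simp add: image_comp)
      ultimately show ?thesis using r(2) by blast
    next
      case 2 then show ?thesis using sc by blast
    qed
  qed
qed

section \<open>Local constructions of a branched complex\<close>

locale branched_complex = branched_cover Fs g Br adj + target_complex Fs
  for Fs :: "int set set" and g :: "int set \<Rightarrow> int set \<Rightarrow> 'p::finite \<Rightarrow> 'p" and Br adj +
  assumes finite_Fs: "finite Fs" and nonempty_Fs: "Fs \<noteq> {}"
begin

lemma resolution_id: "resolution target_space (simplex_on ` simplices) (\<lambda>x. x)"
  unfolding resolution_def by auto

lemma label_id: "A \<in> simplices \<Longrightarrow> label (\<lambda>x. x) (simplex_on A) = A"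
  by (rule label_eq) simp_all

lemma simplex_on_inj: "A \<in> simplices \<Longrightarrow> B \<in> simplices \<Longrightarrow> simplex_on A = simplex_on B \<longleftrightarrow> A = B"
  using label_id by metis

lemma finite_simplices: "finite simplices"
proof -
  have "simplices \<subseteq> (\<Union>F\<in>Fs. Pow F)" by (auto simp: simplices_def)
  moreover have "finite F" if "F \<in> Fs" for F using card_facet[OF that] by (auto intro: card_ge_0_finite)
  ultimately show ?thesis using finite_Fs by (auto intro: finite_subset)
qed

definition step_ok :: "nat \<Rightarrow> (nat \<Rightarrow> 'a set set) \<Rightarrow> nat \<Rightarrow> ('a \<Rightarrow> real^7) \<Rightarrow> ('a \<Rightarrow> real^7) \<Rightarrow> bool" where
  "step_ok N L j p p' \<longleftrightarrow>
     (if j < N then \<exists>e S s. glued Fs (L j) (label p) (L (Suc j)) (label p') e S s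
      else \<exists>q s t E. identified Fs (L j) (label p) (L (Suc j)) (label p') q s t E)"

text \<open>Resolutions are pulled back from the end, where the identity serves. Counting facets
  from both ends shows that their labels are distinct at every stage, so that the combinatorial
  result applies.\<close>

proposition no_local_construction_target:
  fixes T :: "nat \<Rightarrow> (real^7) topology"
  assumes lc: "local_construction 3 target_space (simplex_on ` simplices) k T L"
    and pure: "pure_CW 3 target_space (simplex_on ` simplices)"
  shows False
proof -
  define N where "N = card (n_cells 3 target_space (simplex_on ` simplices))"
  have Nk: "N \<le> k" and pm: "\<And>i. i \<in> {1..k} \<Longrightarrow> pseudomanifold 3 (T i) (L i)" and T1: "is_simplex 3 (T 1) (L 1)"
    and glue: "\<And>i. i \<in> {1..<N} \<Longrightarrow> glue_step 3 (T i) (L i) (T (Suc i)) (L (Suc i))"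
    and ident: "\<And>i. i \<in> {N..<k} \<Longrightarrow> identify_step 3 (T i) (L i) (T (Suc i)) (L (Suc i))"
    and Tk: "T k = target_space" "L k = simplex_on ` simplices"
    using lc unfolding local_construction_def Let_def N_def by simp_all
  have "n_cells 3 target_space (simplex_on ` simplices) \<noteq> {}" using pure unfolding pure_CW_def by blast
  moreover have "finite (n_cells 3 target_space (simplex_on ` simplices))" using finite_simplices by (simp add: n_cells_def)
  ultimately have N1: "1 \<le> N" by (simp add: N_def card_gt_0_iff Suc_le_eq)
  then have k1: "1 \<le> k" using Nk by simp
  have pmk: "pseudomanifold 3 target_space (simplex_on ` simplices)" using pm[of k] k1 Tk by simp
  note Rk = pseudomanifoldD(2)[OF pmk]
  have facets_k: "n_cells 3 target_space (simplex_on ` simplices) = simplex_on ` Fs"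
    unfolding facets_of_n_cells[OF resolution_id Rk, symmetric] facets_of_def
    using label_id facet_simplex by force
  have "inj_on simplex_on Fs" by (rule inj_onI) (simp add: simplex_on_inj facet_simplex)
  then have N: "N = card Fs" unfolding N_def facets_k by (rule card_image)
  have charted: "charted (T i) (L i)" if "1 \<le> i" "i \<le> N" for i
    using that
  proof (induction i rule: dec_induct)
    case base show ?case by (rule charted_simplex[OF T1])
  next
    case (step i)
    show ?case by (rule charted_glue[OF step.IH glue]) (use step in simp_all)
  qed
  have "\<exists>P. P k = (\<lambda>x. x) \<and> (\<forall>j\<in>{i..k}. resolution (T j) (L j) (P j)) \<and> (\<forall>j\<in>{i..<k}. step_ok N L j (P j) (P (Suc j)))"
    if "1 \<le> i" "i \<le> k" for i
    using that(2,1)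
  proof (induction i rule: inc_induct)
    case base
    show ?case using resolution_id Tk by (intro exI[of _ "\<lambda>_ x. x"]) simp
  next
    case (step i)
    then obtain P where P: "P k = (\<lambda>x. x)" "\<And>j. j \<in> {Suc i..k} \<Longrightarrow> resolution (T j) (L j) (P j)"
      "\<And>j. j \<in> {Suc i..<k} \<Longrightarrow> step_ok N L j (P j) (P (Suc j))" by auto
    have i: "i \<in> {1..k}" "Suc i \<in> {1..k}" using step by auto
    have PS: "resolution (T (Suc i)) (L (Suc i)) (P (Suc i))" using P(2) step by simp
    have "\<exists>p. resolution (T i) (L i) p \<and> step_ok N L i p (P (Suc i))"
    proof (cases "i < N")
      case True
      have gs: "glue_step 3 (T i) (L i) (T (Suc i)) (L (Suc i))" using glue[of i] True step by simp
      have ch: "charted (T i) (L i)" using charted[of i] True step by simp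
      from glue_step_resolution[OF gs pm[OF i(1)] pm[OF i(2)] ch PS] obtain p e S s
        where "resolution (T i) (L i) p" "glued Fs (L i) (label p) (L (Suc i)) (label (P (Suc i))) e S s" by blast
      then show ?thesis unfolding step_ok_def if_P[OF True] by (intro exI conjI)
    next
      case False
      have ids: "identify_step 3 (T i) (L i) (T (Suc i)) (L (Suc i))" using ident[of i] False step by simp
      from identify_step_resolution[OF ids pm[OF i(1)] pm[OF i(2)] PS] obtain p q s t F
        where "resolution (T i) (L i) p" "identified Fs (L i) (label p) (L (Suc i)) (label (P (Suc i))) q s t F" by blast
      then show ?thesis unfolding step_ok_def if_not_P[OF False] by (intro exI conjI)
    qed
    then obtain p where p: "resolution (T i) (L i) p" "step_ok N L i p (P (Suc i))" by blast
    define P' where "P' = P(i := p)"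
    have "P' k = (\<lambda>x. x)" using P(1) step by (simp add: P'_def)
    moreover have "resolution (T j) (L j) (P' j)" if "j \<in> {i..k}" for j
      using that P(2)[of j] p(1) by (cases "j = i") (simp_all add: P'_def)
    moreover have "step_ok N L j (P' j) (P' (Suc j))" if "j \<in> {i..<k}" for j
      using that P(3)[of j] p(2) by (cases "j = i") (simp_all add: P'_def)
    ultimately show ?case by blast
  qed
  from this[OF order_refl k1] obtain P where P: "P k = (\<lambda>x. x)" "\<And>j. j \<in> {1..k} \<Longrightarrow> resolution (T j) (L j) (P j)"
      "\<And>j. j \<in> {1..<k} \<Longrightarrow> step_ok N L j (P j) (P (Suc j))" by auto
  define lab where "lab i = label (P i)" for i
  have lb: "labelling Fs (L i) (lab i)" if "i \<in> {1..k}" for i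
    unfolding lab_def by (rule resolution_labelling[OF P(2)[OF that] pm[OF that]])
  have gl: "\<exists>e S s. glued Fs (L i) (lab i) (L (Suc i)) (lab (Suc i)) e S s" if "i \<in> {1..<N}" for i
    using P(3)[of i] that Nk unfolding step_ok_def lab_def by simp
  have idn: "\<exists>q s t E. identified Fs (L i) (lab i) (L (Suc i)) (lab (Suc i)) q s t E" if "i \<in> {N..<k}" for i
    using P(3)[of i] that N1 unfolding step_ok_def lab_def by simp
  let ?f = "\<lambda>i. facets_of Fs (L i) (lab i)"
  obtain h where h: "homeomorphic_map (simplex_topology 3) (T 1) h" "L 1 = (`) h ` simplex_faces 3"
    using T1 by (auto simp: is_simplex_def)
  have base: "?f 1 = {h ` standard_simplex 3}"
  proof -
    have 1: "1 \<in> {1..k}" using k1 by simp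
    have DK: "h ` standard_simplex 3 \<in> L 1" unfolding h(2) by (rule imageI[OF standard_simplex_face])
    have sub: "c \<subseteq> h ` standard_simplex 3" if "c \<in> L 1" for c
      using that unfolding h(2) by (auto simp: simplex_faces_def)
    obtain D where D: "D \<in> ?f 1" "h ` standard_simplex 3 \<subseteq> D" using labelling_in_facet(2)[OF lb[OF 1] DK] by blast
    then have "D = h ` standard_simplex 3" using sub[OF facets_ofD(1)[OF D(1)]] by blast
    moreover have "c = D" if c: "c \<in> ?f 1" for c
    proof -
      have "c \<subseteq> D" using sub[OF facets_ofD(1)[OF c]] D(2) by blast
      from labelling_card_eq[OF lb[OF 1] facets_ofD(1)[OF c] facets_ofD(1)[OF D(1)] this] show ?thesis
        using card_facet[OF facets_ofD(2)[OF c]] card_facet[OF facets_ofD(2)[OF D(1)]] by simp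
    qed
    ultimately show ?thesis using D(1) by blast
  qed
  have card_le: "finite (?f i) \<and> card (?f i) \<le> i" if "1 \<le> i" "i \<le> N" for i
    using that
  proof (induction i rule: dec_induct)
    case base show ?case unfolding \<open>?f 1 = _\<close> by simp
  next
    case (step i)
    then have i: "i \<in> {1..<N}" "Suc i \<in> {1..k}" and IH: "finite (?f i)" "card (?f i) \<le> i" using Nk by simp_all
    obtain e S s where G: "glued Fs (L i) (lab i) (L (Suc i)) (lab (Suc i)) e S s" using gl[OF i(1)] by blast
    have f: "?f (Suc i) = insert S (e ` ?f i)" by (rule glued_facets[OF lb[OF i(2)] G])
    have "card (insert S (e ` ?f i)) \<le> Suc (card (e ` ?f i))" by (rule card_insert_le_m1[THEN le_trans, of "Suc (card (e ` ?f i))"]) simp_all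
    then show ?case unfolding f using IH card_image_le[OF IH(1), of e] by simp
  qed
  \<comment> \<open>Identifications preserve the labels of facets, so all of \<open>Fs\<close>
    occurs already at stage \<open>N\<close>.\<close>
  have image_k: "lab i ` ?f i = Fs" if "N \<le> i" "i \<le> k" for i
    using that(2,1)
  proof (induction i rule: inc_induct)
    case base
    have "?f k = simplex_on ` Fs" unfolding lab_def P(1) Tk(2) facets_of_n_cells[OF resolution_id Rk] facets_k ..
    then have "lab k ` ?f k = (\<lambda>A. label (\<lambda>x. x) (simplex_on A)) ` Fs" by (simp add: lab_def P(1) image_image)
    then show ?case using label_id facet_simplex by simp
  next
    case (step i)
    then have i: "i \<in> {N..<k}" by simp
    obtain q s t E where G: "identified Fs (L i) (lab i) (L (Suc i)) (lab (Suc i)) q s t E" using idn[OF i] by blast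
    have "lab (Suc i) ` ?f (Suc i) = (\<lambda>c. lab (Suc i) (q c)) ` ?f i"
      unfolding identified_facets[OF G] by (simp add: image_image)
    also have "\<dots> = lab i ` ?f i" using identifiedD(2)[OF G facets_ofD(1)] by (intro image_cong) simp_all
    finally show ?case using step by simp
  qed
  have card_N: "finite (?f i) \<and> card (?f i) \<le> N" if "N \<le> i" "i \<le> k" for i
    using that
  proof (induction i rule: dec_induct)
    case base show ?case using card_le[of N] N1 by simp
  next
    case (step i)
    then have i: "i \<in> {N..<k}" and IH: "finite (?f i)" "card (?f i) \<le> N" by simp_all
    obtain q s t E where G: "identified Fs (L i) (lab i) (L (Suc i)) (lab (Suc i)) q s t E" using idn[OF i] by blast
    show ?case unfolding identified_facets[OF G] using IH card_image_le[OF IH(1), of q] by simp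
  qed
  \<comment> \<open>From stage \<open>N\<close> on there are at most \<open>N\<close> facets, and
    they carry all \<open>N\<close> labels. At earlier stages injectivity is inherited from the next
    stage along the inclusion \<open>e\<close>.\<close>
  have inj: "inj_on (lab i) (?f i)" if "i \<in> {1..k}" for i
  proof (cases "N \<le> i")
    case True
    then have i: "N \<le> i" "i \<le> k" using that by simp_all
    have "card (lab i ` ?f i) = N" using image_k[OF i] N by simp
    moreover have "card (lab i ` ?f i) \<le> card (?f i)" using card_N[OF i] by (intro card_image_le) simp
    ultimately have "card (lab i ` ?f i) = card (?f i)" using card_N[OF i] by simp
    then show ?thesis using card_N[OF i] by (intro eq_card_imp_inj_on) simp_all
  next
    case False
    then have "i \<le> N" "1 \<le> i" using that by simp_all
    then show ?thesis
    proof (induction i rule: inc_induct)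
      case base
      have "card (lab N ` ?f N) = N" using image_k[OF order_refl Nk] N by simp
      moreover have "card (lab N ` ?f N) \<le> card (?f N)" using card_N[OF order_refl Nk] by (intro card_image_le) simp
      ultimately have "card (lab N ` ?f N) = card (?f N)" using card_N[OF order_refl Nk] by simp
      then show ?case using card_N[OF order_refl Nk] by (intro eq_card_imp_inj_on) simp_all
    next
      case (step i)
      then have i: "i \<in> {1..<N}" "Suc i \<in> {1..k}" and IH: "inj_on (lab (Suc i)) (?f (Suc i))" using Nk by simp_all
      obtain e S s where G: "glued Fs (L i) (lab i) (L (Suc i)) (lab (Suc i)) e S s" using gl[OF i(1)] by blast
      note GD = gluedD[OF G]
      show ?case
      proof (rule inj_onI)
        fix c c' assume c: "c \<in> ?f i" "c' \<in> ?f i" "lab i c = lab i c'"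
        note cK = facets_ofD(1)[OF c(1)] facets_ofD(1)[OF c(2)]
        have "e c \<in> ?f (Suc i)" "e c' \<in> ?f (Suc i)" unfolding glued_facets[OF lb[OF i(2)] G] using c by simp_all
        moreover have "lab (Suc i) (e c) = lab (Suc i) (e c')" using GD(2)[OF cK(1)] GD(2)[OF cK(2)] c(3) by simp
        ultimately have "e c = e c'" using inj_onD[OF IH] by simp
        then show "c = c'" using GD(3)[OF cK(1,2)] GD(3)[OF cK(2,1)] by simp
      qed
    qed
  qed
  have simplex_Int: "A \<inter> B \<in> simplices" if "adj A B" for A B
  proof -
    have "A \<inter> B \<noteq> {}" "A \<in> Fs" using that by (auto simp: adj_def)
    then show ?thesis using simplices_mono[OF facet_simplex, of A "A \<inter> B"] by simp
  qed
  have adjD: "A \<in> simplices" "B \<in> simplices" "A \<in> Fs" "B \<in> Fs" "card (A \<inter> B) = 3" "A \<noteq> B" if "adj A B" for A B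
    using that facet_simplex card_facet by (auto simp: adj_def)
  have labk: "lab k (simplex_on A) = A" if "A \<in> simplices" for A unfolding lab_def P(1) by (rule label_id[OF that])
  show False
  proof (rule no_local_construction[OF N1 Nk lb inj base gl idn])
    fix A B assume ad: "adj A B"
    note AB = adjD[OF ad] and AB' = simplex_Int[OF ad]
    have "shared Fs (L k) (lab k) (simplex_on (A \<inter> B)) (simplex_on A) (simplex_on B)"
      unfolding shared_def facets_of_def Tk(2)
      using AB AB' labk simplex_on_inj[OF AB(1,2)] simplex_subset_iff[OF AB' AB(1)] simplex_subset_iff[OF AB' AB(2)] by simp
    then show "\<exists>t D D'. shared Fs (L k) (lab k) t D D' \<and> lab k D = A \<and> lab k D' = B"
      using labk[OF AB(1)] labk[OF AB(2)] by blast
  next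
    fix A B C assume ad: "adj A B" and C: "C \<in> Fs" "A \<inter> B \<subseteq> C"
    note AB = adjD[OF ad] and AB' = simplex_Int[OF ad] and C' = facet_simplex[OF C(1)]
    show "C = A \<or> C = B"
    proof (rule ccontr)
      assume nC: "\<not> (C = A \<or> C = B)"
      let ?t = "simplex_on (A \<inter> B)"
      let ?D = "{D \<in> n_cells 3 target_space (simplex_on ` simplices). ?t \<subseteq> D}"
      have "?t \<in> n_cells 2 target_space (simplex_on ` simplices)"
        unfolding resolution_n_cells[OF resolution_id Rk, of 2, simplified] using AB' AB(5) label_id[OF AB'] by simp
      then have "card ?D \<le> 2" using pmk by (simp add: pseudomanifold_def)
      moreover have "{simplex_on A, simplex_on B, simplex_on C} \<subseteq> ?D"
        unfolding facets_k
        using AB C simplex_subset_iff[OF AB' AB(1)] simplex_subset_iff[OF AB' AB(2)] simplex_subset_iff[OF AB' C'] by simp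
      moreover have "finite ?D" unfolding facets_k using finite_Fs by simp
      ultimately have "card {simplex_on A, simplex_on B, simplex_on C} \<le> 2" using card_mono order_trans by meson
      moreover have "simplex_on A \<noteq> simplex_on B" "simplex_on A \<noteq> simplex_on C" "simplex_on B \<noteq> simplex_on C"
        using simplex_on_inj[OF AB(1,2)] simplex_on_inj[OF AB(1) C'] simplex_on_inj[OF AB(2) C'] AB(6) nC by auto
      ultimately show False by simp
    qed
  qed
qed

lemma simplices_eq: "simplices = faces_of Fs - {{}}"
  by (auto simp: simplices_def faces_of_def)

lemma Union_faces: "\<Union>(simplex_on ` faces_of Fs) = \<Union>(simplex_on ` Fs)"
proof
  show "\<Union>(simplex_on ` faces_of Fs) \<subseteq> \<Union>(simplex_on ` Fs)"
  proof
    fix x assume "x \<in> \<Union>(simplex_on ` faces_of Fs)"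
    then obtain A F where A: "x \<in> simplex_on A" "F \<in> Fs" "A \<subseteq> F" by (auto simp: faces_of_def)
    then have "x \<in> simplex_on F" unfolding simplex_on_def using hull_mono[OF image_mono[OF A(3)], of convex moment] by blast
    then show "x \<in> \<Union>(simplex_on ` Fs)" using A(2) by blast
  qed
qed (auto simp: faces_of_def)

proposition not_LC: "\<not> LC 3 (simplex_on ` faces_of Fs)"
proof
  assume LC: "LC 3 (simplex_on ` faces_of Fs)"
  have K: "simplex_on ` faces_of Fs - {{}} = simplex_on ` simplices"
    unfolding simplices_eq by (auto simp: simplex_on_def)
  obtain k T L where "local_construction 3 target_space (simplex_on ` simplices) k T L"
    and "pure_CW 3 target_space (simplex_on ` simplices)"
    using LC unfolding LC_def Let_def K Union_faces target_space_def by blast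
  then show False by (rule no_local_construction_target)
qed

end

section \<open>A triangulated sphere containing a knotted triangle\<close>

text \<open>The three edges in \<open>branch_edges\<close> form a connected sum of three trefoils.\<close>

definition facets :: "int list list" where "facets = [
   [0,1,12,19], [0,1,12,20], [0,1,19,20], [0,2,5,7], [0,2,5,16], [0,2,7,16], [0,3,9,15],
   [0,3,9,17], [0,3,13,17], [0,3,13,18], [0,3,15,18], [0,4,6,8], [0,4,6,16], [0,4,8,18],
   [0,4,13,14], [0,4,13,18], [0,4,14,16], [0,5,6,7], [0,5,6,16], [0,6,7,14], [0,6,8,14],
   [0,7,14,16], [0,8,13,14], [0,8,13,15], [0,8,15,18], [0,9,10,15], [0,9,10,20], [0,9,17,19],
   [0,9,19,20], [0,10,12,19], [0,10,12,20], [0,10,15,17], [0,10,17,19], [0,13,15,17], [1,2,3,11],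
   [1,2,3,15], [1,2,11,15], [1,3,5,8], [1,3,5,18], [1,3,8,11], [1,3,15,18], [1,4,7,9],
   [1,4,7,13], [1,4,9,10], [1,4,10,17], [1,4,13,14], [1,4,14,17], [1,5,8,9], [1,5,9,10],
   [1,5,10,18], [1,6,7,10], [1,6,7,13], [1,6,10,17], [1,6,13,20], [1,6,17,20], [1,7,9,18],
   [1,7,10,18], [1,8,9,18], [1,8,11,15], [1,8,15,18], [1,12,14,19], [1,12,14,20], [1,13,14,19],
   [1,13,19,20], [1,14,17,20], [2,3,4,15], [2,3,4,20], [2,3,11,20], [2,4,6,8], [2,4,6,15],
   [2,4,8,18], [2,4,18,20], [2,5,7,19], [2,5,8,9], [2,5,8,16], [2,5,9,19], [2,6,8,19],
   [2,6,15,20], [2,6,17,19], [2,6,17,20], [2,7,8,16], [2,7,8,19], [2,8,9,18], [2,9,17,18],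
   [2,9,17,19], [2,11,15,20], [2,17,18,20], [3,4,7,9], [3,4,7,20], [3,4,9,15], [3,5,8,16],
   [3,5,13,16], [3,5,13,18], [3,7,8,16], [3,7,8,20], [3,7,9,17], [3,7,16,17], [3,8,11,20],
   [3,13,16,17], [4,5,7,13], [4,5,7,20], [4,5,13,18], [4,5,18,20], [4,6,15,16], [4,9,10,15],
   [4,10,15,17], [4,14,16,17], [4,15,16,17], [5,6,7,13], [5,6,13,16], [5,7,19,20], [5,9,10,20],
   [5,9,19,20], [5,10,18,20], [6,7,10,14], [6,8,14,19], [6,10,14,19], [6,10,17,19], [6,13,15,16],
   [6,13,15,20], [7,8,19,20], [7,9,17,18], [7,10,14,18], [7,14,16,17], [7,14,17,18],
   [8,11,15,20], [8,13,14,19], [8,13,15,20], [8,13,19,20], [10,12,14,19], [10,12,14,20],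
   [10,14,18,20], [13,15,16,17], [14,17,18,20]]"

definition branch_edges :: "int list list" where "branch_edges = [[1,2],[0,2],[0,1]]"

text \<open>Simplices are handled as lists so that the tables below can be checked by evaluation.
  Order is ignored, since a move may return unsorted lists.\<close>

definition sub_list :: "int list \<Rightarrow> int list \<Rightarrow> bool" where
  "sub_list A B = list_all (\<lambda>x. List.member B x) A"

definition eq_list :: "int list \<Rightarrow> int list \<Rightarrow> bool" where
  "eq_list A B = (sub_list A B \<and> sub_list B A)"

lemma sub_list_iff [simp]: "sub_list A B \<longleftrightarrow> set A \<subseteq> set B"
  by (auto simp: sub_list_def list_all_iff List.member_iff)

lemma eq_list_iff [simp]: "eq_list A B \<longleftrightarrow> set A = set B"
  by (auto simp: eq_list_def)

definition flip :: "int list \<Rightarrow> int list \<Rightarrow> int list list \<Rightarrow> int list list" where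
  "flip A B FL = filter (\<lambda>F. \<not> sub_list A F) FL @ map (\<lambda>a. remove1 a (A @ B)) A"

definition flip_ok :: "int list \<Rightarrow> int list \<Rightarrow> int list list \<Rightarrow> bool" where
  "flip_ok A B FL = (A \<noteq> [] \<and> B \<noteq> [] \<and> distinct (A @ B) \<and> list_all (\<lambda>F. \<not> sub_list B F) FL \<and>
    (let st = filter (sub_list A) FL; nw = map (\<lambda>b. remove1 b (A @ B)) B in
      list_all (\<lambda>F. list_ex (eq_list F) nw) st \<and> list_all (\<lambda>F. list_ex (eq_list F) st) nw))"

fun flips :: "(int list \<times> int list) list \<Rightarrow> int list list \<Rightarrow> int list list option" where
  "flips [] FL = Some FL"
| "flips ((A, B) # ms) FL = (if flip_ok A B FL then flips ms (flip A B FL) else None)"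

text \<open>A certificate: in every pair \<open>A\<close> is an edge lying in three tetrahedra or a
  vertex lying in four. The sixteen entries of the second kind remove their vertex, and the vertices
  9, 10, 17, 18, 20 remain.\<close>

definition moves :: "(int list \<times> int list) list" where "moves = [
   ([1,2],[3,11,15]), ([1,11],[3,8,15]), ([8,11],[3,15,20]), ([11],[2,3,15,20]),
   ([1,15],[3,8,18]), ([1,3],[5,8,18]), ([2,3],[4,15,20]), ([15,18],[0,3,8]), ([0,2],[5,7,16]),
   ([1,8],[5,9,18]), ([0,5],[6,7,16]), ([2,16],[5,7,8]), ([2,7],[5,8,19]), ([5,6],[7,13,16]),
   ([1,5],[9,10,18]), ([8,9],[2,5,18]), ([2,15],[4,6,20]), ([5,10],[9,18,20]), ([0,7],[6,14,16]),
   ([7,19],[5,8,20]), ([0,1],[12,19,20]), ([0,16],[4,6,14]), ([8,16],[3,5,7]), ([7,8],[3,5,20]),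
   ([7,20],[3,4,5]), ([0,12],[10,19,20]), ([1,12],[14,19,20]), ([12],[10,14,19,20]),
   ([0,20],[9,10,19]), ([1,18],[7,9,10]), ([0,19],[9,10,17]), ([0,6],[4,8,14]),
   ([0,14],[4,8,13]), ([1,19],[13,14,20]), ([0,10],[9,15,17]), ([0,9],[3,15,17]),
   ([10,15],[4,9,17]), ([4,10],[1,9,17]), ([5,16],[3,7,13]), ([0,4],[8,13,18]), ([5,7],[3,4,13]),
   ([9,15],[3,4,17]), ([0,17],[3,13,15]), ([0,18],[3,8,13]), ([3,18],[5,8,13]),
   ([0],[3,8,13,15]), ([3,9],[4,7,17]), ([3,16],[7,13,17]), ([8,15],[3,13,20]),
   ([3,7],[4,13,17]), ([3,8],[5,13,20]), ([13,19],[8,14,20]), ([3,17],[4,13,15]),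
   ([4,9],[1,7,17]), ([13,18],[4,5,8]), ([3,5],[4,13,20]), ([1,9],[7,10,17]), ([3],[4,13,15,20]),
   ([8,18],[2,4,5]), ([7,9],[10,17,18]), ([1,10],[6,7,17]), ([4,7],[1,13,17]),
   ([1,4],[13,14,17]), ([15,20],[4,6,13]), ([1,14],[13,17,20]), ([15,17],[4,13,16]),
   ([1,20],[6,13,17]), ([1],[6,7,13,17]), ([15],[4,6,13,16]), ([4,18],[2,5,20]),
   ([7,13],[6,16,17]), ([13,16],[4,6,17]), ([7,16],[6,14,17]), ([16],[4,6,14,17]),
   ([7,18],[10,14,17]), ([14,18],[10,17,20]), ([7],[6,10,14,17]), ([4,17],[6,13,14]),
   ([5,13],[4,8,20]), ([13,17],[6,14,20]), ([6,13],[4,14,20]), ([13],[4,8,14,20]),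
   ([14,17],[6,10,20]), ([4,14],[6,8,20]), ([8,14],[6,19,20]), ([14],[6,10,19,20]),
   ([4,5],[2,8,20]), ([4],[2,6,8,20]), ([5,18],[2,9,20]), ([5,8],[2,19,20]), ([5],[2,9,19,20]),
   ([8],[2,6,19,20]), ([2,18],[9,17,20]), ([6,10],[17,19,20]), ([6],[2,17,19,20]),
   ([2],[9,17,19,20]), ([19],[9,10,17,20])]"

definition is_simplex_boundary :: "int list list \<Rightarrow> bool" where
  "is_simplex_boundary FL = (let V = remdups (concat FL); bd = map (\<lambda>a. remove1 a V) V in
     length V = 5 \<and> list_all (\<lambda>F. list_ex (eq_list F) bd) FL \<and> list_all (\<lambda>F. list_ex (eq_list F) FL) bd)"

lemma flips_to_simplex_boundary:
  "case flips moves facets of None \<Rightarrow> False | Some FL \<Rightarrow> is_simplex_boundary FL"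
  by code_simp

lemma list_all_ex_eq_list:
  "list_all (\<lambda>F. list_ex (eq_list F) ys) xs \<longleftrightarrow> set ` set xs \<subseteq> set ` set ys"
  by (auto simp: list_all_iff list_ex_iff)

lemma set_map_remove1:
  "distinct V \<Longrightarrow> set ` set (map (\<lambda>a. remove1 a V) A) = (\<lambda>a. set V - {a}) ` set A"
  by (auto simp: set_remove1_eq image_iff)

lemma flip_ok_bistellar:
  assumes "flip_ok A B FL"
  shows "bistellar (set A) (set B) (set ` set FL) (set ` set (flip A B FL))"
proof -
  have d: "A \<noteq> []" "B \<noteq> []" "distinct (A @ B)" and nB: "\<forall>F\<in>set FL. \<not> set B \<subseteq> set F"
    and lk: "set ` set (filter (sub_list A) FL) = set ` set (map (\<lambda>b. remove1 b (A @ B)) B)"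
    using assms unfolding flip_ok_def Let_def list_all_ex_eq_list by (auto simp: list_all_iff)
  have "{F \<in> set ` set FL. set A \<subseteq> F} = set ` set (filter (sub_list A) FL)" by auto
  also have "\<dots> = (\<lambda>b. set A \<union> set B - {b}) ` set B" using lk set_map_remove1[OF d(3), of B] by simp
  finally have 1: "{F \<in> set ` set FL. set A \<subseteq> F} = (\<lambda>b. set A \<union> set B - {b}) ` set B" .
  have "set ` set (flip A B FL) = {F \<in> set ` set FL. \<not> set A \<subseteq> F} \<union> (\<lambda>a. set A \<union> set B - {a}) ` set A"
    unfolding flip_def set_append image_Un set_map_remove1[OF d(3), of A] by auto
  then show ?thesis unfolding bistellar_def using d nB 1 by auto
qed

lemma flips_homeomorphic:
  "flips ms FL = Some GL \<Longrightarrow> realization (set ` set FL) homeomorphic realization (set ` set GL)"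
proof (induction ms FL rule: flips.induct)
  case (2 A B ms FL)
  then have "flip_ok A B FL" "flips ms (flip A B FL) = Some GL" by (auto split: if_splits)
  then show ?case
    using bistellar_homeomorphic[OF flip_ok_bistellar] 2 homeomorphic_trans by blast
qed (simp add: homeomorphic_refl)

definition knot_facets :: "int set set" where "knot_facets = set ` set facets"

lemma facets_sorted: "list_all (\<lambda>F. length F = 4 \<and> sorted_wrt (<) F) facets"
  by code_simp

lemma knot_facets: "finite knot_facets" "F \<in> knot_facets \<Longrightarrow> finite F" "F \<in> knot_facets \<Longrightarrow> card F = 4"
  using facets_sorted by (auto simp: knot_facets_def list_all_iff strict_sorted_iff distinct_card)

lemma sphere_facets: "\<Union>(simplex_on ` knot_facets) homeomorphic sphere (0 :: real^4) 1"
proof -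
  obtain FL where FL: "flips moves facets = Some FL" "is_simplex_boundary FL"
    using flips_to_simplex_boundary by (auto split: option.splits)
  define V where "V = remdups (concat FL)"
  have V: "distinct V" "length V = 5" and "set ` set FL = set ` set (map (\<lambda>a. remove1 a V) V)"
    using FL(2) unfolding is_simplex_boundary_def Let_def list_all_ex_eq_list V_def by auto
  then have bd: "set ` set FL = (\<lambda>a. set V - {a}) ` set V" using set_map_remove1[of V V] by simp
  have V5: "finite (set V)" "card (set V) = 5" using V distinct_card[of V] by auto
  have "\<Union>(simplex_on ` knot_facets) homeomorphic realization knot_facets"
    by (rule homeomorphic_sym[THEN iffD1, OF realization_homeomorphic]) (use knot_facets in simp_all)
  also have "realization knot_facets homeomorphic realization ((\<lambda>a. set V - {a}) ` set V)"
    using flips_homeomorphic[OF FL(1)] by (simp only: knot_facets_def bd)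
  also have "\<dots> homeomorphic \<Union>(simplex_on ` (\<lambda>a. set V - {a}) ` set V)"
    using V5 by (intro realization_homeomorphic) auto
  also have "\<dots> homeomorphic sphere (0 :: real^4) 1" by (rule simplex_boundary_homeomorphic_sphere[OF V5])
  finally show ?thesis .
qed

section \<open>A five-sheeted cover branched along the knot\<close>

datatype pt = P0 | P1 | P2 | P3 | P4

lemma UNIV_pt: "UNIV = {P0, P1, P2, P3, P4}" by (auto intro: pt.exhaust)

instance pt :: finite by standard (simp add: UNIV_pt)

lemma card_pt: "CARD(pt) = 5" by (simp add: UNIV_pt)

datatype perm = Perm pt pt pt pt pt

fun app :: "perm \<Rightarrow> pt \<Rightarrow> pt" where
  "app (Perm a b c d e) x = (case x of P0 \<Rightarrow> a | P1 \<Rightarrow> b | P2 \<Rightarrow> c | P3 \<Rightarrow> d | P4 \<Rightarrow> e)"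

definition pts :: "pt list" where "pts = [P0, P1, P2, P3, P4]"

definition id_perm :: perm where "id_perm = Perm P0 P1 P2 P3 P4"

text \<open>The identity is the default, so a table need only list the nontrivial
  permutations.\<close>

definition look :: "('a \<times> perm) list \<Rightarrow> 'a \<Rightarrow> perm" where
  "look hs A = (case map_of hs A of None \<Rightarrow> id_perm | Some p \<Rightarrow> p)"

definition perms_ok :: "('a \<times> perm) list \<Rightarrow> bool" where
  "perms_ok hs = list_all (\<lambda>(A, p). distinct (map (app p) pts)) hs"

lemma app_id_perm [simp]: "app id_perm = id"
  by (auto simp: id_perm_def fun_eq_iff split: pt.split)

lemma set_pts: "set pts = UNIV" by (auto simp: pts_def UNIV_pt)

lemma bij_look: assumes "perms_ok hs" shows "bij (app (look hs A))"
proof -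
  have "bij (app p)" if "(A, p) \<in> set hs" for p
  proof -
    have "distinct (map (app p) pts)" using assms that by (auto simp: perms_ok_def list_all_iff)
    then have "inj (app p)" by (simp add: distinct_map set_pts)
    then show ?thesis by (simp add: bij_def finite_UNIV_inj_surj)
  qed
  then show ?thesis by (auto simp: look_def bij_id[unfolded id_def[symmetric]] split: option.split dest: map_of_SomeD)
qed

text \<open>The key of an entry is a triangle, its value the transport from the adjacent facet with the
  smaller opposite vertex to the other one.\<close>

definition voltages :: "(int list \<times> perm) list" where "voltages = [
   ([0,1,20], Perm P0 P1 P2 P4 P3), ([0,2,5], Perm P0 P1 P4 P3 P2),
   ([0,3,9], Perm P0 P1 P2 P4 P3), ([0,3,15], Perm P4 P3 P2 P1 P0),
   ([0,3,18], Perm P4 P3 P2 P0 P1), ([0,5,7], Perm P1 P2 P4 P3 P0),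
   ([0,5,16], Perm P1 P2 P0 P3 P4), ([0,6,7], Perm P0 P4 P2 P3 P1),
   ([0,6,8], Perm P1 P0 P2 P3 P4), ([0,6,16], Perm P4 P0 P2 P3 P1),
   ([0,7,16], Perm P4 P2 P1 P3 P0), ([0,8,18], Perm P1 P0 P2 P3 P4),
   ([0,9,20], Perm P0 P1 P2 P4 P3), ([0,13,15], Perm P4 P3 P2 P1 P0),
   ([0,13,18], Perm P4 P3 P2 P1 P0), ([1,2,3], Perm P0 P2 P1 P3 P4),
   ([1,3,18], Perm P0 P2 P1 P3 P4), ([1,4,9], Perm P0 P4 P2 P1 P3),
   ([1,4,17], Perm P0 P3 P2 P4 P1), ([1,5,8], Perm P0 P1 P4 P3 P2),
   ([1,5,9], Perm P0 P1 P2 P4 P3), ([1,5,18], Perm P0 P1 P3 P4 P2),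
   ([1,6,7], Perm P0 P4 P2 P3 P1), ([1,6,20], Perm P0 P4 P2 P3 P1),
   ([1,7,9], Perm P0 P3 P2 P1 P4), ([1,7,18], Perm P0 P3 P2 P4 P1),
   ([1,8,18], Perm P0 P1 P4 P3 P2), ([1,17,20], Perm P0 P3 P2 P4 P1),
   ([2,3,15], Perm P1 P4 P2 P3 P0), ([2,3,20], Perm P4 P0 P1 P3 P2),
   ([2,5,8], Perm P0 P1 P4 P3 P2), ([2,6,8], Perm P1 P0 P2 P3 P4),
   ([2,6,15], Perm P4 P0 P2 P3 P1), ([2,6,20], Perm P0 P4 P2 P3 P1),
   ([2,8,18], Perm P1 P0 P4 P3 P2), ([2,18,20], Perm P1 P0 P4 P3 P2),
   ([3,4,9], Perm P0 P4 P2 P1 P3), ([3,4,15], Perm P0 P4 P2 P1 P3),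
   ([3,7,9], Perm P0 P3 P2 P1 P4), ([3,7,16], Perm P3 P2 P4 P1 P0),
   ([3,7,20], Perm P4 P0 P1 P3 P2), ([3,13,16], Perm P3 P2 P4 P1 P0),
   ([3,13,18], Perm P4 P3 P1 P0 P2), ([4,15,16], Perm P0 P4 P2 P1 P3),
   ([4,16,17], Perm P0 P4 P2 P1 P3), ([5,7,20], Perm P4 P0 P1 P3 P2),
   ([5,9,20], Perm P0 P1 P2 P4 P3), ([5,13,16], Perm P1 P2 P0 P3 P4),
   ([5,13,18], Perm P1 P2 P0 P3 P4), ([5,18,20], Perm P3 P0 P1 P4 P2),
   ([6,15,16], Perm P4 P0 P2 P3 P1), ([7,16,17], Perm P0 P3 P2 P4 P1),
   ([7,17,18], Perm P0 P3 P2 P4 P1), ([13,15,16], Perm P4 P3 P2 P1 P0),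
   ([17,18,20], Perm P0 P3 P2 P4 P1)]"

definition transport_int :: "int set \<Rightarrow> int set \<Rightarrow> pt \<Rightarrow> pt" where
  "transport_int A B = (let p = app (look voltages (sorted_list_of_set (A \<inter> B))) in
     if the_elem (A - B) < the_elem (B - A) then p else inv_into UNIV p)"

definition diff :: "int list \<Rightarrow> int list \<Rightarrow> int list" where "diff A B = filter (\<lambda>x. \<not> List.member B x) A"
definition inter :: "int list \<Rightarrow> int list \<Rightarrow> int list" where "inter A B = filter (List.member B) A"

text \<open>Only pairs with \<open>a < b\<close> are tested, the orientation in which the table is
  read; the other orientation is the inverse. \<open>X\<close> is the triangle along which the star
  is cut, and \<open>[]\<close> means no cut, as no triangle is the empty list.\<close>

definition potential_ok :: "int list \<Rightarrow> int list \<Rightarrow> (int list \<times> perm) list \<Rightarrow> bool" where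
  "potential_ok E X hs = (let st = filter (sub_list E) facets in
     perms_ok hs \<and> list_all (\<lambda>A. list_all (\<lambda>B. case (diff A B, diff B A) of ([a], [b]) \<Rightarrow>
       a < b \<longrightarrow> inter A B \<noteq> X \<longrightarrow> list_all (\<lambda>x. app (look voltages (inter A B)) (app (look hs A) x) = app (look hs B) x) pts
       | _ \<Rightarrow> True) st) st)"

definition swap :: "pt \<Rightarrow> pt \<Rightarrow> pt \<Rightarrow> pt" where
  "swap x y z = (if z = x then y else if z = y then x else z)"

text \<open>Since \<open>swap x y\<close> is its own inverse, testing one orientation of the
  crossing is enough.\<close>

definition jump_ok :: "int list \<Rightarrow> int list \<Rightarrow> pt \<Rightarrow> pt \<Rightarrow> (int list \<times> perm) list \<Rightarrow> bool" where
  "jump_ok E X x y hs = (let st = filter (sub_list E) facets in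
     list_all (\<lambda>A. list_all (\<lambda>B. case (diff A B, diff B A) of ([a], [b]) \<Rightarrow>
       a < b \<longrightarrow> inter A B = X \<longrightarrow>
         list_all (\<lambda>z. app (look voltages (inter A B)) (app (look hs A) z) = app (look hs B) (swap x y z)) pts
       | _ \<Rightarrow> True) st) st)"

text \<open>An entry lists an edge and a trivialization of the cover over its star; for the edges of the knot
  the star is cut open along the given triangle, and crossing it transposes the two given sheets.
  Facets that are not listed carry the identity.\<close>

definition flat_data :: "(int list \<times> (int list \<times> perm) list) list" where "flat_data = [
   ([0,3], [([0,3,9,15], Perm P0 P1 P2 P4 P3), ([0,3,15,18], Perm P4 P3 P2 P0 P1)]),
   ([0,5], [([0,2,5,7], Perm P4 P0 P1 P3 P2), ([0,2,5,16], Perm P2 P0 P1 P3 P4)]),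
   ([0,6], [([0,6,8,14], Perm P1 P0 P2 P3 P4), ([0,6,7,14], Perm P1 P0 P2 P3 P4), ([0,5,6,7], Perm P4 P0 P2 P3 P1), ([0,5,6,16], Perm P4 P0 P2 P3 P1)]),
   ([0,7], [([0,5,6,7], Perm P1 P2 P4 P3 P0), ([0,6,7,14], Perm P4 P2 P1 P3 P0), ([0,7,14,16], Perm P4 P2 P1 P3 P0)]),
   ([0,8], [([0,4,6,8], Perm P1 P0 P2 P3 P4), ([0,4,8,18], Perm P1 P0 P2 P3 P4)]),
   ([0,9], [([0,3,9,17], Perm P0 P1 P2 P4 P3), ([0,9,19,20], Perm P0 P1 P2 P4 P3), ([0,9,17,19], Perm P0 P1 P2 P4 P3)]),
   ([0,13], [([0,13,15,17], Perm P4 P3 P2 P1 P0), ([0,3,13,17], Perm P4 P3 P2 P1 P0), ([0,3,13,18], Perm P4 P3 P2 P1 P0)]),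
   ([0,15], [([0,3,15,18], Perm P4 P3 P2 P1 P0), ([0,8,13,15], Perm P4 P3 P2 P1 P0), ([0,8,15,18], Perm P4 P3 P2 P1 P0)]),
   ([0,16], [([0,5,6,16], Perm P4 P0 P2 P3 P1), ([0,2,5,16], Perm P4 P2 P1 P3 P0), ([0,2,7,16], Perm P4 P2 P1 P3 P0)]),
   ([0,18], [([0,3,13,18], Perm P3 P4 P2 P1 P0), ([0,4,8,18], Perm P1 P0 P2 P3 P4), ([0,4,13,18], Perm P1 P0 P2 P3 P4)]),
   ([0,20], [([0,1,19,20], Perm P0 P1 P2 P4 P3), ([0,9,19,20], Perm P0 P1 P2 P4 P3)]),
   ([1,3], [([1,2,3,15], Perm P0 P2 P1 P3 P4), ([1,3,15,18], Perm P0 P2 P1 P3 P4)]),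
   ([1,4], [([1,4,9,10], Perm P0 P4 P2 P1 P3), ([1,4,10,17], Perm P0 P4 P2 P1 P3)]),
   ([1,5], [([1,5,8,9], Perm P0 P1 P4 P3 P2), ([1,5,9,10], Perm P0 P1 P3 P4 P2), ([1,5,10,18], Perm P0 P1 P3 P4 P2)]),
   ([1,6], [([1,6,7,13], Perm P0 P4 P2 P3 P1), ([1,6,13,20], Perm P0 P4 P2 P3 P1)]),
   ([1,7], [([1,7,9,18], Perm P0 P3 P2 P1 P4), ([1,7,10,18], Perm P0 P4 P2 P3 P1), ([1,6,7,10], Perm P0 P4 P2 P3 P1)]),
   ([1,8], [([1,5,8,9], Perm P0 P1 P4 P3 P2), ([1,8,9,18], Perm P0 P1 P4 P3 P2)]),
   ([1,9], [([1,5,9,10], Perm P0 P1 P2 P4 P3), ([1,4,7,9], Perm P0 P3 P2 P1 P4), ([1,4,9,10], Perm P0 P1 P2 P4 P3)]),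
   ([1,17], [([1,4,14,17], Perm P0 P3 P2 P4 P1), ([1,14,17,20], Perm P0 P3 P2 P4 P1)]),
   ([1,18], [([1,3,5,18], Perm P0 P2 P1 P3 P4), ([1,8,9,18], Perm P0 P1 P4 P3 P2), ([1,7,9,18], Perm P0 P1 P4 P3 P2), ([1,7,10,18], Perm P0 P3 P1 P4 P2), ([1,5,10,18], Perm P0 P3 P1 P4 P2)]),
   ([1,20], [([0,1,19,20], Perm P0 P1 P2 P4 P3), ([1,6,17,20], Perm P0 P4 P2 P1 P3), ([1,6,13,20], Perm P0 P1 P2 P4 P3), ([1,13,19,20], Perm P0 P1 P2 P4 P3)]),
   ([2,3], [([1,2,3,15], Perm P0 P2 P1 P3 P4), ([2,3,4,20], Perm P1 P2 P4 P3 P0), ([2,3,4,15], Perm P1 P2 P4 P3 P0)]),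
   ([2,5], [([0,2,5,16], Perm P0 P1 P4 P3 P2), ([2,5,8,16], Perm P0 P1 P4 P3 P2)]),
   ([2,6], [([2,4,6,8], Perm P1 P0 P2 P3 P4), ([2,6,15,20], Perm P0 P4 P2 P3 P1), ([2,4,6,15], Perm P1 P0 P2 P3 P4)]),
   ([2,8], [([2,5,8,9], Perm P0 P1 P4 P3 P2), ([2,4,6,8], Perm P1 P0 P2 P3 P4), ([2,4,8,18], Perm P1 P0 P2 P3 P4), ([2,8,9,18], Perm P0 P1 P4 P3 P2)]),
   ([2,15], [([2,3,4,15], Perm P1 P4 P2 P3 P0), ([2,4,6,15], Perm P1 P4 P2 P3 P0)]),
   ([2,18], [([2,4,8,18], Perm P1 P0 P4 P3 P2), ([2,4,18,20], Perm P1 P0 P4 P3 P2)]),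
   ([2,20], [([2,3,4,20], Perm P1 P2 P4 P3 P0), ([2,6,17,20], Perm P0 P4 P2 P3 P1), ([2,17,18,20], Perm P0 P4 P2 P3 P1), ([2,4,18,20], Perm P1 P2 P4 P3 P0)]),
   ([3,4], [([3,4,9,15], Perm P0 P4 P2 P1 P3)]),
   ([3,7], [([3,7,9,17], Perm P0 P3 P2 P1 P4), ([3,7,16,17], Perm P0 P3 P2 P1 P4), ([3,7,8,16], Perm P4 P0 P1 P3 P2), ([3,7,8,20], Perm P4 P0 P1 P3 P2)]),
   ([3,9], [([0,3,9,17], Perm P0 P1 P2 P4 P3), ([3,4,7,9], Perm P0 P3 P2 P4 P1), ([3,7,9,17], Perm P0 P1 P2 P4 P3)]),
   ([3,13], [([3,5,13,16], Perm P4 P3 P1 P0 P2), ([3,5,13,18], Perm P4 P3 P1 P0 P2)]),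
   ([3,15], [([0,3,9,15], Perm P4 P3 P2 P1 P0), ([2,3,4,15], Perm P1 P4 P2 P3 P0), ([3,4,9,15], Perm P4 P3 P2 P1 P0)]),
   ([3,16], [([3,7,16,17], Perm P3 P2 P4 P1 P0), ([3,13,16,17], Perm P3 P2 P4 P1 P0)]),
   ([3,18], [([0,3,13,18], Perm P3 P4 P2 P1 P0), ([1,3,5,18], Perm P0 P2 P1 P3 P4), ([3,5,13,18], Perm P0 P2 P1 P3 P4)]),
   ([3,20], [([2,3,4,20], Perm P1 P2 P4 P3 P0), ([3,4,7,20], Perm P1 P2 P4 P3 P0)]),
   ([4,9], [([1,4,7,9], Perm P0 P3 P2 P4 P1), ([3,4,7,9], Perm P0 P3 P2 P4 P1)]),
   ([4,15], [([2,3,4,15], Perm P0 P3 P2 P4 P1), ([4,6,15,16], Perm P0 P3 P2 P4 P1), ([2,4,6,15], Perm P0 P3 P2 P4 P1)]),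
   ([4,16], [([4,15,16,17], Perm P0 P4 P2 P1 P3)]),
   ([4,17], [([1,4,14,17], Perm P0 P3 P2 P4 P1), ([4,14,16,17], Perm P0 P3 P2 P4 P1)]),
   ([5,7], [([0,2,5,7], Perm P4 P0 P1 P3 P2), ([5,7,19,20], Perm P4 P0 P1 P3 P2), ([2,5,7,19], Perm P4 P0 P1 P3 P2)]),
   ([5,8], [([1,5,8,9], Perm P0 P1 P4 P3 P2), ([2,5,8,9], Perm P0 P1 P4 P3 P2)]),
   ([5,9], [([1,5,9,10], Perm P0 P1 P2 P4 P3), ([5,9,10,20], Perm P0 P1 P2 P4 P3)]),
   ([5,13], [([3,5,13,16], Perm P2 P0 P1 P3 P4), ([3,5,13,18], Perm P2 P0 P1 P3 P4)]),
   ([5,16], [([0,5,6,16], Perm P1 P2 P0 P3 P4), ([5,6,13,16], Perm P1 P2 P0 P3 P4)]),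
   ([5,18], [([1,5,10,18], Perm P0 P1 P3 P4 P2), ([4,5,13,18], Perm P1 P2 P0 P3 P4), ([4,5,18,20], Perm P1 P2 P0 P3 P4), ([5,10,18,20], Perm P0 P1 P3 P4 P2)]),
   ([5,20], [([5,7,19,20], Perm P4 P0 P1 P3 P2), ([5,9,19,20], Perm P4 P0 P1 P3 P2), ([5,9,10,20], Perm P3 P0 P1 P4 P2), ([5,10,18,20], Perm P3 P0 P1 P4 P2)]),
   ([6,7], [([0,6,7,14], Perm P0 P4 P2 P3 P1), ([1,6,7,10], Perm P0 P4 P2 P3 P1), ([6,7,10,14], Perm P0 P4 P2 P3 P1)]),
   ([6,8], [([0,4,6,8], Perm P1 P0 P2 P3 P4), ([2,4,6,8], Perm P1 P0 P2 P3 P4)]),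
   ([6,15], [([2,4,6,15], Perm P1 P4 P2 P3 P0), ([4,6,15,16], Perm P1 P4 P2 P3 P0)]),
   ([6,16], [([0,4,6,16], Perm P1 P4 P2 P3 P0), ([4,6,15,16], Perm P1 P4 P2 P3 P0)]),
   ([6,20], [([1,6,17,20], Perm P0 P4 P2 P3 P1), ([2,6,17,20], Perm P0 P4 P2 P3 P1)]),
   ([7,9], [([1,4,7,9], Perm P0 P3 P2 P1 P4), ([3,4,7,9], Perm P0 P3 P2 P1 P4)]),
   ([7,16], [([0,7,14,16], Perm P4 P2 P1 P3 P0), ([3,7,16,17], Perm P3 P2 P4 P1 P0), ([7,14,16,17], Perm P4 P2 P1 P3 P0)]),
   ([7,17], [([7,14,17,18], Perm P0 P3 P2 P4 P1), ([7,14,16,17], Perm P0 P3 P2 P4 P1)]),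
   ([7,18], [([1,7,9,18], Perm P0 P4 P2 P1 P3), ([7,9,17,18], Perm P0 P4 P2 P1 P3)]),
   ([7,20], [([3,4,7,20], Perm P1 P2 P4 P3 P0), ([4,5,7,20], Perm P1 P2 P4 P3 P0)]),
   ([8,18], [([0,8,15,18], Perm P1 P0 P2 P3 P4), ([2,8,9,18], Perm P1 P0 P4 P3 P2), ([1,8,9,18], Perm P1 P0 P4 P3 P2), ([1,8,15,18], Perm P1 P0 P2 P3 P4)]),
   ([9,20], [([0,9,19,20], Perm P0 P1 P2 P4 P3), ([5,9,19,20], Perm P0 P1 P2 P4 P3)]),
   ([13,15], [([0,13,15,17], Perm P4 P3 P2 P1 P0), ([13,15,16,17], Perm P4 P3 P2 P1 P0)]),
   ([13,16], [([3,5,13,16], Perm P4 P3 P1 P0 P2), ([6,13,15,16], Perm P4 P3 P2 P1 P0), ([5,6,13,16], Perm P4 P3 P2 P1 P0)]),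
   ([13,18], [([0,3,13,18], Perm P4 P3 P2 P1 P0), ([3,5,13,18], Perm P2 P0 P1 P3 P4)]),
   ([15,16], [([4,6,15,16], Perm P0 P3 P2 P4 P1), ([6,13,15,16], Perm P4 P3 P2 P1 P0)]),
   ([16,17], [([7,14,16,17], Perm P0 P3 P2 P4 P1), ([4,14,16,17], Perm P0 P3 P2 P4 P1)]),
   ([17,18], [([7,14,17,18], Perm P0 P3 P2 P4 P1), ([14,17,18,20], Perm P0 P3 P2 P4 P1)]),
   ([17,20], [([1,14,17,20], Perm P0 P3 P2 P4 P1), ([14,17,18,20], Perm P0 P3 P2 P4 P1)]),
   ([18,20], [([4,5,18,20], Perm P1 P2 P4 P0 P3), ([2,17,18,20], Perm P0 P4 P2 P1 P3), ([2,4,18,20], Perm P1 P2 P4 P0 P3)])]"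

text \<open>Each edge of the knot lies in three tetrahedra. All three triangles at it are listed as
  possible cuts, because which of them is closed last depends on the local construction.\<close>

definition cut_data :: "(int list \<times> int list \<times> pt \<times> pt \<times> (int list \<times> perm) list) list" where "cut_data = [
   ([1,2], [1,2,3], P1, P2, []), ([1,2], [1,2,11], P1, P2, [([1,2,3,11], Perm P0 P2 P1 P3 P4)]),
   ([1,2], [1,2,15], P1, P2, [([1,2,3,15], Perm P0 P2 P1 P3 P4)]), ([0,2], [0,2,5], P2, P4, []),
   ([0,2], [0,2,7], P2, P4, [([0,2,5,7], Perm P0 P1 P4 P3 P2)]),
   ([0,2], [0,2,16], P2, P4, [([0,2,5,16], Perm P0 P1 P4 P3 P2)]),
   ([0,1], [0,1,12], P3, P4, [([0,1,12,20], Perm P0 P1 P2 P4 P3)]),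
   ([0,1], [0,1,19], P3, P4, [([0,1,19,20], Perm P0 P1 P2 P4 P3)]), ([0,1], [0,1,20], P3, P4, [])]"

lemma voltages_ok: "perms_ok voltages" by code_simp

lemma flat_data_ok: "list_all (\<lambda>(E, hs). potential_ok E [] hs) flat_data" by code_simp

lemma cut_data_ok: "list_all (\<lambda>(E, X, x, y, hs). potential_ok E X hs \<and> jump_ok E X x y hs) cut_data" by code_simp

text \<open>An edge that occurs in neither table lies on no triangle with an entry in
  \<open>voltages\<close>, so the identity trivializes the cover around it. Keys are sorted, hence
  so are the three edges formed from them.\<close>

lemma flat_data_complete:
  "list_all (\<lambda>(t, p). case t of [x, y, z] \<Rightarrow>
     list_all (\<lambda>E. List.member (map fst flat_data) E \<or> List.member branch_edges E) [[x, y], [x, z], [y, z]]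
     | _ \<Rightarrow> False) voltages"
  by code_simp

lemma cut_data_complete:
  "list_all (\<lambda>E. let st = filter (sub_list E) facets in list_all (\<lambda>A. list_all (\<lambda>B.
     case (diff A B, diff B A) of ([a], [b]) \<Rightarrow> List.member (map (\<lambda>(E, X, _). (E, X)) cut_data) (E, inter A B)
     | _ \<Rightarrow> True) st) st) branch_edges"
  by code_simp

text \<open>Closed walks in the dual graph from the facet \<open>[0,2,5,7]\<close>. Each carries its
  first sheet to its second, and the five pairs form a single cycle through all sheets.\<close>

definition walks :: "(pt \<times> pt \<times> int list list) list" where "walks = [

   (P0, P3, [[0,2,5,7], [0,2,7,16], [0,7,14,16], [7,14,16,17], [7,14,17,18], [7,9,17,18], [2,9,17,18], [2,9,17,19], [2,5,9,19], [2,5,7,19], [0,2,5,7]]),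
   (P3, P1, [[0,2,5,7], [0,2,7,16], [0,7,14,16], [7,14,16,17], [7,14,17,18], [7,9,17,18], [2,9,17,18], [2,9,17,19], [2,5,9,19], [2,5,7,19], [0,2,5,7]]),
   (P1, P2, [[0,2,5,7], [0,5,6,7], [0,6,7,14], [0,6,8,14], [6,8,14,19], [2,6,8,19], [2,7,8,19], [2,5,7,19], [0,2,5,7]]),
   (P2, P4, [[0,2,5,7], [0,2,5,16], [0,2,7,16], [0,2,5,7]]),
   (P4, P0, [[0,2,5,7], [0,5,6,7], [0,6,7,14], [0,6,8,14], [6,8,14,19], [2,6,8,19], [2,7,8,19], [2,5,7,19], [0,2,5,7]])]"

text \<open>A crossing against the orientation searches for the preimage of the sheet, which can be
  evaluated, where \<open>transport_int\<close> uses \<open>inv_into\<close>.\<close>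

definition step_list :: "int list \<Rightarrow> int list \<Rightarrow> pt \<Rightarrow> pt option" where
  "step_list A B x = (if \<not> (List.member facets A \<and> List.member facets B) then None else
     case (diff A B, diff B A) of ([a], [b]) \<Rightarrow>
       let p = look voltages (inter A B) in
         if a < b then Some (app p x) else List.find (\<lambda>y. app p y = x) pts
     | _ \<Rightarrow> None)"

fun walk_list :: "int list list \<Rightarrow> pt \<Rightarrow> (int list \<times> pt) option" where
  "walk_list [] x = None"
| "walk_list [A] x = Some (A, x)"
| "walk_list (A # B # w) x = (case step_list A B x of None \<Rightarrow> None | Some y \<Rightarrow> walk_list (B # w) y)"

lemma walks_ok:
  "list_all (\<lambda>(x, y, w). hd w = [0,2,5,7] \<and> walk_list w x = Some ([0,2,5,7], y)) walks"
  by code_simp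

lemma walks_cycle: "map (\<lambda>(x, y, w). (x, y)) walks = [(P0, P3), (P3, P1), (P1, P2), (P2, P4), (P4, P0)]"
  by code_simp

section \<open>From the tables to the permutations between facets\<close>

lemma facets_D:
  assumes "A \<in> set facets" shows "sorted A" "distinct A" "card (set A) = 4"
  using assms facets_sorted by (auto simp: list_all_iff strict_sorted_iff distinct_card)

lemma sorted_list_of_facet: "A \<in> set facets \<Longrightarrow> sorted_list_of_set (set A) = A"
  using facets_D by (simp add: sorted_list_of_set.idem_if_sorted_distinct)

lemma set_inter [simp]: "set (inter A B) = set A \<inter> set B" and set_diff [simp]: "set (diff A B) = set A - set B"
  by (auto simp: inter_def diff_def List.member_iff)

lemma inter_sorted_list:
  assumes "A \<in> set facets" shows "inter A B = sorted_list_of_set (set A \<inter> set B)"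
proof -
  have "sorted (inter A B)" "distinct (inter A B)"
    using facets_D[OF assms] by (auto simp: inter_def intro: sorted_wrt_filter)
  from sorted_list_of_set.idem_if_sorted_distinct[OF this] show ?thesis by simp
qed

lemma diff_singleton:
  assumes "A \<in> set facets" "card (set A \<inter> set B) = 3" shows "\<exists>a. diff A B = [a]"
proof -
  have "distinct (diff A B)" using facets_D(2)[OF assms(1)] by (simp add: diff_def)
  from distinct_card[OF this] have "length (diff A B) = card (set A - set B)" by simp
  also have "\<dots> = 1" using facets_D(3)[OF assms(1)] assms(2) card_Diff_subset_Int[of "set A" "set B"] by simp
  finally show ?thesis by (simp add: length_Suc_conv)
qed

definition triangle_perm :: "int set \<Rightarrow> pt \<Rightarrow> pt" where
  "triangle_perm t = app (look voltages (sorted_list_of_set t))"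

lemma bij_triangle_perm: "bij (triangle_perm t)"
  unfolding triangle_perm_def by (rule bij_look[OF voltages_ok])

lemma transport_lists:
  assumes AB: "A \<in> set facets" "B \<in> set facets" "card (set A \<inter> set B) = 3"
  obtains a b where "diff A B = [a]" "diff B A = [b]" "a \<noteq> b"
    "transport_int (set A) (set B) = (if a < b then triangle_perm (set A \<inter> set B) else inv_into UNIV (triangle_perm (set A \<inter> set B)))"
proof -
  obtain a b where ab: "diff A B = [a]" "diff B A = [b]"
    using diff_singleton[OF AB(1), of B] diff_singleton[OF AB(2), of A] AB(3) by (auto simp: Int_commute)
  then have s: "set A - set B = {a}" "set B - set A = {b}" by (simp_all flip: set_diff)
  show thesis
  proof (rule that[OF ab])
    show "a \<noteq> b" using s by blast
    show "transport_int (set A) (set B) = (if a < b then triangle_perm (set A \<inter> set B) else inv_into UNIV (triangle_perm (set A \<inter> set B)))"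
      by (simp add: transport_int_def triangle_perm_def Let_def s)
  qed
qed

definition adj_int :: "int set \<Rightarrow> int set \<Rightarrow> bool" where
  "adj_int A B \<longleftrightarrow> A \<in> knot_facets \<and> B \<in> knot_facets \<and> card (A \<inter> B) = 3"

lemma adj_int_lists:
  assumes "adj_int A B"
  obtains LA LB a b where "LA \<in> set facets" "LB \<in> set facets" "A = set LA" "B = set LB"
    "diff LA LB = [a]" "diff LB LA = [b]" "a \<noteq> b"
    "transport_int A B = (if a < b then triangle_perm (A \<inter> B) else inv_into UNIV (triangle_perm (A \<inter> B)))"
proof -
  obtain LA LB where L: "LA \<in> set facets" "LB \<in> set facets" "A = set LA" "B = set LB"
    using assms by (auto simp: adj_int_def knot_facets_def)
  have "card (set LA \<inter> set LB) = 3" using assms L by (simp add: adj_int_def)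
  then obtain a b where "diff LA LB = [a]" "diff LB LA = [b]" "a \<noteq> b"
    "transport_int A B = (if a < b then triangle_perm (A \<inter> B) else inv_into UNIV (triangle_perm (A \<inter> B)))"
    unfolding L(3,4) by (rule transport_lists[OF L(1,2)])
  then show thesis by (rule that[OF L])
qed

lemma bij_transport: "adj_int A B \<Longrightarrow> bij (transport_int A B)"
  by (erule adj_int_lists) (simp add: bij_triangle_perm bij_imp_bij_inv)

lemma transport_inverse:
  assumes adj: "adj_int A B" shows "transport_int B A (transport_int A B x) = x"
proof -
  let ?p = "triangle_perm (A \<inter> B)"
  have p: "inv_into UNIV ?p (?p z) = z" "?p (inv_into UNIV ?p z) = z" for z
    using bij_triangle_perm by (simp_all add: bij_is_inj bij_is_surj surj_f_inv_f)
  obtain LA LB a b where L: "LA \<in> set facets" "LB \<in> set facets" "A = set LA" "B = set LB"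
    "diff LA LB = [a]" "diff LB LA = [b]" "a \<noteq> b"
    "transport_int A B = (if a < b then ?p else inv_into UNIV ?p)" by (rule adj_int_lists[OF adj])
  have "card (set LB \<inter> set LA) = 3" using adj L by (simp add: adj_int_def Int_commute)
  from transport_lists[OF L(2,1) this] have "transport_int B A = (if b < a then ?p else inv_into UNIV ?p)"
    using L by (metis Int_commute list.inject)
  then show ?thesis using L(7,8) p by auto
qed

definition potential :: "(int list \<times> perm) list \<Rightarrow> int set \<Rightarrow> pt \<Rightarrow> pt" where
  "potential hs A = app (look hs (sorted_list_of_set A))"

lemma potential_okD:
  assumes ok: "potential_ok E X hs" and adj: "adj_int A B" and E: "set E \<subseteq> A \<inter> B"
    and X: "sorted_list_of_set (A \<inter> B) \<noteq> X"
  shows "transport_int A B \<circ> potential hs A = potential hs B"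
proof -
  let ?p = "triangle_perm (A \<inter> B)"
  obtain LA LB a b where L: "LA \<in> set facets" "LB \<in> set facets" "A = set LA" "B = set LB"
    and ab: "diff LA LB = [a]" "diff LB LA = [b]" "a \<noteq> b"
    and tr: "transport_int A B = (if a < b then ?p else inv_into UNIV ?p)" by (rule adj_int_lists[OF adj])
  have key: "inter LA LB = sorted_list_of_set (A \<inter> B)" "inter LB LA = sorted_list_of_set (A \<inter> B)"
    using inter_sorted_list L by (simp_all add: Int_commute)
  have EL: "set E \<subseteq> set LA" "set E \<subseteq> set LB" using E L by auto
  have h: "potential hs A = app (look hs LA)" "potential hs B = app (look hs LB)"
    using sorted_list_of_facet L by (simp_all add: potential_def)
  have ok: "app (look voltages (inter C D)) (app (look hs C) z) = app (look hs D) z"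
    if C: "C \<in> set facets" "D \<in> set facets" "set E \<subseteq> set C" "set E \<subseteq> set D"
      and cd: "diff C D = [c]" "diff D C = [d]" "c < d" "inter C D \<noteq> X" for C D c d z
  proof -
    let ?st = "filter (sub_list E) facets"
    have "C \<in> set ?st" "D \<in> set ?st" using C by simp_all
    moreover have "\<forall>A\<in>set ?st. \<forall>B\<in>set ?st. case (diff A B, diff B A) of ([a], [b]) \<Rightarrow>
       a < b \<longrightarrow> inter A B \<noteq> X \<longrightarrow> list_all (\<lambda>z. app (look voltages (inter A B)) (app (look hs A) z) = app (look hs B) z) pts
       | _ \<Rightarrow> True"
      using ok unfolding potential_ok_def Let_def list_all_iff[of _ ?st] by (elim conjE)
    ultimately have "case (diff C D, diff D C) of ([a], [b]) \<Rightarrow>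
       a < b \<longrightarrow> inter C D \<noteq> X \<longrightarrow> list_all (\<lambda>z. app (look voltages (inter C D)) (app (look hs C) z) = app (look hs D) z) pts
       | _ \<Rightarrow> True" by blast
    then show ?thesis using cd by (simp add: list_all_iff set_pts)
  qed
  consider "a < b" | "b < a" using ab by linarith
  then show ?thesis
  proof cases
    case 1
    have "?p (potential hs A x) = potential hs B x" for x
      unfolding triangle_perm_def h by (rule ok[OF L(1,2) EL ab(1,2) 1, unfolded key, OF X])
    then show ?thesis using tr 1 by auto
  next
    case 2
    \<comment> \<open>Here the table is read from \<open>B\<close> to \<open>A\<close>; applying the
      inverse permutation turns the equation around.\<close>
    have "?p (potential hs B x) = potential hs A x" for x
      unfolding triangle_perm_def h by (rule ok[OF L(2,1) EL(2,1) ab(2,1) 2, unfolded key, OF X])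
    then show ?thesis using tr 2 bij_is_inj[OF bij_triangle_perm[of "A \<inter> B"]] by (auto simp: fun_eq_iff inv_f_eq)
  qed
qed

lemma swap_image:
  assumes "x \<in> S \<longleftrightarrow> y \<in> S" shows "swap x y ` S = S"
proof
  have mem: "swap x y z \<in> S" if "z \<in> S" for z
    unfolding swap_def using that assms by metis
  then show "swap x y ` S \<subseteq> S" by blast
  show "S \<subseteq> swap x y ` S"
  proof
    fix z assume "z \<in> S"
    moreover have "z = swap x y (swap x y z)" by (auto simp: swap_def)
    ultimately show "z \<in> swap x y ` S" using mem by blast
  qed
qed

text \<open>A transposition of \<open>x\<close> and \<open>y\<close> is invisible to sets that
  contain both or neither, so on such sets the crossing acts as if there were no cut.\<close>

lemma jump_okD:
  assumes ok: "jump_ok E X x y hs" and adj: "adj_int A B" and E: "set E \<subseteq> A \<inter> B"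
    and X: "sorted_list_of_set (A \<inter> B) = X" and S: "x \<in> S \<longleftrightarrow> y \<in> S"
  shows "transport_int A B ` potential hs A ` S = potential hs B ` S"
proof -
  let ?p = "triangle_perm (A \<inter> B)"
  obtain LA LB a b where L: "LA \<in> set facets" "LB \<in> set facets" "A = set LA" "B = set LB"
    and ab: "diff LA LB = [a]" "diff LB LA = [b]" "a \<noteq> b"
    and tr: "transport_int A B = (if a < b then ?p else inv_into UNIV ?p)" by (rule adj_int_lists[OF adj])
  have key: "inter LA LB = sorted_list_of_set (A \<inter> B)" "inter LB LA = sorted_list_of_set (A \<inter> B)"
    using inter_sorted_list L by (simp_all add: Int_commute)
  have EL: "set E \<subseteq> set LA" "set E \<subseteq> set LB" using E L by auto
  have h: "potential hs A = app (look hs LA)" "potential hs B = app (look hs LB)"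
    using sorted_list_of_facet L by (simp_all add: potential_def)
  have ok: "app (look voltages (inter C D)) (app (look hs C) z) = app (look hs D) (swap x y z)"
    if C: "C \<in> set facets" "D \<in> set facets" "set E \<subseteq> set C" "set E \<subseteq> set D"
      and cd: "diff C D = [c]" "diff D C = [d]" "c < d" "inter C D = X" for C D c d z
  proof -
    let ?st = "filter (sub_list E) facets"
    have "C \<in> set ?st" "D \<in> set ?st" using C by simp_all
    moreover have "\<forall>A\<in>set ?st. \<forall>B\<in>set ?st. case (diff A B, diff B A) of ([a], [b]) \<Rightarrow>
       a < b \<longrightarrow> inter A B = X \<longrightarrow> list_all (\<lambda>z. app (look voltages (inter A B)) (app (look hs A) z) = app (look hs B) (swap x y z)) pts
       | _ \<Rightarrow> True"
      using ok unfolding jump_ok_def Let_def list_all_iff[of _ ?st] .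
    ultimately have "case (diff C D, diff D C) of ([a], [b]) \<Rightarrow>
       a < b \<longrightarrow> inter C D = X \<longrightarrow> list_all (\<lambda>z. app (look voltages (inter C D)) (app (look hs C) z) = app (look hs D) (swap x y z)) pts
       | _ \<Rightarrow> True" by blast
    then show ?thesis using cd by (simp add: list_all_iff set_pts)
  qed
  consider "a < b" | "b < a" using ab by linarith
  then show ?thesis
  proof cases
    case 1
    have "?p (potential hs A z) = potential hs B (swap x y z)" for z
      unfolding triangle_perm_def h by (rule ok[OF L(1,2) EL ab(1,2) 1, unfolded key, OF X])
    then have "?p ` potential hs A ` S = potential hs B ` swap x y ` S" by (simp add: image_image)
    then show ?thesis using tr 1 swap_image[OF S] by simp
  next
    case 2
    have "?p (potential hs B z) = potential hs A (swap x y z)" for z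
      unfolding triangle_perm_def h by (rule ok[OF L(2,1) EL(2,1) ab(2,1) 2, unfolded key, OF X])
    then have "?p ` potential hs B ` S = potential hs A ` swap x y ` S" by (simp add: image_image)
    then have "potential hs A ` S = ?p ` potential hs B ` S" using swap_image[OF S] by simp
    then show ?thesis using tr 2 bij_is_inj[OF bij_triangle_perm[of "A \<inter> B"]] by (simp add: image_image)
  qed
qed

definition knot_edges :: "int set set" where "knot_edges = set ` set branch_edges"

lemma knot_edges: "finite knot_edges" "card knot_edges + 2 \<le> CARD(pt)"
proof -
  have "card knot_edges \<le> card (set branch_edges)" unfolding knot_edges_def by (rule card_image_le) simp
  also have "\<dots> \<le> length branch_edges" by (rule card_length)
  also have "\<dots> = 3" by (simp add: branch_edges_def)
  finally show "card knot_edges + 2 \<le> CARD(pt)" by (simp add: card_pt)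
qed (simp add: knot_edges_def)

lemma flat_edge:
  assumes E: "card E = 2" "E \<notin> knot_edges"
  shows "\<exists>h :: int set \<Rightarrow> pt \<Rightarrow> pt. (\<forall>A. bij (h A)) \<and>
    (\<forall>A B. adj_int A B \<longrightarrow> E \<subseteq> A \<inter> B \<longrightarrow> transport_int A B \<circ> h A = h B)"
proof (cases "E \<in> set ` set (map fst flat_data)")
  case True
  then obtain Es hs where hs: "(Es, hs) \<in> set flat_data" "E = set Es" by auto
  then have ok: "potential_ok Es [] hs" using flat_data_ok by (auto simp: list_all_iff)
  have "bij (potential hs A)" for A
    using ok bij_look[of hs] by (auto simp: potential_def potential_ok_def Let_def)
  moreover have "transport_int A B \<circ> potential hs A = potential hs B" if "adj_int A B" "E \<subseteq> A \<inter> B" for A B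
  proof (rule potential_okD[OF ok that(1)])
    have "card (A \<inter> B) = 3" using that by (simp add: adj_int_def)
    then have "finite (A \<inter> B)" "A \<inter> B \<noteq> {}" by (auto intro: card_ge_0_finite)
    then show "sorted_list_of_set (A \<inter> B) \<noteq> []" by simp
  qed (use that hs in simp)
  ultimately show ?thesis by (intro exI[of _ "potential hs"]) simp
next
  case False
  \<comment> \<open>A triangle at \<open>E\<close> with an entry in \<open>voltages\<close> would
    have all its edges in one of the tables by \<open>flat_data_complete\<close>, and
    \<open>E\<close> is in none. So the default value of \<open>look\<close> applies.\<close>
  have "transport_int A B = id" if adj: "adj_int A B" and EAB: "E \<subseteq> A \<inter> B" for A B
  proof -
    let ?t = "sorted_list_of_set (A \<inter> B)"
    have "card (A \<inter> B) = 3" using adj by (simp add: adj_int_def)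
    then have st: "set ?t = A \<inter> B" by (simp add: card_ge_0_finite)
    have "map_of voltages ?t = None"
    proof (rule ccontr)
      assume "map_of voltages ?t \<noteq> None"
      then obtain p where p: "(?t, p) \<in> set voltages" by (auto dest: map_of_SomeD)
      then have "case ?t of [x, y, z] \<Rightarrow>
         list_all (\<lambda>E. List.member (map fst flat_data) E \<or> List.member branch_edges E) [[x, y], [x, z], [y, z]]
         | _ \<Rightarrow> False"
        using bspec[OF flat_data_complete[unfolded list_all_iff[of _ voltages]] p] by simp
      then obtain x y z where xyz: "?t = [x, y, z]"
        and "list_all (\<lambda>E. List.member (map fst flat_data) E \<or> List.member branch_edges E) [[x, y], [x, z], [y, z]]"
        by (auto split: list.splits)
      then have cov: "\<forall>E\<in>{[x, y], [x, z], [y, z]}. E \<in> set (map fst flat_data) \<or> E \<in> set branch_edges"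
        unfolding list_all_iff List.member_iff by simp
      have no: "set Es \<noteq> E" if "Es \<in> {[x, y], [x, z], [y, z]}" for Es
        using bspec[OF cov that] False E(2) by (auto simp: knot_edges_def)
      obtain u v where uv: "E = {u, v}" "u \<noteq> v" using E(1) by (auto simp: card_2_iff)
      then have "u \<in> {x, y, z}" "v \<in> {x, y, z}" using EAB st xyz by auto
      then have "E = {x, y} \<or> E = {x, z} \<or> E = {y, z}"
        using uv by (elim insertE emptyE) (simp_all add: insert_commute)
      then show False using no[of "[x, y]"] no[of "[x, z]"] no[of "[y, z]"] by auto
    qed
    then have "triangle_perm (A \<inter> B) = id" by (simp add: triangle_perm_def look_def)
    then show ?thesis using adj by (elim adj_int_lists) (simp add: inv_id[unfolded id_def] id_def inv_f_eq)
  qed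
  then show ?thesis by (intro exI[of _ "\<lambda>_. id"]) (simp add: bij_id)
qed

lemma cut_edge:
  assumes E: "E \<in> knot_edges" and adj: "adj_int A B" and EAB: "E \<subseteq> A \<inter> B"
  shows "\<exists>(h :: int set \<Rightarrow> pt \<Rightarrow> pt) x y. (\<forall>C. bij (h C)) \<and>
    (\<forall>C D. adj_int C D \<longrightarrow> E \<subseteq> C \<inter> D \<longrightarrow> C \<inter> D \<noteq> A \<inter> B \<longrightarrow> transport_int C D \<circ> h C = h D) \<and>
    (\<forall>S. (x \<in> S \<longleftrightarrow> y \<in> S) \<longrightarrow> transport_int A B ` h A ` S = h B ` S)"
proof -
  obtain Es where Es: "Es \<in> set branch_edges" "E = set Es" using E by (auto simp: knot_edges_def)
  obtain LA LB a b where L: "LA \<in> set facets" "LB \<in> set facets" "A = set LA" "B = set LB"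
    and ab: "diff LA LB = [a]" "diff LB LA = [b]" by (rule adj_int_lists[OF adj])
  have "(Es, inter LA LB) \<in> set (map (\<lambda>(E, X, _). (E, X)) cut_data)"
  proof -
    have "\<forall>C\<in>set facets. \<forall>D\<in>set facets. set Es \<subseteq> set C \<longrightarrow> set Es \<subseteq> set D \<longrightarrow> (case (diff C D, diff D C) of ([a], [b]) \<Rightarrow>
       (Es, inter C D) \<in> set (map (\<lambda>(E, X, _). (E, X)) cut_data) | _ \<Rightarrow> True)"
      using cut_data_complete Es(1) unfolding Let_def list_all_iff List.member_iff by auto
    from this[rule_format, OF L(1,2)] show ?thesis using L Es EAB ab by simp
  qed
  then obtain x y hs where hs: "(Es, inter LA LB, x, y, hs) \<in> set cut_data" by auto
  let ?X = "sorted_list_of_set (A \<inter> B)"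
  have "inter LA LB = ?X" using inter_sorted_list L by simp
  then have ok: "potential_ok Es ?X hs" "jump_ok Es ?X x y hs"
    using hs cut_data_ok by (auto simp: list_all_iff)
  have "bij (potential hs A)" for A
    using ok(1) bij_look[of hs] by (auto simp: potential_def potential_ok_def Let_def)
  moreover have "transport_int C D \<circ> potential hs C = potential hs D"
    if "adj_int C D" "E \<subseteq> C \<inter> D" "C \<inter> D \<noteq> A \<inter> B" for C D
  proof (rule potential_okD[OF ok(1) that(1)])
    have "finite (C \<inter> D)" "finite (A \<inter> B)" using that adj by (auto simp: adj_int_def intro: card_ge_0_finite)
    then show "sorted_list_of_set (C \<inter> D) \<noteq> ?X" using that(3) by (metis set_sorted_list_of_set)
  qed (use that Es in simp)
  moreover have "transport_int A B ` potential hs A ` S = potential hs B ` S" if "x \<in> S \<longleftrightarrow> y \<in> S" for S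
    by (rule jump_okD[OF ok(2) adj _ refl that]) (use EAB Es in simp)
  ultimately show ?thesis by blast
qed

lemma walk_list_parallel:
  assumes f: "\<And>A B. adj_int A B \<Longrightarrow> f B = transport_int A B ` f A"
  shows "walk_list w x = Some (B, y) \<Longrightarrow> x \<in> f (set (hd w)) \<Longrightarrow> y \<in> f (set B)"
proof (induction w x rule: walk_list.induct)
  case (3 A C w x)
  then obtain z where z: "step_list A C x = Some z" "walk_list (C # w) z = Some (B, y)" by (auto split: option.splits)
  from z(1) have AC: "A \<in> set facets" "C \<in> set facets" by (auto simp: step_list_def List.member_iff split: if_splits)
  obtain a b where ab: "diff A C = [a]" "diff C A = [b]"
    using z(1) by (auto simp: step_list_def Let_def split: if_splits list.splits)
  have "card (set A - set C) = 1" using ab(1) by (simp flip: set_diff)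
  then have c3: "card (set A \<inter> set C) = 3"
    using card_Diff_subset_Int[of "set A" "set C"] facets_D(3)[OF AC(1)] card_mono[of "set A" "set A \<inter> set C"] by simp
  obtain tr: "transport_int (set A) (set C) = (if a < b then triangle_perm (set A \<inter> set C) else inv_into UNIV (triangle_perm (set A \<inter> set C)))"
    using transport_lists[OF AC c3] ab by (metis list.inject)
  have key: "triangle_perm (set A \<inter> set C) = app (look voltages (inter A C))"
    using inter_sorted_list[OF AC(1)] by (simp add: triangle_perm_def)
  have "z = transport_int (set A) (set C) x"
  proof (cases "a < b")
    case True
    then show ?thesis using z(1) ab AC tr key by (auto simp: step_list_def Let_def List.member_iff)
  next
    case False
    then have "triangle_perm (set A \<inter> set C) z = x"
      using z(1) ab AC key by (auto simp: step_list_def Let_def List.member_iff find_Some_iff)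
    then show ?thesis using tr False bij_is_inj[OF bij_triangle_perm] by (auto simp: inv_f_eq)
  qed
  moreover have "adj_int (set A) (set C)" using AC c3 by (auto simp: adj_int_def knot_facets_def)
  ultimately have "z \<in> f (set C)" using f "3.prems"(2) by auto
  then show ?case using "3.IH"[OF z] by simp
qed auto

text \<open>The closed walks pass membership of sheets over one facet around a 5-cycle, so a
  parallel family contains all of them or none.\<close>

lemma cover_connected:
  "\<exists>R. \<forall>f. (\<forall>A B. adj_int A B \<longrightarrow> f B = transport_int A B ` f A) \<longrightarrow> f R = {} \<or> f R = UNIV"
proof (intro exI[of _ "set [0,2,5,7]"] allI impI)
  fix f assume f: "\<forall>A B. adj_int A B \<longrightarrow> f B = transport_int A B ` f A"
  let ?R = "set [0,2,5,7] :: int set"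
  have w: "x \<in> f ?R \<Longrightarrow> y \<in> f ?R" if xy: "(x, y) \<in> set (map (\<lambda>(x, y, w). (x, y)) walks)" for x y
  proof -
    assume x: "x \<in> f ?R"
    obtain w where "(x, y, w) \<in> set walks" using xy by auto
    then have w: "hd w = [0,2,5,7]" "walk_list w x = Some ([0,2,5,7], y)" using walks_ok by (auto simp: list_all_iff)
    show "y \<in> f ?R" by (rule walk_list_parallel[OF _ w(2)]) (use f x w(1) in auto)
  qed
  have c: "P0 \<in> f ?R \<Longrightarrow> P3 \<in> f ?R" "P3 \<in> f ?R \<Longrightarrow> P1 \<in> f ?R" "P1 \<in> f ?R \<Longrightarrow> P2 \<in> f ?R"
    "P2 \<in> f ?R \<Longrightarrow> P4 \<in> f ?R" "P4 \<in> f ?R \<Longrightarrow> P0 \<in> f ?R"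
    by (erule w[rotated], simp add: walks_cycle)+
  show "f ?R = {} \<or> f ?R = UNIV"
  proof (cases "P0 \<in> f ?R")
    case True
    have "x \<in> f ?R" for x
      by (cases x) (simp_all only: True c(1)[OF True] c(2)[OF c(1)[OF True]] c(3)[OF c(2)[OF c(1)[OF True]]]
        c(4)[OF c(3)[OF c(2)[OF c(1)[OF True]]]])
    then show ?thesis by blast
  next
    case False
    have "P4 \<notin> f ?R" using c(5) False by blast
    then have "P2 \<notin> f ?R" using c(4) by blast
    then have "P1 \<notin> f ?R" using c(3) by blast
    then have "P3 \<notin> f ?R" using c(2) by blast
    have "x \<notin> f ?R" for x by (cases x) (simp_all only: False \<open>P1 \<notin> f ?R\<close> \<open>P2 \<notin> f ?R\<close> \<open>P3 \<notin> f ?R\<close> \<open>P4 \<notin> f ?R\<close> not_False_eq_True)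
    then show ?thesis by blast
  qed
qed

interpretation knot: branched_complex knot_facets transport_int knot_edges adj_int
proof unfold_locales
  show "knot_facets \<noteq> {}" by (simp add: knot_facets_def facets_def)
qed (use knot_facets(1,3) knot_edges bij_transport transport_inverse flat_edge cut_edge cover_connected in
    \<open>simp_all add: adj_int_def\<close>)

(* Every finite simplicial complex of dimension 3 has a geometric realization in R^7. *)
theorem corollary2p15:
  shows "\<exists>\<C> :: (real^7) set set. simplicial_3_sphere \<C> \<and> \<not> LC 3 \<C>"
proof (intro exI conjI)
  show "simplicial_3_sphere (simplex_on ` faces_of knot_facets)"
    unfolding simplicial_3_sphere_def knot.Union_faces
    using simplicial_complex_simplex_on[of knot_facets] knot_facets sphere_facets by simp
  show "\<not> LC 3 (simplex_on ` faces_of knot_facets)" by (rule knot.not_LC)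
qed

end
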